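(* Let $k\ge 2$ and let $\boldsymbol X$ be a Kotz Type III elliptical random vector in $\mathbb R^k$, i.e. $\boldsymbol X\stackrel{d}{=}A^\top R\,\boldsymbol U$, where $A\in\mathbb R^{k\times k}$ is a non-singular matrix such that $\Sigma:=A^\top A$ is a correlation matrix, $\boldsymbol U$ is uniformly distributed on the unit sphere of $\mathbb R^k$, and $R>0$ is a random variable independent of $\boldsymbol U$ with $$\boldsymbol P\{R>u\}=(1+o(1))\,p\,u^{N}\exp(-q u^{\delta}),\quad u\to\infty,$$ for some constants $\delta>0$, $p>0$, $q>0$, $N\in\mathbb R$. Let $t_n$, $n\ge 1$, be positive constants with $\lim_{n\to\infty}t_n=\infty$ and let $\boldsymbol a\in\mathbb R^k\setminus(-\infty,0]^k$. Let $I$ be the minimal index set of the quadratic programming problem $\boldsymbol Q(\Sigma,\boldsymbol a)$, let $J:=\{1,\dots,k\}\setminus I$, and $\|\boldsymbol a_I\|:=(\boldsymbol a_I^\top\Sigma_{II}^{-1}\boldsymbol a_I)^{1/2}$. Define $\boldsymbol v_n\in\mathbb R^k$ by $$(\boldsymbol v_n)_I:=q\delta\,(t_n\|\boldsymbol a_I\|)^{\delta-1}\boldsymbol 1_I,\qquad\text{and, if } |I|<k,\quad (\boldsymbol v_n)_J:=\sqrt{q\delta}\,(t_n\|\boldsymbol a_I\|)^{\delta/2-1}\boldsymbol 1_J .$$ Let $\boldsymbol V_{n;\boldsymbol a}$ be a random vector whose distribution is the conditional distribution of $\boldsymbol X-t_n\boldsymbol a$ given $\boldsymbol X>t_n\boldsymbol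 a$. Then we have the convergence in distribution $$\boldsymbol v_n\boldsymbol V_{n;\boldsymbol a}\stackrel{d}{\to}\boldsymbol W,\qquad n\to\infty,$$ where $\boldsymbol W_I$ has independent components with survivor functions $$\exp\bigl(-s\,\boldsymbol a_I^\top\Sigma_{II}^{-1}\boldsymbol e_i/\|\boldsymbol a_I\|\bigr),\quad i\in I,\ s>0.$$ Furthermore, if $|I|<k$, then $\boldsymbol W_I$ is independent of $\boldsymbol W_J$, which has partial survivor function $$\boldsymbol P\{\boldsymbol W_L>\boldsymbol x_L\}=\frac{\boldsymbol P\{\boldsymbol Z_J>\infty(\boldsymbol a_J-\Sigma_{JI}\Sigma_{II}^{-1}\boldsymbol a_I)+\boldsymbol x^*_J\mid\boldsymbol Z_I=\boldsymbol 0_I\}}{\boldsymbol P\{\boldsymbol Z_J>\infty(\boldsymbol a_J-\Sigma_{JI}\Sigma_{II}^{-1}\boldsymbol a_I)\mid\boldsymbol Z_I=\boldsymbol 0_I\}},\qquad \forall\,\boldsymbol x\in[0,\infty)^k,\ L\subset J,$$ where $\boldsymbol x^*_J\in\mathbb R^{|J|}$ is given by $\boldsymbol x^*_L:=\boldsymbol x_L$ and, if $|J|>|L|$, $\boldsymbol x^*_{J\setminus L}:=\boldsymbol 0_{J\setminus L}$, and $\boldsymbol Z$ is a standard (mean-zero) Gaussian random vector in $\mathbb R^k$ with covariance matrix $\Sigma$. Here $\infty\cdot 0$ is interpreted as $0$.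
   Context: Notation. For $\boldsymbol x\in\mathbb R^k$ and $K\subset\{1,\dots,k\}$, $\boldsymbol x_K=(x_i,i\in K)^\top$ is the subvector, and $|K|$ is the number of elements of $K$. For index sets $K,L$, $\Sigma_{KL}$ is the submatrix of $\Sigma$ with rows in $K$ and columns in $L$; $\Sigma_{II}^{-1}$ means $(\Sigma_{II})^{-1}$. Inequalities between vectors are componentwise ($\boldsymbol x>\boldsymbol y$ means $x_i>y_i$ for all $i$; similarly $\ge$). The product $\boldsymbol v\boldsymbol x$ of two vectors is componentwise. $\boldsymbol 0$ and $\boldsymbol 1$ are the vectors of zeros and ones. $\boldsymbol e_i$, $i\in I$, is the $i$-th unit vector of $\mathbb R^{|I|}$ (coordinates indexed by $I$). A correlation matrix here is a positive definite symmetric matrix with all diagonal entries equal to 1. Minimal index set. The problem $\boldsymbol Q(\Sigma,\boldsymbol a)$, $\boldsymbol a\in\mathbb R^k\setminus(-\infty,0]^k$, is: minimise $\boldsymbol x^\top\Sigma^{-1}\boldsymbol x$ under the linear constraint $\boldsymbol x\ge\boldsymbol a$. It has a unique solution $\widetilde{\boldsymbol a}$ defined by a unique non-empty index set $I\subset\{1,\dots,k\}$, called the minimal index set, such that, with $J=\{1,\dots,k\}\setminus I$: $\widetilde{\boldsymbol a}_I=\boldsymbol a_I>\boldsymbol 0_I$, $\Sigma_{II}^{-1}\boldsymbol a_I>\boldsymbol 0_I$, the minimum is $\widetilde{\boldsymbol a}^\top\Sigma^{-1}\widetilde{\boldsymbol a}=\boldsymbol a_I^\top\Sigma_{II}^{-1}\boldsymbol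 a_I>0$, and, if $|I|<k$, $\widetilde{\boldsymbol a}_J=\Sigma_{JI}\Sigma_{II}^{-1}\boldsymbol a_I\ge\boldsymbol a_J$. Convention. Since $\boldsymbol a_J-\Sigma_{JI}\Sigma_{II}^{-1}\boldsymbol a_I\le\boldsymbol 0_J$, the vector $\infty(\boldsymbol a_J-\Sigma_{JI}\Sigma_{II}^{-1}\boldsymbol a_I)$ has components $-\infty$ (where the component of the difference is negative) or $0$ (where it is zero). The conditional law of $\boldsymbol Z_J$ given $\boldsymbol Z_I=\boldsymbol 0_I$ is the mean-zero Gaussian law with covariance matrix $\Sigma_{JJ}-\Sigma_{JI}\Sigma_{II}^{-1}\Sigma_{IJ}$. *)

theory Defs
  imports "HOL-Probability.Probability"
begin

text \<open>
  Vectors and matrices are indexed by a finite type \<open>'k\<close>, whose cardinality is the dimension k.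
  A subvector or submatrix is kept at full size and padded with zeros outside the selected indices.
  Sums and products of matching padded blocks are then the padded sums and products of the blocks,
  and the entries at selected indices are those of the genuine subvector or submatrix.
\<close>

definition subvec :: "real ^ 'k \<Rightarrow> 'k set \<Rightarrow> real ^ 'k" where
  "subvec x K = (\<chi> i. if i \<in> K then x $ i else 0)"

definition submat :: "real ^ 'k ^ 'k \<Rightarrow> 'k set \<Rightarrow> 'k set \<Rightarrow> real ^ 'k ^ 'k" where
  "submat S K L = (\<chi> i j. if i \<in> K \<and> j \<in> L then S $ i $ j else 0)"

text \<open>
  The padded form of the inverse of the principal submatrix with index set \<open>K\<close>;
  \<open>submat (mat 1) K K\<close> is the padded identity matrix.
\<close>

definition is_sub_inv :: "real ^ 'k ^ 'k \<Rightarrow> 'k::finite set \<Rightarrow> real ^ 'k ^ 'k \<Rightarrow> bool" where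
  "is_sub_inv S K B \<longleftrightarrow> submat B K K = B \<and>
     submat S K K ** B = submat (mat 1) K K \<and> B ** submat S K K = submat (mat 1) K K"

definition sub_inv :: "real ^ 'k ^ 'k \<Rightarrow> 'k::finite set \<Rightarrow> real ^ 'k ^ 'k" where
  "sub_inv S K = (THE B. is_sub_inv S K B)"

definition sub_det :: "real ^ 'k ^ 'k \<Rightarrow> 'k::finite set \<Rightarrow> real" where
  "sub_det S K = (\<Sum>p | p permutes K. of_int (sign p) * (\<Prod>i\<in>K. S $ i $ p i))"

definition correlation_matrix :: "real ^ 'k ^ 'k \<Rightarrow> bool" where
  "correlation_matrix S \<longleftrightarrow>
     transpose S = S \<and> (\<forall>x. x \<noteq> 0 \<longrightarrow> 0 < x \<bullet> (S *v x)) \<and> (\<forall>i. S $ i $ i = 1)"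

text \<open>The description in \<open>sub_inv\<close> is satisfied by exactly one matrix.\<close>

lemma is_sub_inv_iff:
  assumes "correlation_matrix S"
  shows "is_sub_inv S K B \<longleftrightarrow> B = sub_inv S K"
proof -
  define P where "P = submat S K K + submat (mat 1) (- K) (- K)"
  have row: "(P ** Q) $ i $ j = (submat S K K ** submat Q K K) $ i $ j" if "i \<in> K" "j \<in> K" for Q i j
    unfolding P_def matrix_matrix_mult_def submat_def using that
    by (auto intro!: sum.cong)
  have col: "(Q ** P) $ i $ j = (submat Q K K ** submat S K K) $ i $ j" if "i \<in> K" "j \<in> K" for Q i j
    unfolding P_def matrix_matrix_mult_def submat_def using that
    by (auto intro!: sum.cong)
  have out: "submat S1 K K ** submat S2 K K = submat (submat S1 K K ** submat S2 K K) K K"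
    for S1 S2 :: "real ^ 'a ^ 'a"
    unfolding matrix_matrix_mult_def submat_def by (auto simp: vec_eq_iff)
  have sub_cong: "submat Y K K = submat Z K K" if "\<And>i j. i \<in> K \<Longrightarrow> j \<in> K \<Longrightarrow> Y $ i $ j = Z $ i $ j"
    for Y Z :: "real ^ 'a ^ 'a"
    using that by (auto simp: submat_def vec_eq_iff)
  have "x = 0" if "P *v x = 0" for x
  proof -
    have outside: "x $ i = 0" if "i \<notin> K" for i
    proof -
      have "P $ i $ j = (if j = i then 1 else 0)" for j
        unfolding P_def submat_def mat_def using that by auto
      then have "(P *v x) $ i = x $ i"
        unfolding matrix_vector_mult_def by (simp add: if_distrib[of "\<lambda>u. u * y" for y] cong: if_cong)
      then show ?thesis using \<open>P *v x = 0\<close> by simp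
    qed
    have inside: "(P *v x) $ i = (S *v x) $ i" if "i \<in> K" for i
      unfolding P_def matrix_vector_mult_def submat_def using that outside
      by (auto intro!: sum.cong)
    have "x \<bullet> (S *v x) = (\<Sum>i\<in>UNIV. x $ i * (P *v x) $ i)"
      unfolding inner_vec_def
    proof (intro sum.cong refl)
      fix i show "x $ i \<bullet> (S *v x) $ i = x $ i * (P *v x) $ i"
        using inside[of i] outside[of i] by (cases "i \<in> K") simp_all
    qed
    then have "x \<bullet> (S *v x) = 0" using that by simp
    then show ?thesis using assms unfolding correlation_matrix_def by (cases "x = 0") fastforce+
  qed
  then have "invertible P" unfolding invertible_left_inverse matrix_left_invertible_ker by blast
  then obtain Q where Q: "P ** Q = mat 1" "Q ** P = mat 1" unfolding invertible_def by blast
  have ex: "is_sub_inv S K (submat Q K K)"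
    unfolding is_sub_inv_def
  proof (intro conjI)
    show "submat (submat Q K K) K K = submat Q K K" by (simp add: submat_def vec_eq_iff)
    show "submat S K K ** submat Q K K = submat (mat 1) K K"
      by (subst out) (rule sub_cong, simp only: row[symmetric] Q(1))
    show "submat Q K K ** submat S K K = submat (mat 1) K K"
      by (subst out) (rule sub_cong, simp only: col[symmetric] Q(2))
  qed
  have E: "submat (mat 1) K K $ i $ j = (if i = j then of_bool (i \<in> K) else (0::real))" for i j
    by (simp add: submat_def mat_def)
  have delta: "(if b then u else 0) * y = (if b then u * y else 0)"
    "y * (if b then u else 0) = (if b then y * u else 0)" for b and u y :: real
    by simp_all
  have unit: "submat (mat 1) K K ** submat B K K = submat B K K"
    "submat B K K ** submat (mat 1) K K = submat B K K" for B :: "real ^ 'a ^ 'a"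
    by (simp_all add: vec_eq_iff matrix_matrix_mult_def E delta) (auto simp: submat_def)
  have uniq: "B = C" if B: "is_sub_inv S K B" and C: "is_sub_inv S K C" for B C
  proof -
    note B' = B[unfolded is_sub_inv_def] and C' = C[unfolded is_sub_inv_def]
    have "B = B ** submat (mat 1) K K" using unit(2)[of B] B' by simp
    also have "\<dots> = B ** (submat S K K ** C)" using C' by simp
    also have "\<dots> = submat (mat 1) K K ** C" using B' by (simp add: matrix_mul_assoc)
    also have "\<dots> = C" using unit(1)[of C] C' by simp
    finally show ?thesis .
  qed
  have "is_sub_inv S K (sub_inv S K)"
    unfolding sub_inv_def by (rule theI[of "is_sub_inv S K", OF ex]) (rule uniq[OF _ ex])
  then show ?thesis using uniq by blast
qed

definition sub_norm :: "real ^ 'k ^ 'k \<Rightarrow> 'k::finite set \<Rightarrow> real ^ 'k \<Rightarrow> real" where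
  "sub_norm S K x = sqrt (subvec x K \<bullet> (sub_inv S K *v subvec x K))"

definition schur_compl :: "real ^ 'k ^ 'k \<Rightarrow> 'k::finite set \<Rightarrow> real ^ 'k ^ 'k" where
  "schur_compl S I =
     submat S (- I) (- I) - submat S (- I) I ** sub_inv S I ** submat S I (- I)"

definition qp_solution :: "real ^ 'k ^ 'k \<Rightarrow> real ^ 'k \<Rightarrow> real ^ 'k::finite \<Rightarrow> bool" where
  "qp_solution S a y \<longleftrightarrow>
     (\<forall>i. a $ i \<le> y $ i) \<and>
     (\<forall>x. (\<forall>i. a $ i \<le> x $ i) \<longrightarrow> y \<bullet> (matrix_inv S *v y) \<le> x \<bullet> (matrix_inv S *v x))"

text \<open>
  The literature sometimes lists positivity of \<open>a\<close> on \<open>I\<close> among the properties of the minimal index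
  set. It is not required here, because it can fail: for k = 2, correlation -9/10 and a = (1, -1/2)
  the minimal index set is {1, 2}. The conditions below determine \<open>I\<close>: it is the set of indices
  at which \<open>matrix_inv S *v y\<close> is positive, for the unique minimiser \<open>y\<close>.
\<close>

definition minimal_index_set :: "real ^ 'k ^ 'k \<Rightarrow> real ^ 'k \<Rightarrow> 'k::finite set \<Rightarrow> bool" where
  "minimal_index_set S a I \<longleftrightarrow> I \<noteq> {} \<and>
     (\<exists>y. qp_solution S a y \<and>
        (\<forall>i\<in>I. y $ i = a $ i) \<and>
        (\<forall>i\<in>I. 0 < (sub_inv S I *v subvec a I) $ i) \<and>
        y \<bullet> (matrix_inv S *v y) = subvec a I \<bullet> (sub_inv S I *v subvec a I) \<and>
        0 < subvec a I \<bullet> (sub_inv S I *v subvec a I) \<and>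
        (\<forall>j\<in>- I. y $ j = (submat S (- I) I *v (sub_inv S I *v subvec a I)) $ j \<and> a $ j \<le> y $ j))"

text \<open>
  Normalised surface measure on the unit sphere, as the radial projection of the uniform
  distribution on the unit ball.
\<close>

definition sphere_uniform :: "('a::euclidean_space) measure" where
  "sphere_uniform = distr (uniform_measure lborel (ball 0 1)) borel sgn"

text \<open>
  Independence of two random variables with values in different types: the library constant
  \<open>indep_var\<close> requires equal types.
\<close>

definition indep_rv ::
    "'m measure \<Rightarrow> ('m \<Rightarrow> 'a::topological_space) \<Rightarrow> ('m \<Rightarrow> 'b::topological_space) \<Rightarrow> bool" where
  "indep_rv M X Y \<longleftrightarrow>
     prob_space.indep_set M (sets (vimage_algebra (space M) X borel))
                            (sets (vimage_algebra (space M) Y borel))"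

text \<open>
  The mean-zero Gaussian law on the coordinates in \<open>K\<close>, for a covariance matrix \<open>C\<close> whose principal
  submatrix on \<open>K\<close> is positive definite. For empty \<open>K\<close> it is the point mass on the empty tuple.
\<close>

definition gaussian_law :: "real ^ 'k ^ 'k \<Rightarrow> 'k::finite set \<Rightarrow> ('k \<Rightarrow> real) measure" where
  "gaussian_law C K = density (\<Pi>\<^sub>M i\<in>K. lborel)
     (\<lambda>z. ennreal (exp (- (\<Sum>i\<in>K. \<Sum>j\<in>K. z i * sub_inv C K $ i $ j * z j) / 2)
                     / sqrt ((2 * pi) ^ card K * sub_det C K)))"

text \<open>
  The conditional law of the coordinates outside \<open>I\<close> of a mean-zero Gaussian vector with covariance
  matrix \<open>S\<close>, given that its coordinates in \<open>I\<close> are zero.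
\<close>

definition gaussian_cond_zero :: "real ^ 'k ^ 'k \<Rightarrow> 'k::finite set \<Rightarrow> ('k \<Rightarrow> real) measure" where
  "gaussian_cond_zero S I = gaussian_law (schur_compl S I) (- I)"

text \<open>The conditional law of \<open>X - b\<close> given that \<open>X > b\<close> componentwise.\<close>

definition excess_law :: "'x measure \<Rightarrow> ('x \<Rightarrow> real ^ 'k) \<Rightarrow> real ^ 'k::finite \<Rightarrow> (real ^ 'k) measure" where
  "excess_law MX X b =
     distr (uniform_measure MX {\<omega> \<in> space MX. \<forall>i. b $ i < X \<omega> $ i}) borel (\<lambda>\<omega>. X \<omega> - b)"

text \<open>
  Convergence in distribution on a general topological space; the library's \<open>weak_conv\<close> is
  restricted to the real line.
\<close>

definition weak_limit :: "(nat \<Rightarrow> ('a::topological_space) measure) \<Rightarrow> 'a measure \<Rightarrow> bool" where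
  "weak_limit \<mu> \<nu> \<longleftrightarrow>
     (\<forall>f :: 'a \<Rightarrow> real. continuous_on UNIV f \<and> bounded (range f) \<longrightarrow>
        (\<lambda>n. \<integral>x. f x \<partial>\<mu> n) \<longlonglongrightarrow> (\<integral>x. f x \<partial>\<nu>))"

end

theory Submission
  imports Defs "HOL-Real_Asymp.Real_Asymp"
begin

text \<open>
  The radial variable has a regular tail but, in general, no density, so densities of the elliptical
  vector are not available. The proof first multiplies the vector by an independent random factor
  whose logarithm is uniform on a short interval. The smoothed vector has a Lebesgue density, namely
  a constant times
    \<open>P(norm g * exp (- h) < R \<le> norm g) / (h * norm g ^ k)\<close>
  at \<open>g\<close>, before the linear map is applied (\<open>log_uniform_smoothing_density\<close>). This needs only the
  tail function of \<open>R\<close>, and so the tail hypothesis can be inserted directly.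
  
  Let \<open>u\<close> be the Mahalanobis norm of the scaled minimiser of the quadratic programme, and let
  \<open>m = q * \<delta> * u powr \<delta>\<close>, which tends to infinity. Around the minimiser use coordinates \<open>y\<close> at scale
  \<open>u / m\<close> in the directions of \<open>I\<close>, and at scale \<open>u / sqrt m\<close> for the residual of the other coordinates
  after regression on those in \<open>I\<close>. By the block form of the inverse matrix (\<open>inverse_form_blocks\<close>) the
  squared Mahalanobis norm is \<open>u\<^sup>2 * (1 + 2 * \<Lambda> / m + O(1 / m\<^sup>2))\<close>, where \<open>\<Lambda>\<close> is linear in the coordinates
  in \<open>I\<close> and quadratic in the others. Hence the tail changes by the factor \<open>exp (- \<Lambda>)\<close>, which is the
  product of independent exponential laws and of the Gaussian law with the Schur complement as
  covariance matrix. With the smoothing range \<open>h = \<eta> / m\<close> the density, divided by a normalising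
  sequence, converges to \<open>(exp \<eta> - 1) / \<eta> * exp (- \<Lambda>)\<close> and is dominated by an integrable function on
  every set where the coordinates in \<open>I\<close> are bounded below (\<open>smoothed_convergence\<close>). The domination
  also replaces a proof of tightness.
  
  A dilation by at most \<open>exp (\<eta> / m)\<close> moves the scaled excess by a multiple of \<open>\<eta>\<close> only. Test functions
  that are continuous on the compact space of extended real vectors are uniformly continuous along
  finite vectors, and the limit does not charge the boundary of the orthant. So the smoothing costs
  an error that vanishes with \<open>\<eta>\<close> (\<open>main_convergence\<close>). The normalising sequence cancels
  in the conditional expectation (\<open>normalised_convergence\<close>).
  
  Outside \<open>I\<close> the threshold is either attained by the minimiser, and then the event asks the Gaussian
  coordinate to be positive, or lies strictly below it, and then the scaled excess tends to \<open>\<infinity>\<close>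
  and imposes no condition. This is the reason for a limit law on extended real vectors.
\<close>

section \<open>Polar integration and smoothing of the radius\<close>

lemma nn_integral_scaleR:
  fixes f :: "'a::euclidean_space \<Rightarrow> ennreal"
  assumes f[measurable]: "f \<in> borel_measurable borel" and c: "c \<noteq> 0"
  shows "(\<integral>\<^sup>+ y. f y \<partial>lborel) = ennreal (\<bar>c\<bar> ^ DIM('a)) * (\<integral>\<^sup>+ y. f (c *\<^sub>R y) \<partial>lborel)"
  by (subst lborel_affine[OF c, of 0])
     (simp add: nn_integral_density nn_integral_distr nn_integral_cmult)

lemma nn_integral_cong_off_point:
  fixes f g :: "'a::euclidean_space \<Rightarrow> ennreal"
  assumes "\<And>x. x \<noteq> c \<Longrightarrow> f x = g x"
  shows "integral\<^sup>N lborel f = integral\<^sup>N lborel g"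
  using AE_lborel_singleton[of c] by (intro nn_integral_cong_AE) (auto elim!: AE_mp intro: assms)

lemma nn_integral_power_tail:
  assumes "0 < a" "0 < (k::nat)"
  shows "(\<integral>\<^sup>+ r. ennreal (1 / r ^ Suc k) * indicator {a..} r \<partial>lborel) = ennreal (1 / (real k * a ^ k))"
proof -
  have "(\<integral>\<^sup>+ r. ennreal (1 / r ^ Suc k) * indicator {a..} r \<partial>lborel) = ennreal (0 - (- 1 / (real k * a ^ k)))"
  proof (rule nn_integral_FTC_atLeast[where F="\<lambda>r. - 1 / (real k * r ^ k)"])
    fix x assume x: "a \<le> x"
    then have "0 < x" using assms by simp
    obtain m where m: "k = Suc m" using assms by (cases k) auto
    have "((\<lambda>r. - (1 / real k) * inverse r ^ Suc m) has_real_derivative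
        - (1 / real k) * ((1 + of_nat m) * (- (inverse x ^ Suc (Suc 0)) * inverse x ^ m))) (at x)"
      using \<open>0 < x\<close> by (intro DERIV_cmult DERIV_power_Suc DERIV_inverse) auto
    moreover have "- (1 / real k) * ((1 + of_nat m) * (- (inverse x ^ Suc (Suc 0)) * inverse x ^ m)) = 1 / x ^ Suc k"
      unfolding m using \<open>0 < x\<close> by (simp add: field_simps)
    ultimately show "((\<lambda>r. - 1 / (real k * r ^ k)) has_real_derivative 1 / x ^ Suc k) (at x)"
      unfolding m by (simp add: inverse_eq_divide power_one_over ac_simps)
    show "0 \<le> 1 / x ^ Suc k" using \<open>0 < x\<close> by simp
  next
    show "((\<lambda>r. - 1 / (real k * r ^ k)) \<longlongrightarrow> 0) at_top"
      using assms by (intro tendsto_divide_0[OF tendsto_const] filterlim_at_top_imp_at_infinity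
        filterlim_tendsto_pos_mult_at_top[OF tendsto_const] filterlim_pow_at_top filterlim_ident) auto
  qed measurable
  then show ?thesis by simp
qed

text \<open>
  Polar coordinates for the measure \<open>dr / r\<close>. The uniform law on the sphere is the law of the direction
  of a uniform point of the ball, so dilation invariance turns the left side into an integral over
  dilated balls, and Tonelli's theorem integrates the dilation factor out.
\<close>

lemma sphere_uniform_radial:
  fixes f :: "'a::euclidean_space \<Rightarrow> ennreal"
  assumes f[measurable]: "f \<in> borel_measurable borel"
  shows "(\<integral>\<^sup>+ u. (\<integral>\<^sup>+ r. f (r *\<^sub>R u) * ennreal (1 / r) * indicator {0<..} r \<partial>lborel) \<partial>sphere_uniform)
    = ennreal (1 / (DIM('a) * measure lborel (ball 0 1 :: 'a set))) *
      (\<integral>\<^sup>+ y. f y * ennreal (1 / norm y ^ DIM('a)) \<partial>lborel)"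
proof -
  let ?k = "DIM('a)" and ?B = "ball 0 1 :: 'a set"
  define vol where "vol = measure lborel ?B"
  have evol: "emeasure lborel ?B = ennreal vol"
    using less_imp_neq[OF emeasure_lborel_ball_finite[of "0::'a" 1]] unfolding vol_def infinity_ennreal_def
    by (rule emeasure_eq_ennreal_measure)
  have [measurable]: "?B \<in> sets borel" by simp
  have vol: "0 < vol"
    unfolding vol_def by (simp add: content_ball_pos)
  let ?\<phi> = "\<lambda>u. (\<integral>\<^sup>+ r. f (r *\<^sub>R u) * ennreal (1 / r) * indicator {0<..} r \<partial>lborel)"
  \<comment> \<open>The measure dr/r is invariant under dilations, so the unit vector sgn g may be replaced by g.\<close>
  have sgn: "?\<phi> (sgn g) = ?\<phi> g" if "g \<noteq> 0" for g
  proof -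
    have "?\<phi> (sgn g) = ennreal \<bar>norm g\<bar> * (\<integral>\<^sup>+ r. f ((0 + norm g * r) *\<^sub>R sgn g) * ennreal (1 / (0 + norm g * r))
       * indicator {0<..} (0 + norm g * r) \<partial>lborel)"
      using that by (intro nn_integral_real_affine) auto
    also have "\<dots> = (\<integral>\<^sup>+ r. ennreal (norm g) * (f ((norm g * r) *\<^sub>R sgn g) * ennreal (1 / (norm g * r))
       * indicator {0<..} (norm g * r)) \<partial>lborel)"
      by (simp add: nn_integral_cmult)
    also have "\<dots> = ?\<phi> g"
    proof (rule nn_integral_cong)
      fix r :: real
      have 1: "(norm g * r) *\<^sub>R sgn g = r *\<^sub>R g" using that by (simp add: sgn_div_norm)
      have 2: "ennreal (norm g) * ennreal (1 / (norm g * r)) = ennreal (1 / r)" if "0 < r"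
        using that \<open>g \<noteq> 0\<close> by (subst ennreal_mult[symmetric]) auto
      have "ennreal (norm g) * (f ((norm g * r) *\<^sub>R sgn g) * ennreal (1 / (norm g * r)) * indicator {0<..} (norm g * r))
        = f (r *\<^sub>R g) * (ennreal (norm g) * ennreal (1 / (norm g * r))) * indicator {0<..} (norm g * r)"
        unfolding 1 by (simp add: ac_simps)
      also have "\<dots> = f (r *\<^sub>R g) * ennreal (1 / r) * indicator {0<..} r"
        using that 2 by (cases "0 < r") (auto simp: zero_less_mult_iff)
      finally show "ennreal (norm g) * (f ((norm g * r) *\<^sub>R sgn g) * ennreal (1 / (norm g * r)) * indicator {0<..} (norm g * r))
        = f (r *\<^sub>R g) * ennreal (1 / r) * indicator {0<..} r" .
    qed
    finally show ?thesis .
  qed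
  have "(\<integral>\<^sup>+ u. ?\<phi> u \<partial>sphere_uniform) = (\<integral>\<^sup>+ g. ?\<phi> (sgn g) * indicator ?B g \<partial>lborel) / emeasure lborel ?B"
    unfolding sphere_uniform_def
    by (subst nn_integral_distr) (simp_all add: nn_integral_uniform_measure)
  also have "(\<integral>\<^sup>+ g. ?\<phi> (sgn g) * indicator ?B g \<partial>lborel) = (\<integral>\<^sup>+ g. ?\<phi> g * indicator ?B g \<partial>lborel)"
    by (rule nn_integral_cong_off_point[of 0]) (subst sgn, assumption, rule refl)
  also have "\<dots> = (\<integral>\<^sup>+ g. (\<integral>\<^sup>+ r. f (r *\<^sub>R g) * ennreal (1 / r) * indicator {0<..} r * indicator ?B g \<partial>lborel) \<partial>lborel)"
    by (intro nn_integral_cong) (simp add: nn_integral_multc)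
  also have "\<dots> = (\<integral>\<^sup>+ r. (\<integral>\<^sup>+ g. f (r *\<^sub>R g) * ennreal (1 / r) * indicator {0<..} r * indicator ?B g \<partial>lborel) \<partial>lborel)"
    by (intro lborel_pair.Fubini') measurable
  also have "\<dots> = (\<integral>\<^sup>+ r. (\<integral>\<^sup>+ y. f y * (ennreal (1 / r ^ Suc ?k) * (if norm y < r then 1 else 0)) \<partial>lborel) \<partial>lborel)"
  proof (rule nn_integral_cong)
    fix r :: real
    show "(\<integral>\<^sup>+ g. f (r *\<^sub>R g) * ennreal (1 / r) * indicator {0<..} r * indicator ?B g \<partial>lborel)
        = (\<integral>\<^sup>+ y. f y * (ennreal (1 / r ^ Suc ?k) * (if norm y < r then 1 else 0)) \<partial>lborel)"
    proof (cases "0 < r")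
      case True
      have "(\<integral>\<^sup>+ y. f y * (ennreal (1 / r ^ Suc ?k) * (if norm y < r then 1 else 0)) \<partial>lborel)
        = ennreal (\<bar>r\<bar> ^ ?k) * (\<integral>\<^sup>+ g. f (r *\<^sub>R g) * (ennreal (1 / r ^ Suc ?k) * (if norm (r *\<^sub>R g) < r then 1 else 0)) \<partial>lborel)"
        using True by (intro nn_integral_scaleR) auto
      also have "\<dots> = (\<integral>\<^sup>+ g. ennreal (\<bar>r\<bar> ^ ?k) * (f (r *\<^sub>R g) * (ennreal (1 / r ^ Suc ?k) * (if norm (r *\<^sub>R g) < r then 1 else 0))) \<partial>lborel)"
        by (subst nn_integral_cmult) auto
      also have "\<dots> = (\<integral>\<^sup>+ g. f (r *\<^sub>R g) * ennreal (1 / r) * indicator {0<..} r * indicator ?B g \<partial>lborel)"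
      proof (rule nn_integral_cong)
        fix g
        have 1: "ennreal (\<bar>r\<bar> ^ ?k) * ennreal (1 / r ^ Suc ?k) = ennreal (1 / r)"
          using True by (subst ennreal_mult[symmetric]) auto
        have "ennreal (\<bar>r\<bar> ^ ?k) * (f (r *\<^sub>R g) * (ennreal (1 / r ^ Suc ?k) * (if norm (r *\<^sub>R g) < r then 1 else 0)))
          = f (r *\<^sub>R g) * (ennreal (\<bar>r\<bar> ^ ?k) * ennreal (1 / r ^ Suc ?k)) * (if norm (r *\<^sub>R g) < r then 1 else 0)"
          by (simp add: ac_simps)
        also have "\<dots> = f (r *\<^sub>R g) * ennreal (1 / r) * indicator {0<..} r * indicator ?B g"
          unfolding 1 using True by (auto split: split_indicator)
        finally show "ennreal (\<bar>r\<bar> ^ ?k) * (f (r *\<^sub>R g) * (ennreal (1 / r ^ Suc ?k) * (if norm (r *\<^sub>R g) < r then 1 else 0)))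
          = f (r *\<^sub>R g) * ennreal (1 / r) * indicator {0<..} r * indicator ?B g" .
      qed
      finally show ?thesis by simp
    next
      case False
      then have "\<not> norm y < r" for y :: 'a by (meson le_less_trans norm_ge_zero)
      then show ?thesis using False by simp
    qed
  qed
  also have "\<dots> = (\<integral>\<^sup>+ y. (\<integral>\<^sup>+ r. f y * (ennreal (1 / r ^ Suc ?k) * (if norm y < r then 1 else 0)) \<partial>lborel) \<partial>lborel)"
    by (intro lborel_pair.Fubini') measurable
  also have "\<dots> = (\<integral>\<^sup>+ y. ennreal (1 / real ?k) * (f y * ennreal (1 / norm y ^ ?k)) \<partial>lborel)"
  proof (rule nn_integral_cong_off_point[of 0])
    fix y :: 'a assume "y \<noteq> 0"
    have "(\<integral>\<^sup>+ r. f y * (ennreal (1 / r ^ Suc ?k) * (if norm y < r then 1 else 0)) \<partial>lborel)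
      = f y * (\<integral>\<^sup>+ r. ennreal (1 / r ^ Suc ?k) * (if norm y < r then 1 else 0) \<partial>lborel)"
      by (simp add: nn_integral_cmult)
    also have "(\<integral>\<^sup>+ r. ennreal (1 / r ^ Suc ?k) * (if norm y < r then 1 else 0) \<partial>lborel)
      = (\<integral>\<^sup>+ r. ennreal (1 / r ^ Suc ?k) * indicator {norm y..} r \<partial>lborel)"
      by (rule nn_integral_cong_off_point[of "norm y"]) (auto split: split_indicator)
    also have "\<dots> = ennreal (1 / (real ?k * norm y ^ ?k))"
      using \<open>y \<noteq> 0\<close> by (intro nn_integral_power_tail) auto
    also have "\<dots> = ennreal (1 / real ?k) * ennreal (1 / norm y ^ ?k)"
      by (simp add: ennreal_mult[symmetric])
    finally show "(\<integral>\<^sup>+ r. f y * (ennreal (1 / r ^ Suc ?k) * (if norm y < r then 1 else 0)) \<partial>lborel)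
      = ennreal (1 / real ?k) * (f y * ennreal (1 / norm y ^ ?k))" by (simp add: ac_simps)
  qed
  also have "\<dots> = ennreal (1 / real ?k) * (\<integral>\<^sup>+ y. f y * ennreal (1 / norm y ^ ?k) \<partial>lborel)"
    by (simp add: nn_integral_cmult)
  also have "ennreal (1 / real ?k) * (\<integral>\<^sup>+ y. f y * ennreal (1 / norm y ^ ?k) \<partial>lborel) / emeasure lborel ?B
    = ennreal (1 / (?k * vol)) * (\<integral>\<^sup>+ y. f y * ennreal (1 / norm y ^ ?k) \<partial>lborel)"
  proof -
    have "ennreal (1 / (?k * vol)) = ennreal (1 / real ?k) / ennreal vol"
      using vol by (subst divide_ennreal) auto
    then show ?thesis unfolding evol by (simp add: divide_ennreal_def ac_simps)
  qed
  finally show ?thesis unfolding vol_def .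
qed

text \<open>
  The product form of the joint law, for variables with values in different types.
\<close>

lemma indep_rv_distr_pair:
  fixes R :: "'m \<Rightarrow> 'a::second_countable_topology" and U :: "'m \<Rightarrow> 'b::second_countable_topology"
  assumes "prob_space M" and R[measurable]: "R \<in> borel_measurable M" and U[measurable]: "U \<in> borel_measurable M"
    and ind: "indep_rv M R U"
  shows "distr M borel R \<Otimes>\<^sub>M distr M borel U = distr M (borel \<Otimes>\<^sub>M borel) (\<lambda>\<omega>. (R \<omega>, U \<omega>))"
proof -
  interpret prob_space M by fact
  interpret PR: prob_space "distr M borel R" by (rule prob_space_distr) measurable
  interpret PU: prob_space "distr M borel U" by (rule prob_space_distr) measurable
  show ?thesis
  proof (rule pair_measure_eqI)
    show "sigma_finite_measure (distr M borel R)" "sigma_finite_measure (distr M borel U)" by unfold_locales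
    show "sets (distr M borel R \<Otimes>\<^sub>M distr M borel U) = sets (distr M (borel \<Otimes>\<^sub>M borel) (\<lambda>\<omega>. (R \<omega>, U \<omega>)))"
      by (simp cong: sets_pair_measure_cong)
    fix A B assume "A \<in> sets (distr M borel R)" "B \<in> sets (distr M borel U)"
    then have [measurable]: "A \<in> sets borel" "B \<in> sets borel" by auto
    have "prob ((R -` A \<inter> space M) \<inter> (U -` B \<inter> space M)) = prob (R -` A \<inter> space M) * prob (U -` B \<inter> space M)"
      using ind unfolding indep_rv_def by (rule indep_setD) (auto intro: in_vimage_algebra)
    moreover have "(\<lambda>\<omega>. (R \<omega>, U \<omega>)) -` (A \<times> B) \<inter> space M = (R -` A \<inter> space M) \<inter> (U -` B \<inter> space M)" by auto
    ultimately show "emeasure (distr M borel R) A * emeasure (distr M borel U) B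
       = emeasure (distr M (borel \<Otimes>\<^sub>M borel) (\<lambda>\<omega>. (R \<omega>, U \<omega>))) (A \<times> B)"
      by (simp add: emeasure_distr emeasure_eq_measure ennreal_mult)
  qed
qed

lemma prob_space_sphere_uniform: "prob_space (sphere_uniform :: 'a::euclidean_space measure)"
proof -
  have "emeasure lborel (ball 0 1 :: 'a set) \<noteq> 0"
    using content_ball_pos[of 1 "0::'a"] by (auto simp: measure_def)
  moreover have "emeasure lborel (ball 0 1 :: 'a set) \<noteq> \<infinity>"
    using less_imp_neq[OF emeasure_lborel_ball_finite[of "0::'a" 1]] .
  ultimately interpret B: prob_space "uniform_measure lborel (ball 0 1 :: 'a set)"
    by (rule prob_space_uniform_measure)
  show ?thesis unfolding sphere_uniform_def by (rule B.prob_space_distr) simp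
qed

lemma AE_sphere_uniform_norm: "AE u in (sphere_uniform :: 'a::euclidean_space measure). norm u = 1"
proof -
  have "AE g in uniform_measure lborel (ball 0 1 :: 'a set). norm (sgn g) = 1"
    using AE_lborel_singleton[of "0::'a"]
    by (intro AE_uniform_measureI) (auto elim!: AE_mp simp: norm_sgn)
  then show ?thesis unfolding sphere_uniform_def
    by (subst AE_distr_iff) auto
qed

text \<open>
  The indicator on the right has the dilation factor as free variable on the left and the original
  radius on the right: this exchange is what later makes the tail function of \<open>R\<close> appear.
\<close>

lemma nn_integral_log_uniform_scaling:
  fixes f :: "'a::euclidean_space \<Rightarrow> ennreal"
  assumes f[measurable]: "f \<in> borel_measurable borel" and \<rho>: "0 < \<rho>" and h: "0 < h" and u: "norm u = 1"
  shows "(\<integral>\<^sup>+ l. f (l *\<^sub>R (\<rho> *\<^sub>R u)) * ennreal (1 / (h * l)) * indicator {1..<exp h} l \<partial>lborel)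
    = (\<integral>\<^sup>+ r. (f (r *\<^sub>R u) * (ennreal (1 / h) * indicator {y. norm y * exp (- h) < \<rho> \<and> \<rho> \<le> norm y} (r *\<^sub>R u)))
        * ennreal (1 / r) * indicator {0<..} r \<partial>lborel)" (is "_ = (\<integral>\<^sup>+ r. ?g r \<partial>lborel)")
proof -
  have [measurable]: "{y::'a. norm y * exp (- h) < \<rho> \<and> \<rho> \<le> norm y} \<in> sets borel" by measurable
  have "(\<integral>\<^sup>+ r. ?g r \<partial>lborel) = ennreal \<bar>\<rho>\<bar> * (\<integral>\<^sup>+ l. ?g (0 + \<rho> * l) \<partial>lborel)"
    using \<rho> by (intro nn_integral_real_affine) auto
  also have "\<dots> = (\<integral>\<^sup>+ l. ennreal \<rho> * ?g (\<rho> * l) \<partial>lborel)"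
    using \<rho> by (subst nn_integral_cmult[symmetric]) auto
  also have "\<dots> = (\<integral>\<^sup>+ l. f (l *\<^sub>R (\<rho> *\<^sub>R u)) * ennreal (1 / (h * l)) * indicator {1..<exp h} l \<partial>lborel)"
  proof (rule nn_integral_cong)
    fix l :: real
    show "ennreal \<rho> * ?g (\<rho> * l) = f (l *\<^sub>R (\<rho> *\<^sub>R u)) * ennreal (1 / (h * l)) * indicator {1..<exp h} l"
    proof (cases "0 < l")
      case True
      have 1: "indicator {y. norm y * exp (- h) < \<rho> \<and> \<rho> \<le> norm y} ((\<rho> * l) *\<^sub>R u) = (indicator {1..<exp h} l :: ennreal)"
        using True \<rho> u by (auto split: split_indicator simp: abs_mult exp_minus field_simps)
      have "ennreal \<rho> * (ennreal (1 / h) * ennreal (1 / (\<rho> * l))) = ennreal (1 / (h * l))"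
        using True \<rho> h by (simp add: ennreal_mult[symmetric])
      then have e: "ennreal \<rho> * (ennreal (1 / h) * (ennreal (1 / (\<rho> * l)) * X)) = ennreal (1 / (h * l)) * X" for X
        by (metis mult.assoc)
      have "ennreal \<rho> * ?g (\<rho> * l)
        = ennreal \<rho> * (ennreal (1 / h) * (ennreal (1 / (\<rho> * l)) * (f ((\<rho> * l) *\<^sub>R u) * indicator {1..<exp h} l)))"
        using True \<rho> unfolding 1 by (simp add: ac_simps zero_less_mult_iff)
      also have "\<dots> = ennreal (1 / (h * l)) * (f ((\<rho> * l) *\<^sub>R u) * indicator {1..<exp h} l)" by (rule e)
      finally show ?thesis by (simp add: ac_simps)
    next
      case False
      then show ?thesis using \<rho> by (auto simp: zero_less_mult_iff split: split_indicator)
    qed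
  qed
  finally show ?thesis by simp
qed

text \<open>
  The law of the dilation factor has density \<open>1 / (h * l)\<close> on \<open>[1, exp h)\<close>. It is the multiplicative Haar
  measure, restricted and normalised, so smoothing each sphere with it gives a measure with a density
  that depends on the radius only through the length and a shell of thickness \<open>exp h\<close>.
\<close>

lemma log_uniform_smoothing_density:
  fixes R :: "'m \<Rightarrow> real" and U :: "'m \<Rightarrow> 'a::euclidean_space"
  assumes "prob_space M" and R[measurable]: "R \<in> borel_measurable M" and U[measurable]: "U \<in> borel_measurable M"
    and ind: "indep_rv M R U" and Rpos: "AE \<omega> in M. 0 < R \<omega>" and Uu: "distr M borel U = sphere_uniform"
    and f[measurable]: "f \<in> borel_measurable borel" and h: "0 < h"
  shows "(\<integral>\<^sup>+ \<omega>. (\<integral>\<^sup>+ l. f (l *\<^sub>R (R \<omega> *\<^sub>R U \<omega>)) * ennreal (1 / (h * l)) * indicator {1..<exp h} l \<partial>lborel) \<partial>M)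
    = ennreal (1 / (DIM('a) * measure lborel (ball 0 1 :: 'a set))) *
      (\<integral>\<^sup>+ y. f y * ennreal (measure M {\<omega>\<in>space M. norm y * exp (- h) < R \<omega> \<and> R \<omega> \<le> norm y}
          / (h * norm y ^ DIM('a))) \<partial>lborel)"
proof -
  interpret prob_space M by fact
  let ?R = "distr M borel R" and ?U = "sphere_uniform :: 'a measure"
  let ?c = "ennreal (1 / (DIM('a) * measure lborel (ball 0 1 :: 'a set)))"
  interpret PR: prob_space ?R by (rule prob_space_distr) measurable
  interpret PU: prob_space ?U by (rule prob_space_sphere_uniform)
  have sU[measurable_cong]: "sets ?U = sets borel" unfolding sphere_uniform_def by simp
  interpret P: pair_sigma_finite ?R "lborel :: 'a measure" ..
  let ?\<phi> = "\<lambda>x. (\<integral>\<^sup>+ l. f (l *\<^sub>R x) * ennreal (1 / (h * l)) * indicator {1..<exp h} l \<partial>lborel)"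
  let ?s = "\<lambda>\<rho> y. f y * (ennreal (1 / h) * indicator {y. norm y * exp (- h) < \<rho> \<and> \<rho> \<le> norm y} y)"
  have "(\<integral>\<^sup>+ \<omega>. ?\<phi> (R \<omega> *\<^sub>R U \<omega>) \<partial>M) = (\<integral>\<^sup>+ (\<rho>, u). ?\<phi> (\<rho> *\<^sub>R u) \<partial>distr M (borel \<Otimes>\<^sub>M borel) (\<lambda>\<omega>. (R \<omega>, U \<omega>)))"
    by (subst nn_integral_distr) auto
  also have "\<dots> = (\<integral>\<^sup>+ (\<rho>, u). ?\<phi> (\<rho> *\<^sub>R u) \<partial>(?R \<Otimes>\<^sub>M ?U))"
    using indep_rv_distr_pair[OF \<open>prob_space M\<close> R U ind] Uu by simp
  also have "\<dots> = (\<integral>\<^sup>+ \<rho>. (\<integral>\<^sup>+ u. ?\<phi> (\<rho> *\<^sub>R u) \<partial>?U) \<partial>?R)"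
    by (subst PU.nn_integral_fst[symmetric]) auto
  also have "\<dots> = (\<integral>\<^sup>+ \<rho>. ?c * (\<integral>\<^sup>+ y. ?s \<rho> y * ennreal (1 / norm y ^ DIM('a)) \<partial>lborel) \<partial>?R)"
  proof (rule nn_integral_cong_AE)
    have "AE \<rho> in ?R. 0 < \<rho>" using Rpos by (subst AE_distr_iff) auto
    then show "AE \<rho> in ?R. (\<integral>\<^sup>+ u. ?\<phi> (\<rho> *\<^sub>R u) \<partial>?U) = ?c * (\<integral>\<^sup>+ y. ?s \<rho> y * ennreal (1 / norm y ^ DIM('a)) \<partial>lborel)"
    proof (rule AE_mp, intro AE_I2 impI)
      fix \<rho> :: real assume \<rho>: "0 < \<rho>"
      have [measurable]: "{y::'a. norm y * exp (- h) < \<rho> \<and> \<rho> \<le> norm y} \<in> sets borel" by measurable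
      have "(\<integral>\<^sup>+ u. ?\<phi> (\<rho> *\<^sub>R u) \<partial>?U) = (\<integral>\<^sup>+ u. (\<integral>\<^sup>+ r. ?s \<rho> (r *\<^sub>R u) * ennreal (1 / r) * indicator {0<..} r \<partial>lborel) \<partial>?U)"
        by (rule nn_integral_cong_AE, rule AE_mp[OF AE_sphere_uniform_norm], rule AE_I2, rule impI,
            rule nn_integral_log_uniform_scaling[OF f \<rho> h])
      also have "\<dots> = ?c * (\<integral>\<^sup>+ y. ?s \<rho> y * ennreal (1 / norm y ^ DIM('a)) \<partial>lborel)"
        by (rule sphere_uniform_radial) measurable
      finally show "(\<integral>\<^sup>+ u. ?\<phi> (\<rho> *\<^sub>R u) \<partial>?U) = ?c * (\<integral>\<^sup>+ y. ?s \<rho> y * ennreal (1 / norm y ^ DIM('a)) \<partial>lborel)" .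
    qed
  qed
  also have "\<dots> = ?c * (\<integral>\<^sup>+ \<rho>. (\<integral>\<^sup>+ y. f y * (ennreal (1 / h) * (if norm y * exp (- h) < \<rho> \<and> \<rho> \<le> norm y then 1 else 0))
       * ennreal (1 / norm y ^ DIM('a)) \<partial>lborel) \<partial>?R)"
    by (subst nn_integral_cmult) (auto simp: indicator_def of_bool_def)
  also have "(\<integral>\<^sup>+ \<rho>. (\<integral>\<^sup>+ y. f y * (ennreal (1 / h) * (if norm y * exp (- h) < \<rho> \<and> \<rho> \<le> norm y then 1 else 0))
       * ennreal (1 / norm y ^ DIM('a)) \<partial>lborel) \<partial>?R)
    = (\<integral>\<^sup>+ y. (\<integral>\<^sup>+ \<rho>. f y * (ennreal (1 / h) * (if norm y * exp (- h) < \<rho> \<and> \<rho> \<le> norm y then 1 else 0))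
       * ennreal (1 / norm y ^ DIM('a)) \<partial>?R) \<partial>lborel)"
    by (rule P.Fubini'[symmetric]) measurable
  also have "\<dots> = (\<integral>\<^sup>+ y. f y * ennreal (measure M {\<omega>\<in>space M. norm y * exp (- h) < R \<omega> \<and> R \<omega> \<le> norm y}
          / (h * norm y ^ DIM('a))) \<partial>lborel)"
  proof (rule nn_integral_cong)
    fix y :: 'a
    have "(\<integral>\<^sup>+ \<rho>. f y * (ennreal (1 / h) * (if norm y * exp (- h) < \<rho> \<and> \<rho> \<le> norm y then 1 else 0))
       * ennreal (1 / norm y ^ DIM('a)) \<partial>?R)
      = (\<integral>\<^sup>+ \<rho>. (f y * ennreal (1 / h) * ennreal (1 / norm y ^ DIM('a))) * indicator {norm y * exp (- h)<..norm y} \<rho> \<partial>?R)"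
      by (intro nn_integral_cong) (auto simp: ac_simps split: split_indicator)
    also have "\<dots> = (f y * ennreal (1 / h) * ennreal (1 / norm y ^ DIM('a))) * emeasure ?R {norm y * exp (- h)<..norm y}"
      by (rule nn_integral_cmult_indicator) simp
    also have "emeasure ?R {norm y * exp (- h)<..norm y} = emeasure M {\<omega>\<in>space M. norm y * exp (- h) < R \<omega> \<and> R \<omega> \<le> norm y}"
      by (subst emeasure_distr) (auto intro!: arg_cong[where f="emeasure M"])
    also have "\<dots> = ennreal (measure M {\<omega>\<in>space M. norm y * exp (- h) < R \<omega> \<and> R \<omega> \<le> norm y})" (is "_ = ennreal ?p")
      by (rule emeasure_eq_measure)
    also have "f y * ennreal (1 / h) * ennreal (1 / norm y ^ DIM('a)) * ennreal ?p
      = f y * (ennreal (1 / h) * ennreal (1 / norm y ^ DIM('a)) * ennreal ?p)" by (simp add: ac_simps)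
    also have "ennreal (1 / h) * ennreal (1 / norm y ^ DIM('a)) * ennreal ?p = ennreal (?p / (h * norm y ^ DIM('a)))"
      using h by (simp add: ennreal_mult[symmetric])
    finally show "(\<integral>\<^sup>+ \<rho>. f y * (ennreal (1 / h) * (if norm y * exp (- h) < \<rho> \<and> \<rho> \<le> norm y then 1 else 0))
       * ennreal (1 / norm y ^ DIM('a)) \<partial>?R) = f y * ennreal (?p / (h * norm y ^ DIM('a)))" .
  qed
  finally show ?thesis .
qed

lemma nn_integral_log_uniform_weight:
  assumes "0 < h"
  shows "(\<integral>\<^sup>+ l. ennreal (1 / (h * l)) * indicator {1..<exp h} l \<partial>lborel) = 1"
proof -
  have "(\<integral>\<^sup>+ l. ennreal (1 / (h * l)) * indicator {1..<exp h} l \<partial>lborel)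
     = (\<integral>\<^sup>+ l. ennreal (1 / (h * l)) * indicator {1..exp h} l \<partial>lborel)"
    by (rule nn_integral_cong_off_point[of "exp h"]) (auto split: split_indicator)
  also have "\<dots> = ennreal (ln (exp h) / h - ln 1 / h)"
    using assms by (intro nn_integral_FTC_Icc) (auto intro!: derivative_eq_intros simp: has_real_derivative_iff_has_vector_derivative[symmetric] field_simps)
  finally show ?thesis using assms by simp
qed

section \<open>Asymptotics of the tail\<close>

abbreviation (input) weibull_tail :: "real \<Rightarrow> real \<Rightarrow> real \<Rightarrow> real \<Rightarrow> real \<Rightarrow> real" where
  "weibull_tail p N q \<delta> u \<equiv> p * u powr N * exp (- q * u powr \<delta>)"

lemma weibull_tail_scaled:
  assumes "0 < u" "0 < x"
  shows "weibull_tail p N q \<delta> (u * x)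
    = weibull_tail p N q \<delta> u * (x powr N * exp (- (q * u powr \<delta> * (x powr \<delta> - 1))))"
proof -
  have "- q * (u powr \<delta> * x powr \<delta>) = - q * u powr \<delta> + - (q * u powr \<delta> * (x powr \<delta> - 1))"
    by (simp add: algebra_simps)
  then have "exp (- q * (u powr \<delta> * x powr \<delta>)) = exp (- q * u powr \<delta>) * exp (- (q * u powr \<delta> * (x powr \<delta> - 1)))"
    by (simp only: exp_add)
  then show ?thesis using assms by (simp add: powr_mult)
qed

lemma powr_minus_one_tendsto:
  fixes x M :: "nat \<Rightarrow> real"
  assumes lim: "(\<lambda>n. M n * (x n - 1)) \<longlonglongrightarrow> s" and x: "x \<longlonglongrightarrow> 1"
  shows "(\<lambda>n. M n * (x n powr \<delta> - 1)) \<longlonglongrightarrow> \<delta> * s"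
proof -
  have "((\<lambda>x. x powr \<delta>) has_real_derivative \<delta>) (at 1)"
    using has_real_derivative_powr[of 1 \<delta>] by simp
  then obtain g where g: "\<And>z. z powr \<delta> - 1 powr \<delta> = g z * (z - 1)" "isCont g 1" "g 1 = \<delta>"
    unfolding CARAT_DERIV by blast
  have "(\<lambda>n. g (x n)) \<longlonglongrightarrow> \<delta>" using isCont_tendsto_compose[OF g(2) x] g(3) by simp
  then have "(\<lambda>n. g (x n) * (M n * (x n - 1))) \<longlonglongrightarrow> \<delta> * s" by (intro tendsto_mult lim)
  moreover have "g (x n) * (M n * (x n - 1)) = M n * (x n powr \<delta> - 1)" for n
    using g(1)[of "x n"] by simp
  ultimately show ?thesis by simp
qed

text \<open>
  The Gumbel max-domain property: on the scale \<open>u / (q * \<delta> * u powr \<delta>)\<close> around \<open>u\<close> the tail decays like the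
  standard exponential law. The ratio of the
  polynomial factors tends to 1, because this scale is small compared with \<open>u\<close>.
\<close>

lemma tail_ratio_tendsto:
  fixes T :: "real \<Rightarrow> real" and u x :: "nat \<Rightarrow> real"
  assumes T: "T \<sim>[at_top] weibull_tail p N q \<delta>" and p: "0 < p" "0 < q" "0 < \<delta>"
    and u: "filterlim u at_top sequentially"
    and lim: "(\<lambda>n. (q * \<delta> * u n powr \<delta>) * (x n - 1)) \<longlonglongrightarrow> s"
  shows "(\<lambda>n. T (u n * x n) / T (u n)) \<longlonglongrightarrow> exp (- s)"
proof -
  let ?G = "weibull_tail p N q \<delta>"
  define m where "m n = q * \<delta> * u n powr \<delta>" for n
  have m: "filterlim m at_top sequentially"
  proof -
    have "filterlim (\<lambda>v. q * \<delta> * v powr \<delta>) at_top at_top" using p by real_asymp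
    from filterlim_compose[OF this u] show ?thesis unfolding m_def .
  qed
  have "(\<lambda>n. (m n * (x n - 1)) * inverse (m n)) \<longlonglongrightarrow> s * 0"
    using lim tendsto_inverse_0_at_top[OF m] unfolding m_def by (intro tendsto_mult)
  moreover have "\<forall>\<^sub>F n in sequentially. (m n * (x n - 1)) * inverse (m n) = x n - 1"
    using filterlim_at_top_dense[THEN iffD1, OF m, rule_format, of 0] by eventually_elim (auto simp: field_simps)
  ultimately have "(\<lambda>n. x n - 1) \<longlonglongrightarrow> 0" by (simp add: filterlim_cong)
  then have x1: "x \<longlonglongrightarrow> 1" by (simp add: LIM_zero_iff)
  have ux: "filterlim (\<lambda>n. u n * x n) at_top sequentially"
    using filterlim_tendsto_pos_mult_at_top[OF x1 _ u] by (simp add: mult.commute)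
  have upos: "\<forall>\<^sub>F n in sequentially. 0 < u n"
    using filterlim_at_top_dense[THEN iffD1, OF u, rule_format, of 0] .
  have xpos: "\<forall>\<^sub>F n in sequentially. 0 < x n" using order_tendstoD(1)[OF x1, of 0] by simp
  have G0: "\<forall>\<^sub>F v in at_top. ?G v \<noteq> 0"
    using eventually_gt_at_top[of 0] by eventually_elim (use p in auto)
  have TG: "((\<lambda>v. T v / ?G v) \<longlongrightarrow> 1) at_top" by (rule asymp_equivD_strong[OF T]) (use G0 in eventually_elim, auto)
  have A: "(\<lambda>n. T (u n * x n) / ?G (u n * x n)) \<longlonglongrightarrow> 1" by (rule filterlim_compose[OF TG ux])
  have B: "(\<lambda>n. T (u n) / ?G (u n)) \<longlonglongrightarrow> 1" by (rule filterlim_compose[OF TG u])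
  have "(\<lambda>n. m n * (x n powr \<delta> - 1)) \<longlonglongrightarrow> \<delta> * s"
    using lim unfolding m_def[symmetric] by (rule powr_minus_one_tendsto[OF _ x1])
  then have "(\<lambda>n. m n * (x n powr \<delta> - 1) / \<delta>) \<longlonglongrightarrow> \<delta> * s / \<delta>" by (intro tendsto_divide tendsto_const) (use p in auto)
  then have "(\<lambda>n. q * u n powr \<delta> * (x n powr \<delta> - 1)) \<longlonglongrightarrow> s"
    using p unfolding m_def by (simp add: ac_simps)
  then have E: "(\<lambda>n. x n powr N * exp (- (q * u n powr \<delta> * (x n powr \<delta> - 1)))) \<longlonglongrightarrow> 1 powr N * exp (- s)"
    by (intro tendsto_intros x1) auto
  have "(\<lambda>n. (T (u n * x n) / ?G (u n * x n)) / (T (u n) / ?G (u n)) *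
      (x n powr N * exp (- (q * u n powr \<delta> * (x n powr \<delta> - 1))))) \<longlonglongrightarrow> 1 / 1 * (1 powr N * exp (- s))"
    by (intro tendsto_mult[OF tendsto_divide[OF A B] E]) simp
  moreover have "\<forall>\<^sub>F n in sequentially. (T (u n * x n) / ?G (u n * x n)) / (T (u n) / ?G (u n)) *
      (x n powr N * exp (- (q * u n powr \<delta> * (x n powr \<delta> - 1)))) = T (u n * x n) / T (u n)"
    using upos xpos
  proof eventually_elim
    case (elim n)
    have "?G (u n) \<noteq> 0" "x n powr N * exp (- (q * u n powr \<delta> * (x n powr \<delta> - 1))) \<noteq> 0" using elim p by auto
    then show ?case unfolding weibull_tail_scaled[OF elim]
      by (simp add: field_simps del: mult_eq_0_iff)
  qed
  ultimately have "(\<lambda>n. T (u n * x n) / T (u n)) \<longlonglongrightarrow> 1 / 1 * (1 powr N * exp (- s))"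
    by (rule Lim_transform_eventually)
  then show ?thesis by simp
qed

text \<open>
  A Potter-type bound that is uniform in \<open>x\<close>. The exponent tends to \<open>- \<infinity>\<close> with \<open>u\<close>, so that every
  fixed polynomial rate of decay is available for large \<open>u\<close>, also if \<open>\<delta> < 1\<close>.
\<close>

lemma tail_ratio_bound:
  fixes T :: "real \<Rightarrow> real"
  assumes T: "T \<sim>[at_top] weibull_tail p N q \<delta>" and p: "0 < p" "0 < q" "0 < \<delta>"
  shows "\<exists>u0. \<forall>u\<ge>u0. 0 < T u \<and> (\<forall>x\<ge>1/2. T (u * x) \<le> 4 * x powr (N - q * \<delta> * u powr \<delta>) * T u)"
proof -
  let ?G = "weibull_tail p N q \<delta>"
  have G0: "\<forall>\<^sub>F v in at_top. ?G v \<noteq> 0"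
    using eventually_gt_at_top[of 0] by eventually_elim (use p in auto)
  have TG: "((\<lambda>v. T v / ?G v) \<longlongrightarrow> 1) at_top" by (rule asymp_equivD_strong[OF T]) (use G0 in eventually_elim, auto)
  have "\<forall>\<^sub>F v in at_top. 1/2 < T v / ?G v" "\<forall>\<^sub>F v in at_top. T v / ?G v < 2"
    by (rule order_tendstoD[OF TG], simp)+
  with eventually_gt_at_top[of 0] have "\<forall>\<^sub>F v in at_top. 1/2 < T v / ?G v \<and> T v / ?G v < 2 \<and> 0 < v"
    by eventually_elim blast
  then obtain v0 where v0: "\<And>v. v \<ge> v0 \<Longrightarrow> 1/2 < T v / ?G v \<and> T v / ?G v < 2 \<and> 0 < v"
    unfolding eventually_at_top_linorder by blast
  have b: "?G v / 2 < T v" "T v < 2 * ?G v" "0 < v" "0 < ?G v" if "v \<ge> v0" for v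
  proof -
    show "0 < v" using v0[OF that] by simp
    then show g: "0 < ?G v" using p by simp
    show "?G v / 2 < T v" "T v < 2 * ?G v" using v0[OF that] g by (auto simp: field_simps)
  qed
  show ?thesis
  proof (intro exI[of _ "max 1 (2 * \<bar>v0\<bar>)"] allI impI)
    fix u assume u: "max 1 (2 * \<bar>v0\<bar>) \<le> u"
    then have u': "v0 \<le> u" "0 < u" by auto
    show "0 < T u \<and> (\<forall>x\<ge>1/2. T (u * x) \<le> 4 * x powr (N - q * \<delta> * u powr \<delta>) * T u)"
    proof (intro conjI allI impI)
      show "0 < T u" using b[OF u'(1)] by linarith
      fix x :: real assume x: "1/2 \<le> x"
      have "v0 \<le> u * (1/2)" using u by auto
      also have "\<dots> \<le> u * x" using u' x by (intro mult_left_mono) auto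
      finally have ux: "v0 \<le> u * x" .
      have x0: "0 < x" using x by simp
      \<comment> \<open>With this inequality the stretched exponential is dominated by a power of x, for every \<delta> > 0.\<close>
      have "\<delta> * ln x \<le> x powr \<delta> - 1"
      proof -
        have "x powr \<delta> = exp (\<delta> * ln x)" using x0 by (simp add: powr_def)
        then show ?thesis using exp_ge_add_one_self[of "\<delta> * ln x"] by linarith
      qed
      then have "q * u powr \<delta> * (\<delta> * ln x) \<le> q * u powr \<delta> * (x powr \<delta> - 1)"
        using p by (intro mult_left_mono) auto
      then have "exp (- (q * u powr \<delta> * (x powr \<delta> - 1))) \<le> x powr (- (q * \<delta> * u powr \<delta>))"
        using x0 by (simp add: powr_def ac_simps)
      then have e: "x powr N * exp (- (q * u powr \<delta> * (x powr \<delta> - 1))) \<le> x powr (N - q * \<delta> * u powr \<delta>)"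
        using x0 by (simp add: powr_diff powr_minus divide_inverse mult_left_mono)
      have "T (u * x) \<le> 2 * ?G (u * x)" using b(2)[OF ux] by simp
      also have "\<dots> = 2 * (?G u * (x powr N * exp (- (q * u powr \<delta> * (x powr \<delta> - 1)))))"
        by (simp only: weibull_tail_scaled[OF u'(2) x0])
      also have "\<dots> \<le> 2 * (?G u * x powr (N - q * \<delta> * u powr \<delta>))"
        using b(4)[OF u'(1)] e by (intro mult_left_mono) auto
      also have "\<dots> \<le> 2 * (2 * T u * x powr (N - q * \<delta> * u powr \<delta>))"
        using b(1)[OF u'(1)] by (intro mult_left_mono mult_right_mono) auto
      finally show "T (u * x) \<le> 4 * x powr (N - q * \<delta> * u powr \<delta>) * T u" by (simp add: ac_simps)
    qed
  qed
qed

text \<open>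
  The expression is the density of the smoothed vector at relative radius \<open>g n\<close>, up to a factor that is
  independent of the point. The factor \<open>(exp \<eta> - 1) / \<eta>\<close> is the mean of \<open>exp\<close> over the smoothing range.
\<close>

lemma shell_density_tendsto:
  fixes T :: "real \<Rightarrow> real" and u :: "nat \<Rightarrow> real"
  assumes T: "T \<sim>[at_top] weibull_tail p N q \<delta>" and p: "0 < p" "0 < q" "0 < \<delta>"
    and u: "filterlim u at_top sequentially" and m_def: "\<And>n. m n = q * \<delta> * u n powr \<delta>"
    and g_def: "\<And>n. g n = sqrt (1 + 2 * \<Lambda> / m n + \<beta> / (m n)\<^sup>2)"
  shows "(\<lambda>n. (T (u n * (g n * exp (- (\<eta> / m n)))) - T (u n * g n)) / (T (u n) * (\<eta> * g n ^ k)))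
     \<longlonglongrightarrow> (exp \<eta> - 1) / \<eta> * exp (- \<Lambda>)"
proof -
  have m: "filterlim m at_top sequentially"
  proof -
    have "filterlim (\<lambda>v. q * \<delta> * v powr \<delta>) at_top at_top" using p by real_asymp
    from filterlim_compose[OF this u] show ?thesis unfolding m_def .
  qed
  have "((\<lambda>x. x * (sqrt (1 + 2 * \<Lambda> / x + \<beta> / x\<^sup>2) - 1)) \<longlongrightarrow> \<Lambda>) at_top"
    by (real_asymp simp: field_simps)
  from filterlim_compose[OF this m] have A: "(\<lambda>n. m n * (g n - 1)) \<longlonglongrightarrow> \<Lambda>" unfolding g_def .
  have "((\<lambda>x. sqrt (1 + 2 * \<Lambda> / x + \<beta> / x\<^sup>2)) \<longlongrightarrow> 1) at_top" by (real_asymp simp: field_simps)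
  from filterlim_compose[OF this m] have g1: "g \<longlonglongrightarrow> 1" unfolding g_def .
  have "((\<lambda>x. exp (- (\<eta> / x))) \<longlongrightarrow> 1) at_top" "((\<lambda>x. x * (exp (- (\<eta> / x)) - 1)) \<longlongrightarrow> - \<eta>) at_top"
    by real_asymp+
  from this[THEN filterlim_compose[OF _ m]]
  have "(\<lambda>n. (m n * (g n - 1)) * exp (- (\<eta> / m n)) + m n * (exp (- (\<eta> / m n)) - 1)) \<longlonglongrightarrow> \<Lambda> * 1 + - \<eta>"
    by (intro tendsto_add tendsto_mult A)
  then have B: "(\<lambda>n. m n * (g n * exp (- (\<eta> / m n)) - 1)) \<longlonglongrightarrow> \<Lambda> - \<eta>" by (simp add: algebra_simps)
  have C: "(\<lambda>n. T (u n * g n) / T (u n)) \<longlonglongrightarrow> exp (- \<Lambda>)"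
    by (rule tail_ratio_tendsto[OF T p u]) (use A m_def in simp)
  have D: "(\<lambda>n. T (u n * (g n * exp (- (\<eta> / m n)))) / T (u n)) \<longlonglongrightarrow> exp (- (\<Lambda> - \<eta>))"
    by (rule tail_ratio_tendsto[OF T p u]) (use B m_def in simp)
  have "(\<lambda>n. (T (u n * (g n * exp (- (\<eta> / m n)))) / T (u n) - T (u n * g n) / T (u n)) / (\<eta> * g n ^ k))
    \<longlonglongrightarrow> (exp (- (\<Lambda> - \<eta>)) - exp (- \<Lambda>)) / (\<eta> * 1 ^ k)"
  proof (cases "\<eta> = 0")
    case False
    then show ?thesis by (intro tendsto_divide tendsto_diff tendsto_mult tendsto_power C D g1 tendsto_const) auto
  qed simp
  moreover have "(exp (- (\<Lambda> - \<eta>)) - exp (- \<Lambda>)) / (\<eta> * 1 ^ k) = (exp \<eta> - 1) / \<eta> * exp (- \<Lambda>)"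
    by (simp add: exp_diff exp_minus field_simps)
  moreover have "(T (u n * (g n * exp (- (\<eta> / m n)))) / T (u n) - T (u n * g n) / T (u n)) / (\<eta> * g n ^ k)
    = (T (u n * (g n * exp (- (\<eta> / m n)))) - T (u n * g n)) / (T (u n) * (\<eta> * g n ^ k))" for n
    by (simp add: diff_divide_distrib[symmetric])
  ultimately show ?thesis by (simp only:)
qed

text \<open>
  Monotonicity of \<open>(1 + a / M) powr M\<close> in \<open>M\<close>, up to a constant: it makes the bounds for all large \<open>M\<close>
  integrable by comparison with a single polynomial.
\<close>

lemma one_plus_powr_ge:
  fixes L M :: real and j :: nat
  assumes L: "0 \<le> L" and j: "0 < j" and M: "4 * real j \<le> M"
  shows "(1 + L / (4 * real j)) ^ j \<le> (1 + 2 * L / M) powr (M / 4)"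
proof -
  \<comment> \<open>The integer part of the exponent is used, because Bernoulli's inequality needs a natural exponent.\<close>
  define i where "i = nat \<lfloor>M / (4 * real j)\<rfloor>"
  have r: "1 \<le> M / (4 * real j)" using j M by (simp add: field_simps)
  have i1: "real i \<le> M / (4 * real j)" unfolding i_def using r by (intro of_nat_floor) auto
  have i0: "1 \<le> i" unfolding i_def using r by (simp add: le_nat_iff le_floor_iff)
  have i2: "M / (4 * real j) < real i + 1" unfolding i_def using r by linarith
  have i3: "M / (4 * real j) \<le> 2 * real i" using i2 i0 by linarith
  have M0: "0 < M" using j M by linarith
  have "1 + L / (4 * real j) \<le> 1 + real i * (2 * L / M)"
  proof -
    have "L / (4 * real j) = (L / M) * (M / (4 * real j))" using M0 by simp
    also have "\<dots> \<le> (L / M) * (2 * real i)" using L M0 by (intro mult_left_mono i3) auto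
    finally show ?thesis by (simp add: field_simps)
  qed
  also have "\<dots> \<le> (1 + 2 * L / M) ^ i" using L M0 by (intro Bernoulli_inequality) (simp add: order_trans[of _ 0])
  finally have "(1 + L / (4 * real j)) ^ j \<le> ((1 + 2 * L / M) ^ i) ^ j"
    using L by (intro power_mono) auto
  also have "\<dots> = (1 + 2 * L / M) powr (real i * real j)"
    using L M0 powr_realpow[of "1 + 2 * L / M" "i * j"] by (simp add: power_mult add_pos_nonneg)
  also have "\<dots> \<le> (1 + 2 * L / M) powr (M / 4)"
    using L M0 i1 j by (intro powr_mono) (auto simp: field_simps)
  finally show ?thesis .
qed

text \<open>
  The dominating function for \<open>shell_density_tendsto\<close>. The power \<open>j\<close> is free, and is later chosen large
  enough for integrability in dimension \<open>k\<close>.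
\<close>

lemma shell_density_bound:
  fixes T :: "real \<Rightarrow> real" and k j :: nat
  assumes T: "T \<sim>[at_top] weibull_tail p N q \<delta>" and p: "0 < p" "0 < q" "0 < \<delta>"
    and T0: "\<And>v. 0 \<le> T v" and \<eta>: "0 < \<eta>" "\<eta> \<le> 1" and \<Lambda>0: "0 \<le> \<Lambda>0" and j: "0 < j"
  shows "\<exists>u0 C. \<forall>u\<ge>u0. \<forall>\<Lambda> \<beta> m g. m = q * \<delta> * u powr \<delta> \<longrightarrow> g = sqrt (1 + 2 * \<Lambda> / m + \<beta> / m\<^sup>2) \<longrightarrow> - \<Lambda>0 \<le> \<Lambda> \<longrightarrow> 0 \<le> \<beta> \<longrightarrow>
     (T (u * (g * exp (- (\<eta> / m)))) - T (u * g)) / (T u * (\<eta> * g ^ k)) \<le> C / (1 + (\<Lambda> + \<Lambda>0) / (4 * real j)) ^ j"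
proof -
  obtain u0 where u0: "\<And>u. u \<ge> u0 \<Longrightarrow> 0 < T u"
    "\<And>u x. u \<ge> u0 \<Longrightarrow> x \<ge> 1/2 \<Longrightarrow> T (u * x) \<le> 4 * x powr (N - q * \<delta> * u powr \<delta>) * T u"
    using tail_ratio_bound[OF T p] by blast
  have "filterlim (\<lambda>u. q * \<delta> * u powr \<delta>) at_top at_top"
    using p by real_asymp
  moreover have "\<forall>\<^sub>F m::real in at_top. 1 \<le> m \<and> 4 * real j \<le> m \<and> 2 * \<bar>real k - N\<bar> \<le> m \<and> 4 * \<Lambda>0 \<le> m \<and> 1/4 \<le> (1 - 2 * \<Lambda>0 / m) * exp (- (2 / m))"
  proof (intro eventually_conj eventually_ge_at_top)
    have "((\<lambda>m. (1 - 2 * \<Lambda>0 / m) * exp (- (2 / m))) \<longlongrightarrow> 1) at_top" by real_asymp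
    from order_tendstoD(1)[OF this, of "1/4"] show "\<forall>\<^sub>F m::real in at_top. 1/4 \<le> (1 - 2 * \<Lambda>0 / m) * exp (- (2 / m))"
      by (auto elim: eventually_mono)
  qed
  ultimately have "\<forall>\<^sub>F u in at_top. (let m = q * \<delta> * u powr \<delta> in 1 \<le> m \<and> 4 * real j \<le> m \<and> 2 * \<bar>real k - N\<bar> \<le> m \<and> 4 * \<Lambda>0 \<le> m \<and> 1/4 \<le> (1 - 2 * \<Lambda>0 / m) * exp (- (2 / m)))"
    unfolding Let_def by (rule filterlim_iff[THEN iffD1, rule_format])
  then obtain u1 where u1: "\<And>u. u \<ge> u1 \<Longrightarrow> (let m = q * \<delta> * u powr \<delta> in 1 \<le> m \<and> 4 * real j \<le> m \<and> 2 * \<bar>real k - N\<bar> \<le> m \<and> 4 * \<Lambda>0 \<le> m \<and> 1/4 \<le> (1 - 2 * \<Lambda>0 / m) * exp (- (2 / m)))"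
    unfolding eventually_at_top_linorder by blast
  show ?thesis
  proof (rule exI[of _ "max u0 u1"], rule exI[of _ "4 / \<eta> * (exp (4 * \<Lambda>0) * exp 2)"], intro allI impI)
    fix u \<Lambda> \<beta> m g
    assume u: "max u0 u1 \<le> u" and m_def: "m = q * \<delta> * u powr \<delta>" and g_def: "g = sqrt (1 + 2 * \<Lambda> / m + \<beta> / m\<^sup>2)"
      and \<Lambda>: "- \<Lambda>0 \<le> \<Lambda>" and \<beta>: "0 \<le> \<beta>"
    have m: "1 \<le> m" "4 * real j \<le> m" "2 * \<bar>real k - N\<bar> \<le> m" "4 * \<Lambda>0 \<le> m" "1/4 \<le> (1 - 2 * \<Lambda>0 / m) * exp (- (2 / m))"
      using u1[of u] u unfolding m_def by (auto simp: Let_def)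
    have Tu: "0 < T u" using u0(1) u by simp
    \<comment> \<open>L is nonnegative, and the loss from replacing \<Lambda> by L is the bounded factor exp (4 * \<Lambda>0).\<close>
    define L where "L = \<Lambda> + \<Lambda>0"
    define x where "x = g * exp (- (\<eta> / m))"
    \<comment> \<open>A lower bound for the square of the relative radius x of the inner shell boundary.\<close>
    define w where "w = (1 + 2 * L / m) * (1 - 2 * \<Lambda>0 / m) * exp (- (2 / m))"
    define P where "P = (m + k - N) / 2"
    have L: "0 \<le> L" using \<Lambda> by (simp add: L_def)
    have m0: "0 < m" using m(1) by simp
    have c: "1/2 \<le> 1 - 2 * \<Lambda>0 / m" using m(4) m0 by (simp add: field_simps)
    have "(1 + 2 * L / m) * (1 - 2 * \<Lambda>0 / m) = 1 + 2 * \<Lambda> / m - (2 * L / m) * (2 * \<Lambda>0 / m)"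
      using m0 by (simp add: L_def field_simps)
    also have "\<dots> \<le> 1 + 2 * \<Lambda> / m" using L \<Lambda>0 m0 by simp
    also have "\<dots> \<le> 1 + 2 * \<Lambda> / m + \<beta> / m\<^sup>2" using \<beta> by simp
    finally have le: "(1 + 2 * L / m) * (1 - 2 * \<Lambda>0 / m) \<le> 1 + 2 * \<Lambda> / m + \<beta> / m\<^sup>2" .
    have pos: "0 < (1 + 2 * L / m) * (1 - 2 * \<Lambda>0 / m)" using L m0 c by (intro mult_pos_pos) (auto intro!: add_pos_nonneg)
    have g2: "g\<^sup>2 = 1 + 2 * \<Lambda> / m + \<beta> / m\<^sup>2" unfolding g_def using le pos by (intro real_sqrt_pow2) linarith
    have g0: "0 < g" unfolding g_def using le pos by simp
    have x0: "0 < x" unfolding x_def using g0 by simp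
    have "exp (- (\<eta> / m)) ^ 2 = exp (- (2 * \<eta> / m))" by (simp add: exp_double[symmetric])
    then have x2: "x\<^sup>2 = g\<^sup>2 * exp (- (2 * \<eta> / m))" unfolding x_def by (simp add: power_mult_distrib)
    have "exp (- (2 / m)) \<le> exp (- (2 * \<eta> / m))" using m0 \<eta> by (simp add: divide_right_mono)
    moreover have "0 \<le> 1 + 2 * \<Lambda> / m + \<beta> / m\<^sup>2" using le pos by linarith
    ultimately have wx: "w \<le> x\<^sup>2" unfolding x2 g2 w_def
      using le by (intro mult_mono) auto
    have w0: "0 < w" unfolding w_def using pos by simp
    have "1/4 \<le> (1 + 2 * L / m) * ((1 - 2 * \<Lambda>0 / m) * exp (- (2 / m)))"
      using mult_mono[of 1 "1 + 2 * L / m", OF _ m(5)] L m0 by simp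
    then have "(1/2)\<^sup>2 \<le> x\<^sup>2" using wx unfolding w_def by (simp add: power2_eq_square mult.assoc)
    then have xh: "1/2 \<le> x" using x0 by (simp add: power2_le_iff_abs_le)
    have xg: "x \<le> g" unfolding x_def using g0 \<eta> m0 by (simp add: mult_le_cancel_left1)
    have P: "m / 4 \<le> P" "P \<le> m" using m(3) unfolding P_def by (auto simp: abs_if split: if_splits)
    have "x powr (N - m) / x powr k = x powr (2 * (- P))"
    proof -
      have "2 * (- P) = N - m - real k" by (simp add: P_def field_simps)
      then show ?thesis using x0 by (simp only: powr_diff)
    qed
    also have "\<dots> = (x\<^sup>2) powr (- P)" using x0 powr_powr[of x 2 "- P"] by (simp add: powr_numeral)
    also have "(x\<^sup>2) powr (- P) \<le> w powr (- P)"
      using wx w0 P m0 by (intro powr_mono2') auto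
    also have "w powr (- P) = (1 + 2 * L / m) powr (- P) * ((1 - 2 * \<Lambda>0 / m) powr (- P) * exp (- (2 / m)) powr (- P))"
      unfolding w_def using L m0 c by (simp add: powr_mult mult.assoc)
    also have "\<dots> \<le> 1 / (1 + L / (4 * real j)) ^ j * (exp (4 * \<Lambda>0) * exp 2)"
    proof (intro mult_mono)
      have "(1 + 2 * L / m) powr (- P) \<le> (1 + 2 * L / m) powr (- (m / 4))"
        using P L m0 by (intro powr_mono) auto
      also have "\<dots> = 1 / (1 + 2 * L / m) powr (m / 4)" by (rule powr_minus_divide)
      also have "\<dots> \<le> 1 / (1 + L / (4 * real j)) ^ j"
      proof (rule frac_le[OF zero_le_one order_refl _ one_plus_powr_ge[OF L j m(2)]])
        show "0 < (1 + L / (4 * real j)) ^ j" using L by (intro zero_less_power add_pos_nonneg) auto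
      qed
      finally show "(1 + 2 * L / m) powr (- P) \<le> 1 / (1 + L / (4 * real j)) ^ j" .
      define z where "z = 2 * \<Lambda>0 / m"
      have z: "0 \<le> z" "z \<le> 1/2" unfolding z_def using \<Lambda>0 m0 m(4) by (auto simp: field_simps)
      have "- ln (1 - z) \<le> z / (1 - z)"
        using ln_add_one_self_le_self2[of "z / (1 - z)"] z ln_div[of 1 "1 - z"] by (simp add: field_simps)
      also have "\<dots> \<le> z / (1/2)" using z by (intro divide_left_mono) auto
      finally have "P * (- ln (1 - z)) \<le> m * (2 * z)" using P m0 z by (intro mult_mono) auto
      also have "\<dots> = 4 * \<Lambda>0" using m0 by (simp add: z_def)
      finally show "(1 - 2 * \<Lambda>0 / m) powr (- P) \<le> exp (4 * \<Lambda>0)"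
        unfolding z_def[symmetric] using z by (simp add: powr_def)
      show "exp (- (2 / m)) powr (- P) \<le> exp 2"
        using P m0 by (simp add: powr_def field_simps)
    qed (use L in auto)
    finally have le2: "x powr (N - m) / x powr k \<le> 1 / (1 + L / (4 * real j)) ^ j * (exp (4 * \<Lambda>0) * exp 2)" .
    have "(T (u * x) - T (u * g)) / (T u * (\<eta> * g ^ k)) \<le> T (u * x) / (T u * (\<eta> * x ^ k))"
      using T0 Tu \<eta> x0 g0 xg by (intro frac_le mult_left_mono power_mono mult_pos_pos) auto
    also have "\<dots> \<le> (4 * x powr (N - m) * T u) / (T u * (\<eta> * x ^ k))"
      using u0(2)[of u x] u xh Tu \<eta> x0 unfolding m_def by (intro divide_right_mono) auto
    also have "\<dots> = 4 / \<eta> * (x powr (N - m) / x powr k)"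
      using Tu x0 by (simp add: powr_realpow)
    also have "\<dots> \<le> 4 / \<eta> * (1 / (1 + L / (4 * real j)) ^ j * (exp (4 * \<Lambda>0) * exp 2))"
      using \<eta> by (intro mult_left_mono le2) auto
    also have "\<dots> = 4 / \<eta> * (exp (4 * \<Lambda>0) * exp 2) / (1 + L / (4 * real j)) ^ j" by simp
    finally show "(T (u * (g * exp (- (\<eta> / m)))) - T (u * g)) / (T u * (\<eta> * g ^ k))
      \<le> 4 / \<eta> * (exp (4 * \<Lambda>0) * exp 2) / (1 + (\<Lambda> + \<Lambda>0) / (4 * real j)) ^ j"
      unfolding x_def L_def .
  qed
qed

section \<open>Padded submatrices and their inverses\<close>

text \<open>
  Padding is multiplication by coordinate projections, so that identities between blocks become
  identities in the ring of square matrices.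
\<close>

abbreviation coord_proj :: "'k set \<Rightarrow> real ^ 'k ^ 'k::finite" where
  "coord_proj K \<equiv> submat (mat 1) K K"

lemma coord_proj_nth: "coord_proj K $ i $ j = (if i = j then of_bool (i \<in> K) else 0)"
  by (simp add: submat_def mat_def)

lemma delta_mult:
  "(if b then u else 0) * y = (if b then u * y else 0)"
  "y * (if b then u else 0) = (if b then y * u else (0::real))"
  by simp_all

lemma submat_eq_proj: "submat S K L = coord_proj K ** S ** coord_proj L"
  by (simp add: vec_eq_iff matrix_matrix_mult_def coord_proj_nth delta_mult) (simp add: submat_def)

lemma subvec_eq_proj: "subvec x K = coord_proj K *v x"
  by (simp add: vec_eq_iff matrix_vector_mult_def coord_proj_nth delta_mult) (simp add: subvec_def)

lemma coord_proj_mult: "coord_proj K ** coord_proj L = coord_proj (K \<inter> L)"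
  by (simp add: vec_eq_iff matrix_matrix_mult_def coord_proj_nth delta_mult)

lemma coord_proj_add_compl: "coord_proj K + coord_proj (- K) = mat 1"
  by (simp add: vec_eq_iff coord_proj_nth) (simp add: mat_def)

lemma transpose_coord_proj: "transpose (coord_proj K) = coord_proj K"
  by (simp add: vec_eq_iff transpose_def coord_proj_nth)

lemma matrix_zero_mult: "(0 :: real ^ 'n ^ 'm) ** A = 0"
  by (simp add: vec_eq_iff matrix_matrix_mult_def)

lemma matrix_add_mult: "(A + B :: real ^ 'n ^ 'm) ** C = A ** C + B ** C"
  by (simp add: vec_eq_iff matrix_matrix_mult_def algebra_simps sum.distrib)

lemma matrix_diff_mult: "(A - B :: real ^ 'n ^ 'm) ** C = A ** C - B ** C"
  by (simp add: vec_eq_iff matrix_matrix_mult_def algebra_simps sum_subtractf)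

lemma matrix_mult_diff: "(A :: real ^ 'n ^ 'm) ** (B - C) = A ** B - A ** C"
  by (simp add: vec_eq_iff matrix_matrix_mult_def algebra_simps sum_subtractf)

lemma transpose_diff: "transpose (A - B :: real ^ 'n ^ 'm) = transpose A - transpose B"
  by (simp add: vec_eq_iff transpose_def)

lemma coord_proj_empty: "coord_proj {} = 0"
  by (simp add: vec_eq_iff coord_proj_nth)

lemma inner_matrix_sym:
  assumes "transpose S = S"
  shows "x \<bullet> (S *v y) = (S *v x) \<bullet> (y :: real ^ 'k::finite)"
  using dot_lmul_matrix[of x S y] transpose_matrix_vector[of S x] assms by simp

lemma inner_coord_proj: "x \<bullet> (coord_proj K *v y) = (coord_proj K *v x) \<bullet> y"
  by (rule inner_matrix_sym[OF transpose_coord_proj])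

text \<open>
  Positive definiteness of the principal submatrix with index set \<open>K\<close>. The Schur complement satisfies
  this on the complement of \<open>I\<close> only, since it is padded with zeros.
\<close>

definition posdef_on :: "'k set \<Rightarrow> real ^ 'k ^ 'k::finite \<Rightarrow> bool" where
  "posdef_on K S \<longleftrightarrow> transpose S = S \<and> (\<forall>x. x \<noteq> 0 \<longrightarrow> coord_proj K *v x = x \<longrightarrow> 0 < x \<bullet> (S *v x))"

lemma correlation_matrix_posdef_on: "correlation_matrix S \<Longrightarrow> posdef_on K S"
  by (simp add: correlation_matrix_def posdef_on_def)

lemma coord_proj_UNIV: "coord_proj UNIV = mat 1"
  by (simp add: vec_eq_iff submat_def mat_def)

lemma posdef_on_subset: "posdef_on UNIV S \<Longrightarrow> posdef_on K S"
  by (simp add: posdef_on_def coord_proj_UNIV)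

text \<open>
  Completing a principal block by the identity outside \<open>K\<close> gives a positive definite matrix of full size,
  whose inverse and determinant contain those of the block.
\<close>

lemma posdef_on_completion:
  assumes S: "posdef_on K S" and "x \<noteq> 0"
  shows "0 < x \<bullet> ((submat S K K + coord_proj (- K)) *v x)"
proof -
  let ?y = "coord_proj K *v x" and ?z = "coord_proj (- K) *v x"
  have "x \<bullet> (submat S K K *v x) = ?y \<bullet> (S *v ?y)"
    by (simp add: submat_eq_proj[of S] matrix_vector_mul_assoc[symmetric] inner_coord_proj)
  moreover have "coord_proj (- K) *v ?z = ?z" by (simp add: matrix_vector_mul_assoc coord_proj_mult)
  then have "x \<bullet> ?z = ?z \<bullet> ?z" by (metis inner_coord_proj)
  ultimately have eq: "x \<bullet> ((submat S K K + coord_proj (- K)) *v x) = ?y \<bullet> (S *v ?y) + ?z \<bullet> ?z"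
    by (simp add: matrix_vector_mult_add_rdistrib inner_add_right)
  have "coord_proj K *v ?y = ?y" by (simp add: matrix_vector_mul_assoc coord_proj_mult)
  then have y: "?y \<noteq> 0 \<Longrightarrow> 0 < ?y \<bullet> (S *v ?y)" using S unfolding posdef_on_def by blast
  have "x = ?y + ?z" by (simp add: matrix_vector_mult_add_rdistrib[symmetric] coord_proj_add_compl)
  then have "?y \<noteq> 0 \<or> ?z \<noteq> 0" using \<open>x \<noteq> 0\<close> by auto
  then show ?thesis unfolding eq
    using y by (cases "?y = 0") (auto intro: add_pos_nonneg)
qed

lemma posdef_invertible:
  assumes "\<And>x. x \<noteq> 0 \<Longrightarrow> 0 < x \<bullet> (P *v x)"
  shows "invertible (P :: real ^ 'k ^ 'k::finite)"
proof -
  have "x = 0" if "P *v x = 0" for x using assms[of x] that by (cases "x = 0") auto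
  then show ?thesis unfolding invertible_left_inverse matrix_left_invertible_ker by blast
qed

lemma coord_proj_idem: "coord_proj K ** coord_proj K = coord_proj K"
  by (simp add: coord_proj_mult)

lemma submat_absorb:
  assumes "submat B K K = B"
  shows "coord_proj K ** B = B" "B ** coord_proj K = B"
proof -
  have B: "B = coord_proj K ** B ** coord_proj K" using assms submat_eq_proj[of B K K] by simp
  have "coord_proj K ** (coord_proj K ** B ** coord_proj K) = coord_proj K ** B ** coord_proj K"
    by (simp only: matrix_mul_assoc coord_proj_idem)
  then show "coord_proj K ** B = B" using B by simp
  have "(coord_proj K ** B ** coord_proj K) ** coord_proj K = coord_proj K ** B ** (coord_proj K ** coord_proj K)"
    by (simp only: matrix_mul_assoc)
  then show "B ** coord_proj K = B" using B by (simp add: coord_proj_idem)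
qed

lemma is_sub_inv_unique:
  assumes B: "is_sub_inv S K B" and C: "is_sub_inv S K C"
  shows "B = C"
proof -
  note B' = B[unfolded is_sub_inv_def] and C' = C[unfolded is_sub_inv_def]
  have "B = B ** coord_proj K" using submat_absorb B' by metis
  also have "\<dots> = B ** (submat S K K ** C)" using C' by simp
  also have "\<dots> = (B ** submat S K K) ** C" by (rule matrix_mul_assoc)
  also have "\<dots> = coord_proj K ** C" using B' by simp
  also have "\<dots> = C" using submat_absorb C' by metis
  finally show ?thesis .
qed

lemma is_sub_inv_sub_inv:
  assumes S: "posdef_on K S"
  shows "is_sub_inv S K (sub_inv S K)"
proof -
  let ?E = "coord_proj K"
  define P where "P = submat S K K + coord_proj (- K)"
  have "invertible P" by (rule posdef_invertible) (simp add: P_def posdef_on_completion[OF S])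
  then obtain Q where Q: "P ** Q = mat 1" "Q ** P = mat 1" unfolding invertible_def by blast
  have EE: "?E ** ?E = ?E" "?E ** coord_proj (- K) = 0" "coord_proj (- K) ** ?E = 0"
    by (simp_all add: coord_proj_mult coord_proj_empty)
  have EEX: "?E ** (?E ** X) = ?E ** X" "?E ** (coord_proj (- K) ** X) = 0" "coord_proj (- K) ** (?E ** X) = 0" for X
    by (simp_all only: matrix_mul_assoc EE matrix_zero_mult)
  have EP: "?E ** P = submat S K K" "P ** ?E = submat S K K"
    by (simp_all add: P_def submat_eq_proj[of S] matrix_add_ldistrib matrix_add_mult matrix_mul_assoc[symmetric] EE EEX)
  have "P ** (?E ** Q) = (P ** ?E) ** Q" by (rule matrix_mul_assoc)
  also have "\<dots> = (?E ** P) ** Q" by (simp only: EP)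
  also have "\<dots> = ?E ** (P ** Q)" by (rule matrix_mul_assoc[symmetric])
  finally have PEQ: "P ** (?E ** Q) = ?E" by (simp add: Q)
  have "Q ** ?E = Q ** (P ** (?E ** Q))" by (simp only: PEQ)
  also have "\<dots> = ?E ** Q" by (simp only: matrix_mul_assoc Q matrix_mul_lid)
  finally have QE: "Q ** ?E = ?E ** Q" .
  have "is_sub_inv S K (?E ** Q)"
    unfolding is_sub_inv_def
  proof (intro conjI)
    show "submat (?E ** Q) K K = ?E ** Q"
      by (simp add: submat_eq_proj[of "?E ** Q"] matrix_mul_assoc[symmetric] QE EEX)
    have "submat S K K ** (?E ** Q) = ?E ** (P ** (?E ** Q))"
      by (simp only: EP(1)[symmetric] matrix_mul_assoc)
    then show "submat S K K ** (?E ** Q) = ?E" by (simp only: PEQ EE)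
    have "?E ** Q ** submat S K K = ?E ** (Q ** P ** ?E)"
      by (simp only: EP(2)[symmetric] matrix_mul_assoc)
    then show "?E ** Q ** submat S K K = ?E" by (simp add: Q EE)
  qed
  then show ?thesis
    unfolding sub_inv_def by (rule theI[of "is_sub_inv S K"]) (rule is_sub_inv_unique[OF _ \<open>is_sub_inv S K (?E ** Q)\<close>])
qed

lemma transpose_submat: "transpose S = S \<Longrightarrow> transpose (submat S K L) = submat S L K"
  by (simp add: submat_def transpose_def vec_eq_iff)

lemma sub_inv_laws:
  assumes S: "posdef_on K S"
  shows "coord_proj K ** sub_inv S K = sub_inv S K" "sub_inv S K ** coord_proj K = sub_inv S K"
    "submat S K K ** sub_inv S K = coord_proj K" "sub_inv S K ** submat S K K = coord_proj K"
    "transpose (sub_inv S K) = sub_inv S K"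
proof -
  note i = is_sub_inv_sub_inv[OF S]
  note i' = i[unfolded is_sub_inv_def]
  show "coord_proj K ** sub_inv S K = sub_inv S K" "sub_inv S K ** coord_proj K = sub_inv S K"
    using i' by (auto intro: submat_absorb)
  show "submat S K K ** sub_inv S K = coord_proj K" "sub_inv S K ** submat S K K = coord_proj K"
    using i' by auto
  have sym: "transpose S = S" using S by (simp add: posdef_on_def)
  have tr: "transpose (submat X K K) = submat (transpose X) K K" for X :: "real ^ 'a ^ 'a"
    by (simp add: submat_def transpose_def vec_eq_iff)
  have "is_sub_inv S K (transpose (sub_inv S K))"
    unfolding is_sub_inv_def
  proof (intro conjI)
    show "submat (transpose (sub_inv S K)) K K = transpose (sub_inv S K)"
      using i' by (simp add: tr[symmetric])
    have "submat S K K ** transpose (sub_inv S K) = transpose (sub_inv S K ** submat S K K)"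
      by (simp add: matrix_transpose_mul transpose_submat[OF sym])
    then show "submat S K K ** transpose (sub_inv S K) = coord_proj K"
      using i' by (simp add: transpose_coord_proj)
    have "transpose (sub_inv S K) ** submat S K K = transpose (submat S K K ** sub_inv S K)"
      by (simp add: matrix_transpose_mul transpose_submat[OF sym])
    then show "transpose (sub_inv S K) ** submat S K K = coord_proj K"
      using i' by (simp add: transpose_coord_proj)
  qed
  then show "transpose (sub_inv S K) = sub_inv S K" using is_sub_inv_unique i by blast
qed

lemma sub_inv_pos:
  assumes S: "posdef_on K S" and x: "coord_proj K *v x = x" "x \<noteq> 0"
  shows "0 < x \<bullet> (sub_inv S K *v x)"
proof -
  note l = sub_inv_laws[OF S]
  let ?h = "sub_inv S K *v x"
  have h: "coord_proj K *v ?h = ?h" by (simp add: matrix_vector_mul_assoc l)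
  have "submat S K K *v ?h = x" using x by (simp add: matrix_vector_mul_assoc l)
  then have xh: "coord_proj K *v (S *v ?h) = x"
    by (simp add: submat_eq_proj[of S] matrix_vector_mul_assoc[symmetric] h)
  then have "?h \<noteq> 0" using x by auto
  then have "0 < ?h \<bullet> (S *v ?h)" using S h unfolding posdef_on_def by blast
  also have "?h \<bullet> (S *v ?h) = ?h \<bullet> x" using xh h by (metis inner_coord_proj)
  finally show ?thesis by (simp add: inner_commute)
qed

text \<open>
  The minimum over the compact unit sphere is attained, and the form is homogeneous of degree two.
\<close>

lemma posdef_form_lower_bound:
  fixes P :: "real ^ 'k ^ 'k::finite"
  assumes "\<And>x. x \<noteq> 0 \<Longrightarrow> 0 < x \<bullet> (P *v x)"
  shows "\<exists>c>0. \<forall>x. c * (norm x)\<^sup>2 \<le> x \<bullet> (P *v x)"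
proof -
  have "compact (sphere (0::real^'k) 1)" "sphere (0::real^'k) 1 \<noteq> {}" by auto
  moreover have "continuous_on (sphere 0 1) (\<lambda>x. x \<bullet> (P *v x))"
    by (intro continuous_intros linear_continuous_on) (simp add: linear_linear)
  ultimately obtain x0 where x0: "x0 \<in> sphere 0 1" "\<And>x. x \<in> sphere 0 1 \<Longrightarrow> x0 \<bullet> (P *v x0) \<le> x \<bullet> (P *v x)"
    using continuous_attains_inf[of "sphere (0::real^'k) 1" "\<lambda>x. x \<bullet> (P *v x)"] by blast
  have "x0 \<noteq> 0" using x0(1) by auto
  show ?thesis
  proof (intro exI[of _ "x0 \<bullet> (P *v x0)"] conjI allI)
    show "0 < x0 \<bullet> (P *v x0)" by (rule assms) fact
    fix x :: "real ^ 'k"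
    show "x0 \<bullet> (P *v x0) * (norm x)\<^sup>2 \<le> x \<bullet> (P *v x)"
    proof (cases "x = 0")
      case False
      have "x0 \<bullet> (P *v x0) \<le> sgn x \<bullet> (P *v sgn x)" using False by (intro x0(2)) (simp add: norm_sgn)
      also have "sgn x \<bullet> (P *v sgn x) = x \<bullet> (P *v x) / (norm x)\<^sup>2"
        by (simp add: sgn_div_norm scaleR_matrix_vector_assoc[symmetric] matrix_vector_mult_scaleR power2_eq_square divide_inverse)
      finally show ?thesis using False by (simp add: field_simps)
    qed simp
  qed
qed

text \<open>
  The determinant does not vanish along the segment from the identity to \<open>P\<close>, and is 1 at its start.
\<close>

lemma posdef_det_pos:
  fixes P :: "real ^ 'k ^ 'k::finite"
  assumes P: "\<And>x. x \<noteq> 0 \<Longrightarrow> 0 < x \<bullet> (P *v x)"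
  shows "0 < det P"
proof (rule ccontr)
  assume "\<not> 0 < det P"
  \<comment> \<open>A segment of positive definite matrices from the identity to P.\<close>
  define F where "F s = (\<chi> i j. (1 - s) * mat 1 $ i $ j + s * P $ i $ j :: real ^ 'k ^ 'k)" for s :: real
  have "continuous_on {0..1} (\<lambda>s. det (F s))"
    unfolding det_def F_def by (intro continuous_intros)
  moreover have "F 0 = mat 1" "F 1 = P" by (simp_all add: F_def vec_eq_iff)
  ultimately obtain s where s: "0 \<le> s" "s \<le> 1" "det (F s) = 0"
    using IVT2'[of "\<lambda>s. det (F s)" 1 0 0] \<open>\<not> 0 < det P\<close> by auto
  have "0 < x \<bullet> (F s *v x)" if "x \<noteq> 0" for x
  proof -
    have "F s *v x = (1 - s) *\<^sub>R x + s *\<^sub>R (P *v x)"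
      by (simp add: F_def vec_eq_iff matrix_vector_mult_def mat_def algebra_simps sum.distrib sum_distrib_left sum_subtractf delta_mult
          if_distrib[of "\<lambda>u. _ * u"] cong: if_cong)
    then have "x \<bullet> (F s *v x) = (1 - s) * (x \<bullet> x) + s * (x \<bullet> (P *v x))" by (simp add: inner_add_right)
    moreover have "0 < x \<bullet> x" "0 < x \<bullet> (P *v x)" using that P by auto
    ultimately show ?thesis using s(1,2)
      by (cases "s = 1") (auto intro!: add_pos_nonneg mult_pos_pos)
  qed
  then have "invertible (F s)" by (rule posdef_invertible)
  then show False using s(3) by (simp add: invertible_det_nz)
qed

text \<open>
  A permutation that moves an index outside \<open>K\<close> meets a zero entry of the completed matrix.
\<close>

lemma sub_det_eq_det: "sub_det S K = det (submat S K K + coord_proj (- K))"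
proof -
  let ?P = "submat S K K + coord_proj (- K)"
  have P: "?P $ i $ j = (if i \<in> K \<and> j \<in> K then S $ i $ j else if i = j \<and> i \<notin> K then 1 else 0)" for i j
    by (auto simp: submat_def mat_def)
  have "det ?P = (\<Sum>p | p permutes K. of_int (sign p) * (\<Prod>i\<in>UNIV. ?P $ i $ p i))"
    unfolding det_def
  proof (rule sum.mono_neutral_right)
    show "finite {p. p permutes (UNIV :: 'a set)}" by (simp add: finite_permutations)
    show "{p. p permutes K} \<subseteq> {p. p permutes UNIV}" by (auto intro: permutes_subset)
    show "\<forall>p\<in>{p. p permutes UNIV} - {p. p permutes K}. of_int (sign p) * (\<Prod>i\<in>UNIV. ?P $ i $ p i) = 0"
    proof
      fix p assume "p \<in> {p. p permutes UNIV} - {p. p permutes K}"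
      then have "p permutes UNIV" "\<not> p permutes K" by auto
      then obtain i where "i \<notin> K" "p i \<noteq> i" unfolding permutes_def by auto
      then have "?P $ i $ p i = 0" unfolding P by simp
      then have "(\<Prod>i\<in>UNIV. ?P $ i $ p i) = 0" by (intro prod_zero) auto
      then show "of_int (sign p) * (\<Prod>i\<in>UNIV. ?P $ i $ p i) = 0" by simp
    qed
  qed
  also have "\<dots> = sub_det S K"
    unfolding sub_det_def
  proof (intro sum.cong refl arg_cong2[where f="(*)"])
    fix p assume "p \<in> {p. p permutes K}"
    then have p: "p permutes K" by simp
    have "(\<Prod>i\<in>UNIV. ?P $ i $ p i) = (\<Prod>i\<in>K. ?P $ i $ p i)"
    proof (intro prod.mono_neutral_right ballI)
      fix i assume "i \<in> UNIV - K"
      then show "?P $ i $ p i = 1" unfolding P using permutes_not_in[OF p, of i] by simp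
    qed auto
    also have "\<dots> = (\<Prod>i\<in>K. S $ i $ p i)"
    proof (intro prod.cong refl)
      fix i assume "i \<in> K"
      then show "?P $ i $ p i = S $ i $ p i" unfolding P using permutes_in_image[OF p, of i] by simp
    qed
    finally show "(\<Prod>i\<in>UNIV. ?P $ i $ p i) = (\<Prod>i\<in>K. S $ i $ p i)" .
  qed
  finally show ?thesis ..
qed

lemma sub_det_pos: "posdef_on K S \<Longrightarrow> 0 < sub_det S K"
  unfolding sub_det_eq_det by (rule posdef_det_pos) (rule posdef_on_completion)

text \<open>
  The form of the Schur complement at \<open>x\<close> is the form of \<open>S\<close> at \<open>x - S\<^sub>I\<^sub>I\<^sup>-\<^sup>1 S x\<close>, the vector whose image under
  \<open>S\<close> has no component in \<open>I\<close>.
\<close>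

lemma schur_compl_laws:
  fixes S :: "real ^ 'k ^ 'k::finite"
  assumes S: "posdef_on UNIV S"
  shows "coord_proj (- I) ** schur_compl S I = schur_compl S I"
    "schur_compl S I ** coord_proj (- I) = schur_compl S I"
    "transpose (schur_compl S I) = schur_compl S I"
    "posdef_on (- I) (schur_compl S I)"
proof -
  let ?E = "coord_proj I" and ?F = "coord_proj (- I)" and ?B = "sub_inv S I" and ?C = "schur_compl S I"
  have SI: "posdef_on I S" by (rule posdef_on_subset[OF S])
  have sym: "transpose S = S" using S by (simp add: posdef_on_def)
  note l = sub_inv_laws[OF SI]
  have FF: "?F ** ?F = ?F" "?F ** ?E = 0" "?E ** ?F = 0" "?E ** ?E = ?E"
    by (simp_all add: coord_proj_mult coord_proj_empty)
  have FFX: "?F ** (?F ** X) = ?F ** X" "?F ** (?E ** X) = 0" "?E ** (?F ** X) = 0" "?E ** (?E ** X) = ?E ** X" for X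
    by (simp_all only: matrix_mul_assoc FF matrix_zero_mult)
  have C: "?C = ?F ** S ** ?F - ?F ** S ** ?B ** S ** ?F"
  proof -
    have "?F ** S ** ?E ** ?B ** (?E ** S ** ?F) = ?F ** S ** (?E ** ?B ** ?E) ** S ** ?F"
      by (simp only: matrix_mul_assoc)
    then show ?thesis unfolding schur_compl_def submat_eq_proj[of S] by (simp only: l)
  qed
  show "?F ** ?C = ?C" "?C ** ?F = ?C"
    unfolding C by (simp_all add: matrix_mult_diff matrix_diff_mult matrix_mul_assoc[symmetric] FFX FF)
  show tr: "transpose ?C = ?C"
    unfolding C by (simp add: transpose_diff matrix_transpose_mul transpose_coord_proj sym l matrix_mul_assoc)
  show "posdef_on (- I) ?C"
    unfolding posdef_on_def
  proof (intro conjI allI impI tr)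
    fix x assume x: "x \<noteq> 0" "?F *v x = x"
    define g where "g = x - ?B *v (S *v x)"
    have "?F *v (?B *v y) = 0" for y
    proof -
      have "?F *v (?B *v y) = (?F ** (?E ** ?B)) *v y" by (simp only: l matrix_vector_mul_assoc)
      then show ?thesis by (simp add: FFX)
    qed
    then have Fg: "?F *v g = x" by (simp add: g_def matrix_vector_mult_diff_distrib x)
    then have "g \<noteq> 0" using x by auto
    then have "0 < g \<bullet> (S *v g)" using S by (simp add: posdef_on_def coord_proj_UNIV)
    have 1: "?E *v (S *v g) = 0"
    proof -
      have "?E *v (S *v g) = ?E *v (S *v x) - (?E ** S ** ?B) *v (S *v x)"
        by (simp add: g_def matrix_vector_mult_diff_distrib matrix_vector_mul_assoc matrix_mul_assoc)
      also have "?E ** S ** ?B = ?E ** S ** (?E ** ?B)" by (simp only: l)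
      also have "\<dots> = submat S I I ** ?B" by (simp only: submat_eq_proj[of S] matrix_mul_assoc)
      also have "\<dots> = ?E" by (rule l)
      finally show ?thesis by simp
    qed
    have 2: "?F *v (S *v g) = ?C *v x"
    proof -
      have "?C *v x = ?F *v (S *v (?F *v x)) - ?F *v (S *v (?B *v (S *v (?F *v x))))"
        unfolding C by (simp add: matrix_vector_mult_diff_rdistrib matrix_vector_mul_assoc matrix_mul_assoc)
      then show ?thesis by (simp add: x g_def matrix_vector_mult_diff_distrib)
    qed
    have "S *v g = ?E *v (S *v g) + ?F *v (S *v g)"
      by (simp add: matrix_vector_mult_add_rdistrib[symmetric] coord_proj_add_compl)
    then have "g \<bullet> (S *v g) = g \<bullet> (?F *v (S *v g))" using 1 by simp
    also have "\<dots> = (?F *v g) \<bullet> (?F *v (S *v g))"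
      by (metis FF(1) inner_coord_proj matrix_vector_mul_assoc)
    also have "\<dots> = x \<bullet> (?C *v x)" using Fg 2 by simp
    finally show "0 < x \<bullet> (?C *v x)" using \<open>0 < g \<bullet> (S *v g)\<close> by simp
  qed
qed

text \<open>
  The left side is the quadratic form of the inverse of \<open>S\<close> at \<open>x\<close>, written with \<open>x = S h\<close> to avoid the
  inverse. The vector \<open>z\<close> is the residual of the coordinates outside \<open>I\<close> after regression on those in \<open>I\<close>;
  it equals the Schur complement applied to the part of \<open>h\<close> outside \<open>I\<close>.
\<close>

lemma inverse_form_blocks:
  fixes S :: "real ^ 'k ^ 'k::finite" and h :: "real ^ 'k"
  assumes S: "posdef_on UNIV S" and x: "x = S *v h"
    and z_def: "z = subvec x (- I) - submat S (- I) I *v (sub_inv S I *v subvec x I)"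
  shows "h \<bullet> (S *v h) = subvec x I \<bullet> (sub_inv S I *v subvec x I) + z \<bullet> (sub_inv (schur_compl S I) (- I) *v z)"
proof -
  let ?E = "coord_proj I" and ?F = "coord_proj (- I)" and ?B = "sub_inv S I" and ?C = "schur_compl S I"
  let ?D = "sub_inv ?C (- I)"
  have SI: "posdef_on I S" by (rule posdef_on_subset[OF S])
  have sym: "transpose S = S" using S by (simp add: posdef_on_def)
  note l = sub_inv_laws[OF SI]
  note c = schur_compl_laws[OF S, of I]
  note d = sub_inv_laws[OF c(4)]
  define p where "p = ?E *v h"
  define r where "r = ?F *v h"
  have h: "h = p + r" unfolding p_def r_def
    by (simp add: matrix_vector_mult_add_rdistrib[symmetric] coord_proj_add_compl)
  have Er: "?E *v r = 0" and Fp: "?F *v p = 0" and Fr: "?F *v r = r" and Ep: "?E *v p = p"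
    unfolding p_def r_def by (simp_all add: matrix_vector_mul_assoc coord_proj_mult coord_proj_empty)
  have BE: "?B *v (?E *v y) = ?B *v y" for y by (simp add: matrix_vector_mul_assoc l)
  have EB: "?E *v (?B *v y) = ?B *v y" for y by (simp add: matrix_vector_mul_assoc l)
  have BSE: "?B *v (S *v p) = p"
  proof -
    have "?B *v (S *v p) = (?B ** submat S I I) *v p"
      by (simp add: submat_eq_proj[of S] matrix_vector_mul_assoc[symmetric] Ep BE)
    then show ?thesis by (simp add: l Ep)
  qed
  define w where "w = ?B *v (S *v r)"
  have Bx: "?B *v subvec x I = p + w"
    unfolding subvec_eq_proj BE x h w_def by (simp add: matrix_vector_right_distrib BSE)
  have Ew: "?E *v w = w" unfolding w_def by (rule EB)
  have zF: "z = ?F *v (S *v (r - w))"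
    unfolding z_def Bx unfolding subvec_eq_proj submat_eq_proj[of S] x h
    by (simp add: matrix_vector_mul_assoc[symmetric] matrix_vector_right_distrib matrix_vector_mult_diff_distrib Ep Ew)
  also have "\<dots> = ?C *v r"
  proof -
    have "?C *v r = ?F *v (S *v (?F *v r)) - ?F *v (S *v (?E *v (?B *v (?E *v (S *v (?F *v r))))))"
      unfolding schur_compl_def submat_eq_proj[of S]
      by (simp add: matrix_vector_mult_diff_rdistrib matrix_vector_mul_assoc[symmetric])
    then show ?thesis by (simp add: Fr BE EB w_def matrix_vector_mult_diff_distrib)
  qed
  finally have zC: "z = ?C *v r" .
  have "?D *v z = (?D ** submat ?C (- I) (- I)) *v r"
    unfolding zC submat_eq_proj[of ?C] by (simp add: c matrix_vector_mul_assoc)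
  then have Dz: "?D *v z = r" by (simp only: d Fr)
  have "z \<bullet> r = (S *v (r - w)) \<bullet> r" unfolding zF by (metis Fr inner_coord_proj)
  also have "\<dots> = (S *v h) \<bullet> r - (S *v (p + w)) \<bullet> r"
    unfolding h by (simp add: matrix_vector_right_distrib matrix_vector_mult_diff_distrib inner_diff_left inner_add_left)
  also have "(S *v (p + w)) \<bullet> r = (p + w) \<bullet> (S *v r)" by (rule inner_matrix_sym[OF sym, symmetric])
  finally have zr: "z \<bullet> r = (S *v h) \<bullet> r - (p + w) \<bullet> (S *v r)" .
  have "subvec x I \<bullet> (p + w) = x \<bullet> (p + w)"
    unfolding subvec_eq_proj by (metis Ep Ew inner_coord_proj matrix_vector_right_distrib)
  also have "\<dots> = (S *v h) \<bullet> p + (S *v (p + r)) \<bullet> w" unfolding x h by (simp add: inner_add_right)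
  also have "(S *v (p + r)) \<bullet> w = (p + r) \<bullet> (S *v w)" by (rule inner_matrix_sym[OF sym, symmetric])
  also have "\<dots> = p \<bullet> (S *v w) + r \<bullet> (S *v w)" by (simp add: inner_add_left)
  also have "p \<bullet> (S *v w) = p \<bullet> (S *v r)"
  proof -
    have "p \<bullet> (S *v w) = p \<bullet> (submat S I I *v w)"
      unfolding submat_eq_proj[of S] using Ep Ew by (metis inner_coord_proj matrix_vector_mul_assoc)
    also have "submat S I I *v w = (submat S I I ** ?B) *v (S *v r)"
      by (simp only: w_def matrix_vector_mul_assoc matrix_mul_assoc)
    also have "\<dots> = ?E *v (S *v r)" by (simp only: l)
    finally show ?thesis using Ep by (metis inner_coord_proj)
  qed
  also have "r \<bullet> (S *v w) = w \<bullet> (S *v r)" by (metis inner_commute inner_matrix_sym[OF sym])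
  finally have "subvec x I \<bullet> (?B *v subvec x I) = (S *v h) \<bullet> p + (p + w) \<bullet> (S *v r)"
    unfolding Bx by (simp add: inner_add_left)
  moreover have "h \<bullet> (S *v h) = (S *v h) \<bullet> p + (S *v h) \<bullet> r" 
    using inner_add_right[of "S *v h" p r] unfolding h[symmetric] by (simp add: inner_commute)
  ultimately show ?thesis using zr Dz by simp
qed

section \<open>Change of variables and product measures\<close>

lemma nn_integral_shift:
  fixes f :: "'a::euclidean_space \<Rightarrow> ennreal"
  assumes [measurable]: "f \<in> borel_measurable borel"
  shows "(\<integral>\<^sup>+ x. f (c + x) \<partial>lborel) = (\<integral>\<^sup>+ x. f x \<partial>lborel)"
proof -
  have "(\<integral>\<^sup>+ x. f x \<partial>lborel) = (\<integral>\<^sup>+ x. f x \<partial>distr lborel borel ((+) c))" by (simp add: lborel_distr_plus)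
  also have "\<dots> = (\<integral>\<^sup>+ x. f (c + x) \<partial>lborel)" by (subst nn_integral_distr) auto
  finally show ?thesis ..
qed

text \<open>
  The image of Lebesgue measure under a linear isomorphism is translation invariant, hence a multiple
  of Lebesgue measure.
\<close>

lemma nn_integral_linear_substitution:
  fixes L :: "'a::euclidean_space \<Rightarrow> 'a"
  assumes L: "linear L" "inj L"
  shows "\<exists>\<kappa>>0. \<forall>c f. f \<in> borel_measurable borel \<longrightarrow>
     (\<integral>\<^sup>+ x. f x \<partial>lborel) = ennreal \<kappa> * (\<integral>\<^sup>+ y. f (c + L y) \<partial>lborel)"
proof -
  obtain G where G: "linear G" "\<And>x. G (L x) = x" "\<And>x. L (G x) = x"
    using linear_injective_isomorphism[OF L] by blast
  have Lc: "continuous_on UNIV L" "continuous_on UNIV G"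
    using L(1) G(1) linear_continuous_on linear_conv_bounded_linear by metis+
  then have [measurable]: "L \<in> borel_measurable borel" "G \<in> borel_measurable borel"
    by (auto intro: borel_measurable_continuous_onI)
  let ?B = "ball (0::'a) 1" and ?V = "L -` ball (0::'a) 1"
  have [measurable]: "?B \<in> sets borel" by simp
  have pos: "emeasure lborel W \<noteq> 0 \<and> emeasure lborel W \<noteq> \<infinity>" if W: "open W" "W \<noteq> {}" "bounded W" for W :: "'a set"
  proof
    obtain x e where xe: "0 < e" "ball x e \<subseteq> W" using W by (meson ex_in_conv open_contains_ball)
    have "emeasure lborel (ball x e) \<noteq> 0"
      using content_ball_pos[OF xe(1), of x] by (auto simp: measure_def)
    then show "emeasure lborel W \<noteq> 0"
      using emeasure_mono[OF xe(2), of lborel] W(1) by auto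
    obtain r where r: "W \<subseteq> ball (0::'a) r" using W(3) bounded_subset_ballD by blast
    have "emeasure lborel W \<le> emeasure lborel (ball (0::'a) r)" using emeasure_mono[OF r, of lborel] by simp
    then show "emeasure lborel W \<noteq> \<infinity>"
      using emeasure_lborel_ball_finite[of "0::'a" r] by (auto simp: top_unique)
  qed
  have "?V = G ` ?B"
  proof (intro set_eqI iffI)
    fix x assume "x \<in> ?V"
    then show "x \<in> G ` ?B" using G(2)[of x] by (intro image_eqI[of _ _ "L x"]) auto
  qed (auto simp: G(3))
  moreover have "bounded (G ` ?B)" using G(1) by (simp add: bounded_linear_image linear_conv_bounded_linear)
  moreover have "open ?V" using Lc(1) by (simp add: open_vimage)
  moreover have "0 \<in> ?V" using linear_0[OF L(1)] by simp
  ultimately have V: "emeasure lborel ?V \<noteq> 0 \<and> emeasure lborel ?V \<noteq> \<infinity>" by (intro pos) auto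
  have B: "emeasure lborel ?B \<noteq> 0 \<and> emeasure lborel ?B \<noteq> \<infinity>" by (intro pos) auto
  \<comment> \<open>Both sides are a double integral of f (z + L y) over z in the ball; translations in y and in z turn one into the other.\<close>
  have main: "emeasure lborel ?B * (\<integral>\<^sup>+ y. f (L y) \<partial>lborel) = emeasure lborel ?V * (\<integral>\<^sup>+ x. f x \<partial>lborel)"
    if f[measurable]: "f \<in> borel_measurable borel" for f
  proof -
    have "emeasure lborel ?B * (\<integral>\<^sup>+ y. f (L y) \<partial>lborel) = (\<integral>\<^sup>+ z. (\<integral>\<^sup>+ y. f (L y) \<partial>lborel) * indicator ?B z \<partial>lborel)"
      by (subst nn_integral_cmult_indicator) (simp_all add: mult.commute)
    also have "\<dots> = (\<integral>\<^sup>+ z. (\<integral>\<^sup>+ y. f (z + L y) * indicator ?B z \<partial>lborel) \<partial>lborel)"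
    proof (rule nn_integral_cong)
      fix z :: 'a
      have "(\<integral>\<^sup>+ y. f (L y) \<partial>lborel) = (\<integral>\<^sup>+ y. f (L (G z + y)) \<partial>lborel)"
        by (rule nn_integral_shift[symmetric]) measurable
      then show "(\<integral>\<^sup>+ y. f (L y) \<partial>lborel) * indicator ?B z = (\<integral>\<^sup>+ y. f (z + L y) * indicator ?B z \<partial>lborel)"
        by (simp add: linear_add[OF L(1)] G nn_integral_multc)
    qed
    also have "\<dots> = (\<integral>\<^sup>+ y. (\<integral>\<^sup>+ z. f (z + L y) * indicator ?B z \<partial>lborel) \<partial>lborel)"
      by (rule lborel_pair.Fubini') measurable
    also have "\<dots> = (\<integral>\<^sup>+ y. (\<integral>\<^sup>+ z. f z * indicator ?B (z - L y) \<partial>lborel) \<partial>lborel)"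
    proof (rule nn_integral_cong)
      fix y
      have "(\<integral>\<^sup>+ z. f z * indicator ?B (z - L y) \<partial>lborel) = (\<integral>\<^sup>+ z. f (L y + z) * indicator ?B (L y + z - L y) \<partial>lborel)"
        by (rule nn_integral_shift[symmetric]) measurable
      then show "(\<integral>\<^sup>+ z. f (z + L y) * indicator ?B z \<partial>lborel) = (\<integral>\<^sup>+ z. f z * indicator ?B (z - L y) \<partial>lborel)"
        by (simp add: add.commute)
    qed
    also have "\<dots> = (\<integral>\<^sup>+ z. (\<integral>\<^sup>+ y. f z * indicator ?B (z - L y) \<partial>lborel) \<partial>lborel)"
      by (rule lborel_pair.Fubini') measurable
    also have "\<dots> = (\<integral>\<^sup>+ z. f z * emeasure lborel ?V \<partial>lborel)"
    proof (rule nn_integral_cong)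
      fix z
      have "(\<integral>\<^sup>+ y. indicator ?B (z - L y) \<partial>lborel) = (\<integral>\<^sup>+ y. indicator ?B (z - L (G z + y)) \<partial>(lborel :: 'a measure) :: ennreal)"
        by (rule nn_integral_shift[symmetric]) measurable
      also have "\<dots> = (\<integral>\<^sup>+ y. indicator ?V y \<partial>lborel)"
        by (intro nn_integral_cong) (simp add: linear_add[OF L(1)] G indicator_def)
      also have "\<dots> = emeasure lborel ?V" using \<open>open ?V\<close> by simp
      finally show "(\<integral>\<^sup>+ y. f z * indicator ?B (z - L y) \<partial>lborel) = f z * emeasure lborel ?V"
        by (simp add: nn_integral_cmult)
    qed
    also have "\<dots> = emeasure lborel ?V * (\<integral>\<^sup>+ x. f x \<partial>lborel)" by (simp add: nn_integral_multc mult.commute)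
    finally show ?thesis .
  qed
  obtain b v where bv: "emeasure lborel ?B = ennreal b" "emeasure lborel ?V = ennreal v" "0 < b" "0 < v"
  proof (rule that)
    show "emeasure lborel ?B = ennreal (measure lborel ?B)" "emeasure lborel ?V = ennreal (measure lborel ?V)"
      using B V by (auto simp: emeasure_eq_ennreal_measure)
    then show "0 < measure lborel ?B" "0 < measure lborel ?V"
      using B V by (metis ennreal_eq_0_iff not_le)+
  qed
  show ?thesis
  proof (intro exI[of _ "b / v"] conjI allI impI)
    show "0 < b / v" using bv by simp
    fix c and f :: "'a \<Rightarrow> ennreal" assume f[measurable]: "f \<in> borel_measurable borel"
    have "ennreal v * (\<integral>\<^sup>+ x. f x \<partial>lborel) = ennreal b * (\<integral>\<^sup>+ y. f (c + L y) \<partial>lborel)"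
      using main[of "\<lambda>x. f (c + x)"] bv nn_integral_shift[of f c] by simp
    then have "ennreal (1 / v) * (ennreal v * (\<integral>\<^sup>+ x. f x \<partial>lborel)) = ennreal (1 / v) * (ennreal b * (\<integral>\<^sup>+ y. f (c + L y) \<partial>lborel))" by simp
    then show "(\<integral>\<^sup>+ x. f x \<partial>lborel) = ennreal (b / v) * (\<integral>\<^sup>+ y. f (c + L y) \<partial>lborel)"
      using bv by (simp add: mult.assoc[symmetric] ennreal_mult[symmetric])
  qed
qed

lemma integrable_inverse_square_tail: "integrable lborel (\<lambda>y::real. 1 / (1 + \<bar>y\<bar>)\<^sup>2)"
proof -
  have cone_ind: "(\<integral>\<^sup>+ y. ennreal (1 / (1 + y)\<^sup>2) * indicator {0..} y \<partial>lborel) = ennreal 1"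
  proof -
    have "(\<integral>\<^sup>+ y. ennreal (1 / (1 + y)\<^sup>2) * indicator {0..} y \<partial>lborel) = ennreal (0 - (- 1 / (1 + 0)))"
    proof (rule nn_integral_FTC_atLeast[where F="\<lambda>y. - 1 / (1 + y)"])
      fix x :: real assume "0 \<le> x"
      then show "((\<lambda>y. - 1 / (1 + y)) has_real_derivative 1 / (1 + x)\<^sup>2) (at x)"
        by (auto intro!: derivative_eq_intros simp: power2_eq_square)
      show "0 \<le> 1 / (1 + x)\<^sup>2" by simp
    next
      show "((\<lambda>y::real. - 1 / (1 + y)) \<longlongrightarrow> 0) at_top" by real_asymp
    qed measurable
    then show ?thesis by simp
  qed
  have "(\<integral>\<^sup>+ y. ennreal (1 / (1 + \<bar>y\<bar>)\<^sup>2) \<partial>lborel)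
     \<le> (\<integral>\<^sup>+ y. ennreal (1 / (1 + y)\<^sup>2) * indicator {0..} y + ennreal (1 / (1 + - y)\<^sup>2) * indicator {0..} (- y) \<partial>lborel)"
    by (intro nn_integral_mono) (auto split: split_indicator)
  also have "\<dots> = (\<integral>\<^sup>+ y. ennreal (1 / (1 + y)\<^sup>2) * indicator {0..} y \<partial>lborel)
       + (\<integral>\<^sup>+ y. ennreal (1 / (1 + - y)\<^sup>2) * indicator {0..} (- y) \<partial>lborel)"
    by (rule nn_integral_add) auto
  also have "(\<integral>\<^sup>+ y. ennreal (1 / (1 + - y)\<^sup>2) * indicator {0..} (- y) \<partial>lborel)
      = (\<integral>\<^sup>+ y. ennreal (1 / (1 + y)\<^sup>2) * indicator {0..} y \<partial>lborel)"
    by (subst nn_integral_real_affine[of _ "-1" 0]) auto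
  also have "(\<integral>\<^sup>+ y. ennreal (1 / (1 + y)\<^sup>2) * indicator {0..} y \<partial>lborel) + \<dots> < \<infinity>" unfolding cone_ind by simp
  finally show ?thesis by (intro integrableI_bounded) auto
qed

lemma lborel_vec_eq_distr_PiM:
  "distr (\<Pi>\<^sub>M i\<in>UNIV. lborel) borel (\<lambda>f. \<chi> i. f i) = (lborel :: (real ^ 'k::finite) measure)"
proof (rule lborel_eqI[symmetric])
  interpret product_sigma_finite "\<lambda>_::'k. lborel :: real measure" ..
  have meas[measurable]: "(\<lambda>f. \<chi> i. f i) \<in> (\<Pi>\<^sub>M i\<in>(UNIV::'k set). lborel) \<rightarrow>\<^sub>M (borel :: (real ^ 'k) measure)"
    by (rule borel_measurable_euclidean_space[THEN iffD2]) (auto simp: Basis_vec_def inner_axis)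
  fix l u :: "real ^ 'k" assume lu: "\<And>b. b \<in> Basis \<Longrightarrow> l \<bullet> b \<le> u \<bullet> b"
  have le: "l $ i \<le> u $ i" for i using lu[of "axis i 1"] by (simp add: inner_axis axis_in_Basis_iff)
  have "(\<lambda>f. \<chi> i. f i) -` box l u \<inter> space (\<Pi>\<^sub>M i\<in>(UNIV::'k set). lborel) = Pi\<^sub>E UNIV (\<lambda>i. {l $ i<..<u $ i})"
    by (auto simp: mem_box_cart space_PiM PiE_iff)
  then have "emeasure (distr (\<Pi>\<^sub>M i\<in>UNIV. lborel) borel (\<lambda>f. \<chi> i. f i)) (box l u) = (\<Prod>i\<in>UNIV. ennreal (u $ i - l $ i))"
    using le by (subst emeasure_distr) (auto simp: emeasure_PiM)
  also have "\<dots> = ennreal (\<Prod>i\<in>UNIV. (u - l) $ i)" using le by (subst prod_ennreal) auto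
  also have "(\<Prod>i\<in>UNIV. (u - l) $ i) = (\<Prod>b\<in>Basis. (u - l) \<bullet> b)"
  proof -
    have "Basis = (\<lambda>i. axis i (1::real) :: real ^ 'k) ` UNIV" by (auto simp: Basis_vec_def)
    then have "(\<Prod>b\<in>Basis. (u - l) \<bullet> b) = (\<Prod>b\<in>(\<lambda>i. axis i 1) ` UNIV. (u - l) \<bullet> b)" by (simp only:)
    also have "\<dots> = (\<Prod>i\<in>UNIV. (u - l) $ i)"
      by (subst prod.reindex) (auto simp: inj_on_def axis_eq_axis inner_axis)
    finally show ?thesis ..
  qed
  finally show "emeasure (distr (\<Pi>\<^sub>M i\<in>UNIV. lborel) borel (\<lambda>f. \<chi> i. f i)) (box l u) = ennreal (\<Prod>b\<in>Basis. (u - l) \<bullet> b)" .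
qed simp

lemma vec_lambda_measurable[measurable]:
  "(\<lambda>f. \<chi> i. f i) \<in> (\<Pi>\<^sub>M i\<in>(UNIV::'k::finite set). lborel) \<rightarrow>\<^sub>M (borel :: (real ^ 'k) measure)"
  by (rule borel_measurable_euclidean_space[THEN iffD2]) (auto simp: Basis_vec_def inner_axis)

lemma nn_integral_lborel_vec:
  fixes f :: "real ^ 'k::finite \<Rightarrow> ennreal"
  assumes [measurable]: "f \<in> borel_measurable borel"
  shows "(\<integral>\<^sup>+ y. f y \<partial>lborel) = (\<integral>\<^sup>+ y. f (\<chi> i. y i) \<partial>(\<Pi>\<^sub>M i\<in>UNIV. lborel))"
  by (subst lborel_vec_eq_distr_PiM[symmetric], subst nn_integral_distr) auto

text \<open>
  The integrable majorant for all limit passages.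
\<close>

lemma integrable_prod_inverse_square:
  "integrable lborel (\<lambda>y::real^'k::finite. \<Prod>i\<in>UNIV. 1 / (1 + \<bar>y $ i\<bar>)\<^sup>2)"
proof -
  interpret product_sigma_finite "\<lambda>_::'k. lborel :: real measure" ..
  have "integrable (\<Pi>\<^sub>M i\<in>(UNIV::'k set). lborel) (\<lambda>y::'k \<Rightarrow> real. \<Prod>i\<in>UNIV. 1 / (1 + \<bar>y i\<bar>)\<^sup>2)"
    by (rule product_integrable_prod[where f="\<lambda>_ y. 1 / (1 + \<bar>y\<bar>)\<^sup>2"]) (auto intro: integrable_inverse_square_tail)
  then show ?thesis
    by (subst lborel_vec_eq_distr_PiM[symmetric], subst integrable_distr_eq) (auto simp del: prod_dividef)
qed

lemma PiM_density:
  fixes f :: "'i \<Rightarrow> 'a \<Rightarrow> ennreal"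
  assumes I: "finite I" and N: "\<And>i. sigma_finite_measure (N i)" and f: "\<And>i. f i \<in> borel_measurable (N i)"
    and sf: "\<And>i. sigma_finite_measure (density (N i) (f i))"
  shows "(\<Pi>\<^sub>M i\<in>I. density (N i) (f i)) = density (Pi\<^sub>M I N) (\<lambda>x. \<Prod>i\<in>I. f i (x i))"
proof -
  interpret D: product_sigma_finite "\<lambda>i. density (N i) (f i)" using sf by (simp add: product_sigma_finite_def)
  interpret L: product_sigma_finite N using N by (simp add: product_sigma_finite_def)
  note f[measurable]
  show ?thesis
  proof (rule D.PiM_eqI[OF I, symmetric])
    show "sets (density (Pi\<^sub>M I N) (\<lambda>x. \<Prod>i\<in>I. f i (x i))) = sets (\<Pi>\<^sub>M i\<in>I. density (N i) (f i))"
      by (simp cong: sets_PiM_cong)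
    fix A assume A: "\<And>i. i \<in> I \<Longrightarrow> A i \<in> sets (density (N i) (f i))"
    then have A'[measurable]: "i \<in> I \<Longrightarrow> A i \<in> sets (N i)" for i by simp
    have "emeasure (density (Pi\<^sub>M I N) (\<lambda>x. \<Prod>i\<in>I. f i (x i))) (Pi\<^sub>E I A)
       = (\<integral>\<^sup>+ x. (\<Prod>i\<in>I. f i (x i)) * indicator (Pi\<^sub>E I A) x \<partial>Pi\<^sub>M I N)"
      using I by (intro emeasure_density) (auto intro!: sets_PiM_I_finite)
    also have "\<dots> = (\<integral>\<^sup>+ x. (\<Prod>i\<in>I. f i (x i) * indicator (A i) (x i)) \<partial>Pi\<^sub>M I N)"
    proof (rule nn_integral_cong)
      fix x assume "x \<in> space (Pi\<^sub>M I N)"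
      then have "indicator (Pi\<^sub>E I A) x = (\<Prod>i\<in>I. indicator (A i) (x i) :: ennreal)"
        using I by (auto simp: space_PiM PiE_iff indicator_def prod_zero_iff split: if_splits)
      then show "(\<Prod>i\<in>I. f i (x i)) * indicator (Pi\<^sub>E I A) x = (\<Prod>i\<in>I. f i (x i) * indicator (A i) (x i))"
        by (simp add: prod.distrib)
    qed
    also have "\<dots> = (\<Prod>i\<in>I. (\<integral>\<^sup>+ x. f i x * indicator (A i) x \<partial>N i))"
      using I by (intro L.product_nn_integral_prod) auto
    also have "\<dots> = (\<Prod>i\<in>I. emeasure (density (N i) (f i)) (A i))"
      by (intro prod.cong refl emeasure_density[symmetric]) auto
    finally show "emeasure (density (Pi\<^sub>M I N) (\<lambda>x. \<Prod>i\<in>I. f i (x i))) (Pi\<^sub>E I A)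
      = (\<Prod>i\<in>I. emeasure (density (N i) (f i)) (A i))" .
  qed
qed

text \<open>
  On a finite index set the Borel sets of the product topology are those of the product sigma-algebra.
\<close>

lemma borel_measurable_fun_coord[measurable]: "(\<lambda>\<omega>::'k \<Rightarrow> ereal. \<omega> i) \<in> borel_measurable borel"
  by (intro borel_measurable_continuous_onI continuous_on_product_coordinates)

lemma borel_measurable_fun_eq_PiM: "borel_measurable M = M \<rightarrow>\<^sub>M (\<Pi>\<^sub>M i\<in>(UNIV :: 'k::finite set). (borel :: ereal measure))"
  by (intro measurable_cong_sets refl sets_PiM_equal_borel[symmetric])

lemma borel_measurable_funI:
  fixes f :: "'a \<Rightarrow> 'k::finite \<Rightarrow> ereal"
  assumes "\<And>i. (\<lambda>x. f x i) \<in> borel_measurable M"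
  shows "f \<in> borel_measurable M"
  unfolding borel_measurable_fun_eq_PiM using assms by (intro measurable_PiM_single') auto

lemma AE_PiM_component_lborel:
  assumes i: "i \<in> I" and I: "finite I"
  shows "AE x in (\<Pi>\<^sub>M i\<in>I. (lborel :: real measure)). x i \<noteq> c"
proof -
  interpret product_sigma_finite "\<lambda>_. lborel :: real measure" ..
  let ?A = "\<lambda>j. if j = i then {c} else (UNIV :: real set)"
  have "emeasure (\<Pi>\<^sub>M i\<in>I. lborel) (Pi\<^sub>E I ?A) = (\<Prod>j\<in>I. emeasure (lborel :: real measure) (?A j))"
    using I by (intro emeasure_PiM) auto
  also have "\<dots> = 0" using i I by (intro prod_zero) auto
  finally have 0: "emeasure (\<Pi>\<^sub>M i\<in>I. (lborel :: real measure)) (Pi\<^sub>E I ?A) = 0" .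
  show ?thesis
  proof (rule AE_I[OF _ 0])
    show "{x \<in> space (\<Pi>\<^sub>M i\<in>I. (lborel :: real measure)). \<not> x i \<noteq> c} \<subseteq> Pi\<^sub>E I ?A"
      by (auto simp: space_PiM PiE_iff extensional_def)
    show "Pi\<^sub>E I ?A \<in> sets (\<Pi>\<^sub>M i\<in>I. (lborel :: real measure))" using I by (intro sets_PiM_I_finite) auto
  qed
qed

lemma one_plus_square_bound:
  fixes c z :: real
  assumes "0 < c"
  shows "min 1 c / 2 * (1 + \<bar>z\<bar>)\<^sup>2 \<le> 1 + c * z\<^sup>2"
proof -
  have "(1 + \<bar>z\<bar>)\<^sup>2 \<le> 2 * (1 + z\<^sup>2)"
    using zero_le_power2[of "1 - \<bar>z\<bar>"] by (simp add: power2_eq_square algebra_simps)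
  then have "min 1 c / 2 * (1 + \<bar>z\<bar>)\<^sup>2 \<le> min 1 c / 2 * (2 * (1 + z\<^sup>2))" using assms by (intro mult_left_mono) auto
  also have "\<dots> = min 1 c + min 1 c * z\<^sup>2" by (simp add: algebra_simps)
  also have "\<dots> \<le> 1 + c * z\<^sup>2" by (intro add_mono mult_right_mono) auto
  finally show ?thesis .
qed

section \<open>The limit law\<close>

text \<open>
  \<open>I\<close> carries the exponential coordinates, \<open>T\<close> the indices outside \<open>I\<close> at which the threshold is attained,
  and \<open>D\<close> the inverse of the covariance matrix of the Gaussian part. Coordinates outside \<open>I\<close> and \<open>T\<close> are infinite.
\<close>

locale limit_law =
  fixes I T :: "'k::finite set" and rate :: "'k \<Rightarrow> real" and D :: "real ^ 'k ^ 'k" and c :: real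
  assumes I_ne: "I \<noteq> {}" and T: "T \<subseteq> - I" and rate: "\<And>i. i \<in> I \<Longrightarrow> 0 < rate i" and c: "0 < c"
    and D: "\<And>z. c * (\<Sum>i\<in>-I. (z i)\<^sup>2) \<le> (\<Sum>i\<in>-I. \<Sum>j\<in>-I. z i * D $ i $ j * z j)"
begin

definition gauss_weight :: "('k \<Rightarrow> real) \<Rightarrow> real" where
  "gauss_weight z = exp (- (\<Sum>i\<in>-I. \<Sum>j\<in>-I. z i * D $ i $ j * z j) / 2)"

abbreviation lebJ :: "('k \<Rightarrow> real) measure" where "lebJ \<equiv> \<Pi>\<^sub>M j\<in>-I. lborel"
abbreviation lebI :: "('k \<Rightarrow> real) measure" where "lebI \<equiv> \<Pi>\<^sub>M i\<in>I. lborel"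

text \<open>
  Only tied coordinates are restricted, so this is the event in the numerator and in the denominator
  of the claimed survivor function.
\<close>

definition tied_orthant :: "('k \<Rightarrow> real) \<Rightarrow> ('k \<Rightarrow> real) set" where
  "tied_orthant \<theta> = {z \<in> space lebJ. \<forall>j\<in>T. \<theta> j < z j}"

lemma gauss_weight_measurable[measurable]: "gauss_weight \<in> borel_measurable lebJ"
  unfolding gauss_weight_def by measurable

lemma tied_orthant_measurable[measurable]: "tied_orthant \<theta> \<in> sets lebJ"
  unfolding tied_orthant_def by measurable (use T in auto)

lemma integrable_gauss_weight: "integrable lebJ gauss_weight"
proof -
  interpret product_sigma_finite "\<lambda>_::'k. lborel :: real measure" ..
  define C where "C = 1 / (min 1 (c / 2) / 2)"
  have "integrable lebJ (\<lambda>z. \<Prod>i\<in>-I. C * (1 / (1 + \<bar>z i\<bar>)\<^sup>2))"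
    by (intro product_integrable_prod integrable_mult_right integrable_inverse_square_tail) auto
  then show ?thesis
  proof (rule Bochner_Integration.integrable_bound)
    show "AE z in lebJ. norm (gauss_weight z) \<le> norm (\<Prod>i\<in>-I. C * (1 / (1 + \<bar>z i\<bar>)\<^sup>2))"
    proof (rule AE_I2)
      fix z :: "'k \<Rightarrow> real"
      have "gauss_weight z \<le> exp (- (\<Sum>i\<in>-I. c / 2 * (z i)\<^sup>2))"
      proof -
        have "(\<Sum>i\<in>-I. c / 2 * (z i)\<^sup>2) = c * (\<Sum>i\<in>-I. (z i)\<^sup>2) / 2"
          by (simp add: sum_distrib_left sum_divide_distrib)
        then show ?thesis unfolding gauss_weight_def using D[of z] by simp
      qed
      also have "\<dots> = (\<Prod>i\<in>-I. exp (- (c / 2 * (z i)\<^sup>2)))" by (simp add: sum_negf[symmetric] exp_sum)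
      also have "\<dots> \<le> (\<Prod>i\<in>-I. C * (1 / (1 + \<bar>z i\<bar>)\<^sup>2))"
      proof (intro prod_mono conjI)
        fix i
        have "min 1 (c / 2) / 2 * (1 + \<bar>z i\<bar>)\<^sup>2 \<le> 1 + c / 2 * (z i)\<^sup>2" using c by (intro one_plus_square_bound) auto
        also have "\<dots> \<le> exp (c / 2 * (z i)\<^sup>2)" by (rule exp_ge_add_one_self)
        finally have le: "min 1 (c / 2) / 2 * (1 + \<bar>z i\<bar>)\<^sup>2 \<le> exp (c / 2 * (z i)\<^sup>2)" .
        have "1 / exp (c / 2 * (z i)\<^sup>2) \<le> 1 / (min 1 (c / 2) / 2 * (1 + \<bar>z i\<bar>)\<^sup>2)"
          by (rule frac_le[OF zero_le_one order_refl _ le]) (use c in \<open>auto intro!: mult_pos_pos zero_less_power\<close>)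
        then show "exp (- (c / 2 * (z i)\<^sup>2)) \<le> C * (1 / (1 + \<bar>z i\<bar>)\<^sup>2)"
          unfolding C_def by (simp add: exp_minus inverse_eq_divide)
      qed auto
      finally show "norm (gauss_weight z) \<le> norm (\<Prod>i\<in>-I. C * (1 / (1 + \<bar>z i\<bar>)\<^sup>2))"
        by (simp add: gauss_weight_def)
    qed
  qed measurable
qed

definition gauss_mass :: "('k \<Rightarrow> real) \<Rightarrow> real" where
  "gauss_mass \<theta> = (\<integral>z. gauss_weight z * indicator (tied_orthant \<theta>) z \<partial>lebJ)"

lemma gauss_weight_pos: "0 < gauss_weight z" by (simp add: gauss_weight_def)

lemma gauss_mass_nn: "(\<integral>\<^sup>+ z. ennreal (gauss_weight z) * indicator (tied_orthant \<theta>) z \<partial>lebJ) = ennreal (gauss_mass \<theta>)"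
proof -
  have "integrable lebJ (\<lambda>z. gauss_weight z * indicator (tied_orthant \<theta>) z)"
    by (rule integrable_real_mult_indicator[OF tied_orthant_measurable integrable_gauss_weight])
  then have "(\<integral>\<^sup>+ z. ennreal (gauss_weight z * indicator (tied_orthant \<theta>) z) \<partial>lebJ) = ennreal (gauss_mass \<theta>)"
    unfolding gauss_mass_def using gauss_weight_pos by (intro nn_integral_eq_integral) (auto simp: less_imp_le)
  moreover have "ennreal (gauss_weight z * indicator (tied_orthant \<theta>) z) = ennreal (gauss_weight z) * indicator (tied_orthant \<theta>) z" for z
    by (simp split: split_indicator)
  ultimately show ?thesis by simp
qed

lemma gauss_mass_pos: "0 < gauss_mass (\<lambda>_. 0)"
proof -
  interpret product_sigma_finite "\<lambda>_::'k. lborel :: real measure" ..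
  let ?Q = "Pi\<^sub>E (-I) (\<lambda>_. {0<..<1::real})"
  have "(\<integral>\<^sup>+ z. ennreal (gauss_weight z) * indicator (tied_orthant (\<lambda>_. 0)) z \<partial>lebJ) \<noteq> 0"
  proof
    assume "(\<integral>\<^sup>+ z. ennreal (gauss_weight z) * indicator (tied_orthant (\<lambda>_. 0)) z \<partial>lebJ) = 0"
    then have "AE z in lebJ. ennreal (gauss_weight z) * indicator (tied_orthant (\<lambda>_. 0)) z = 0"
      by (subst (asm) nn_integral_0_iff_AE) auto
    then have "AE z in lebJ. z \<notin> tied_orthant (\<lambda>_. 0)"
    proof (rule AE_mp, intro AE_I2 impI notI)
      fix z assume "ennreal (gauss_weight z) * indicator (tied_orthant (\<lambda>_. 0)) z = 0" "z \<in> tied_orthant (\<lambda>_. 0)"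
      then show False using gauss_weight_pos[of z] by (simp add: ennreal_eq_0_iff)
    qed
    then have "AE z in lebJ. z \<notin> ?Q"
    proof (rule AE_mp, intro AE_I2 impI)
      fix z assume "z \<in> space lebJ" "z \<notin> tied_orthant (\<lambda>_. 0)"
      then show "z \<notin> ?Q" using T by (auto simp: tied_orthant_def PiE_iff)
    qed
    then have "emeasure lebJ ?Q = 0"
      by (subst (asm) AE_iff_measurable[of ?Q]) (auto simp: space_PiM PiE_iff extensional_def intro!: sets_PiM_I_finite)
    then show False by (simp add: emeasure_PiM)
  qed
  then show ?thesis unfolding gauss_mass_nn by (metis ennreal_eq_0_iff not_le)
qed

text \<open>
  The rate 1 outside \<open>I\<close> is a default that makes every member of the family a probability measure.
\<close>

definition exp_law :: "('k \<Rightarrow> real) measure" where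
  "exp_law = (\<Pi>\<^sub>M i\<in>I. density lborel (exponential_density (if i \<in> I then rate i else 1)))"

text \<open>
  The Gaussian part, conditioned on positive tied coordinates.
\<close>

definition gauss_law :: "('k \<Rightarrow> real) measure" where
  "gauss_law = density lebJ (\<lambda>z. ennreal (gauss_weight z) * indicator (tied_orthant (\<lambda>_. 0)) z / ennreal (gauss_mass (\<lambda>_. 0)))"

definition limit_point :: "('k \<Rightarrow> real) \<times> ('k \<Rightarrow> real) \<Rightarrow> 'k \<Rightarrow> ereal" where
  "limit_point p = (\<lambda>i. if i \<in> I then ereal (fst p i) else if i \<in> T then ereal (snd p i) else \<infinity>)"

definition MW :: "('k \<Rightarrow> ereal) measure" where
  "MW = distr (exp_law \<Otimes>\<^sub>M gauss_law) borel limit_point"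

lemma exp_prob: "prob_space (density lborel (exponential_density (if i \<in> I then rate i else 1)))"
  using rate by (intro prob_space_exponential_density) auto

lemma sets_exp_law[measurable_cong]: "sets exp_law = sets lebI" unfolding exp_law_def by (intro sets_PiM_cong) auto
lemma sets_gauss_law[measurable_cong]: "sets gauss_law = sets lebJ" unfolding gauss_law_def by simp

lemma prob_exp_law: "prob_space exp_law"
  unfolding exp_law_def by (intro prob_space_PiM exp_prob)

lemma gauss_law_emeasure: "emeasure gauss_law (tied_orthant \<theta>) = ennreal (gauss_mass (\<lambda>j. max 0 (\<theta> j)) / gauss_mass (\<lambda>_. 0))"
proof -
  have "emeasure gauss_law (tied_orthant \<theta>) = (\<integral>\<^sup>+ z. ennreal (gauss_weight z) * indicator (tied_orthant (\<lambda>_. 0)) z / ennreal (gauss_mass (\<lambda>_. 0)) * indicator (tied_orthant \<theta>) z \<partial>lebJ)"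
    unfolding gauss_law_def by (intro emeasure_density) auto
  also have "\<dots> = (\<integral>\<^sup>+ z. (ennreal (gauss_weight z) * indicator (tied_orthant (\<lambda>j. max 0 (\<theta> j))) z) / ennreal (gauss_mass (\<lambda>_. 0)) \<partial>lebJ)"
    by (intro nn_integral_cong) (auto simp: tied_orthant_def split: split_indicator)
  also have "\<dots> = ennreal (gauss_mass (\<lambda>j. max 0 (\<theta> j))) / ennreal (gauss_mass (\<lambda>_. 0))"
    by (subst nn_integral_divide) (auto simp: gauss_mass_nn)
  also have "\<dots> = ennreal (gauss_mass (\<lambda>j. max 0 (\<theta> j)) / gauss_mass (\<lambda>_. 0))"
    using gauss_mass_pos by (intro divide_ennreal) (auto simp: gauss_mass_def gauss_weight_pos less_imp_le intro!: integral_nonneg_AE)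
  finally show ?thesis .
qed

lemma prob_gauss_law: "prob_space gauss_law"
proof
  have "emeasure gauss_law (space gauss_law) = (\<integral>\<^sup>+ z. ennreal (gauss_weight z) * indicator (tied_orthant (\<lambda>_. 0)) z / ennreal (gauss_mass (\<lambda>_. 0)) * indicator (space lebJ) z \<partial>lebJ)"
    unfolding gauss_law_def by (subst emeasure_density) auto
  also have "\<dots> = (\<integral>\<^sup>+ z. (ennreal (gauss_weight z) * indicator (tied_orthant (\<lambda>_. 0)) z) / ennreal (gauss_mass (\<lambda>_. 0)) \<partial>lebJ)"
    by (intro nn_integral_cong) auto
  also have "\<dots> = ennreal (gauss_mass (\<lambda>_. 0)) / ennreal (gauss_mass (\<lambda>_. 0))"
    by (subst nn_integral_divide) (auto simp: gauss_mass_nn)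
  also have "\<dots> = 1" using gauss_mass_pos by (simp add: divide_ennreal)
  finally show "emeasure gauss_law (space gauss_law) = 1" .
qed

lemma exp_law_coord_measurable: "i \<in> I \<Longrightarrow> (\<lambda>x. x i) \<in> borel_measurable exp_law"
  by measurable

lemma gauss_law_coord_measurable: "i \<in> - I \<Longrightarrow> (\<lambda>x. x i) \<in> borel_measurable gauss_law"
  by measurable

lemma limit_point_measurable[measurable]: "limit_point \<in> borel_measurable (exp_law \<Otimes>\<^sub>M gauss_law)"
proof (rule borel_measurable_funI)
  fix i
  have "(\<lambda>p. ereal (fst p i)) \<in> borel_measurable (exp_law \<Otimes>\<^sub>M gauss_law)" if "i \<in> I"
    by (intro borel_measurable_ereal measurable_compose[OF measurable_fst exp_law_coord_measurable] that)
  moreover have "(\<lambda>p. ereal (snd p i)) \<in> borel_measurable (exp_law \<Otimes>\<^sub>M gauss_law)" if "i \<in> T"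
    using that T by (intro borel_measurable_ereal measurable_compose[OF measurable_snd gauss_law_coord_measurable]) auto
  ultimately show "(\<lambda>p. limit_point p i) \<in> borel_measurable (exp_law \<Otimes>\<^sub>M gauss_law)"
    unfolding limit_point_def by (cases "i \<in> I"; cases "i \<in> T") simp_all
qed

lemma limit_point_section: "(\<lambda>z. limit_point (x, z)) \<in> borel_measurable lebJ"
proof (rule borel_measurable_funI)
  fix i
  have "(\<lambda>z. ereal (z i)) \<in> borel_measurable lebJ" if "i \<in> T"
    using that T by (intro borel_measurable_ereal) auto
  then show "(\<lambda>z. limit_point (x, z) i) \<in> borel_measurable lebJ"
    unfolding limit_point_def by (cases "i \<in> I"; cases "i \<in> T") simp_all
qed

lemma restrict_measurable[measurable]:
  "(\<lambda>\<omega>. restrict \<omega> K) \<in> (borel :: ('k \<Rightarrow> ereal) measure) \<rightarrow>\<^sub>M (\<Pi>\<^sub>M i\<in>K. borel)"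
  by (rule measurable_restrict) measurable

lemma exp_law_restrict_measurable[measurable]:
  "(\<lambda>x. \<lambda>i\<in>I. ereal (x i)) \<in> exp_law \<rightarrow>\<^sub>M (\<Pi>\<^sub>M i\<in>I. borel)"
  by (intro measurable_restrict borel_measurable_ereal exp_law_coord_measurable)

sublocale exp_law: prob_space exp_law by (rule prob_exp_law)
sublocale gauss_law: prob_space gauss_law by (rule prob_gauss_law)
sublocale P: pair_prob_space exp_law gauss_law ..

lemma prob_MW: "prob_space MW"
  unfolding MW_def by (rule P.prob_space_distr) measurable

lemma sets_MW[measurable_cong]: "sets MW = sets borel" unfolding MW_def by simp

sublocale MW: prob_space MW by (rule prob_MW)

lemma distr_pair_fst: "distr (exp_law \<Otimes>\<^sub>M gauss_law) exp_law fst = exp_law"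
  by (rule gauss_law.distr_pair_fst)

lemma distr_pair_snd: "distr (exp_law \<Otimes>\<^sub>M gauss_law) gauss_law snd = gauss_law"
proof (rule measure_eqI)
  fix A assume "A \<in> sets (distr (exp_law \<Otimes>\<^sub>M gauss_law) gauss_law snd)"
  then have A: "A \<in> sets gauss_law" by simp
  then have "snd -` A \<inter> space (exp_law \<Otimes>\<^sub>M gauss_law) = space exp_law \<times> A"
    using sets.sets_into_space[OF A] by (auto simp: space_pair_measure)
  with A show "emeasure (distr (exp_law \<Otimes>\<^sub>M gauss_law) gauss_law snd) A = emeasure gauss_law A"
    by (simp add: emeasure_distr gauss_law.emeasure_pair_measure_Times exp_law.emeasure_space_1)
qed simp

lemma distr_MW_I:
  assumes [measurable]: "f \<in> borel \<rightarrow>\<^sub>M N" and g[measurable]: "g \<in> exp_law \<rightarrow>\<^sub>M N" and eq: "\<And>p. f (limit_point p) = g (fst p)"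
  shows "distr MW N f = distr exp_law N g"
proof -
  have "distr MW N f = distr (exp_law \<Otimes>\<^sub>M gauss_law) N (g \<circ> fst)"
    unfolding MW_def by (subst distr_distr) (auto simp: o_def eq)
  also have "\<dots> = distr (distr (exp_law \<Otimes>\<^sub>M gauss_law) exp_law fst) N g" by (rule distr_distr[symmetric]) measurable
  finally show ?thesis by (simp add: distr_pair_fst)
qed

lemma distr_MW_J:
  assumes [measurable]: "f \<in> borel \<rightarrow>\<^sub>M N" and g[measurable]: "g \<in> gauss_law \<rightarrow>\<^sub>M N" and eq: "\<And>p. f (limit_point p) = g (snd p)"
  shows "distr MW N f = distr gauss_law N g"
proof -
  have "distr MW N f = distr (exp_law \<Otimes>\<^sub>M gauss_law) N (g \<circ> snd)"
    unfolding MW_def by (subst distr_distr) (auto simp: o_def eq)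
  also have "\<dots> = distr (distr (exp_law \<Otimes>\<^sub>M gauss_law) gauss_law snd) N g" by (rule distr_distr[symmetric]) measurable
  finally show ?thesis by (simp add: distr_pair_snd)
qed

lemma distr_MW_coord:
  assumes i: "i \<in> I"
  shows "distr MW borel (\<lambda>\<omega>. \<omega> i) = distr (density lborel (exponential_density (rate i))) borel ereal"
proof -
  have "distr MW borel (\<lambda>\<omega>. \<omega> i) = distr exp_law borel (\<lambda>x. ereal (x i))"
    using i by (intro distr_MW_I) (auto simp: limit_point_def intro!: borel_measurable_ereal exp_law_coord_measurable)
  also have "\<dots> = distr (distr exp_law (density lborel (exponential_density (if i \<in> I then rate i else 1))) (\<lambda>x. x i)) borel ereal"
    using i by (subst distr_distr) (auto simp: o_def exp_law_def)
  also have "distr exp_law (density lborel (exponential_density (if i \<in> I then rate i else 1))) (\<lambda>x. x i)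
    = density lborel (exponential_density (if i \<in> I then rate i else 1))"
    unfolding exp_law_def by (rule distr_PiM_component[OF exp_prob i])
  finally show ?thesis using i by simp
qed

lemma MW_indep_I: "MW.indep_vars (\<lambda>_. borel) (\<lambda>i \<omega>. \<omega> i) I"
proof (subst MW.indep_vars_iff_distr_eq_PiM[OF I_ne])
  show "(\<lambda>\<omega>. \<omega> i) \<in> MW \<rightarrow>\<^sub>M borel" for i by measurable
  let ?E = "\<lambda>i. density lborel (exponential_density (if i \<in> I then rate i else 1))"
  interpret E: product_prob_space ?E I
    using exp_prob by (simp add: product_prob_space_def product_prob_space_axioms_def product_sigma_finite_def prob_space_imp_sigma_finite)
  have pc: "prob_space (distr MW borel (\<lambda>\<omega>. \<omega> i))" for i by (rule MW.prob_space_distr) measurable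
  interpret Q: product_sigma_finite "\<lambda>i. distr MW borel (\<lambda>\<omega>. \<omega> i)"
    using pc by (simp add: product_sigma_finite_def prob_space_imp_sigma_finite)
  have "distr MW (\<Pi>\<^sub>M i\<in>I. borel) (\<lambda>x. \<lambda>i\<in>I. x i) = distr exp_law (\<Pi>\<^sub>M i\<in>I. borel) (\<lambda>x. \<lambda>i\<in>I. ereal (x i))"
    by (rule distr_MW_I) (measurable, auto simp: limit_point_def fun_eq_iff)
  also have "\<dots> = (\<Pi>\<^sub>M i\<in>I. distr MW borel (\<lambda>\<omega>. \<omega> i))"
  proof (rule Q.PiM_eqI)
    show "sets (distr exp_law (Pi\<^sub>M I (\<lambda>i. borel)) (\<lambda>x. \<lambda>i\<in>I. ereal (x i))) = sets (\<Pi>\<^sub>M i\<in>I. distr MW borel (\<lambda>\<omega>. \<omega> i))"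
      by (simp cong: sets_PiM_cong)
    fix A assume "\<And>i. i \<in> I \<Longrightarrow> A i \<in> sets (distr MW borel (\<lambda>\<omega>. \<omega> i))"
    then have A[measurable]: "i \<in> I \<Longrightarrow> A i \<in> sets borel" for i by simp
    have "(\<lambda>x. \<lambda>i\<in>I. ereal (x i)) -` Pi\<^sub>E I A \<inter> space exp_law = Pi\<^sub>E I (\<lambda>i. ereal -` A i)"
      by (auto simp: exp_law_def space_PiM PiE_iff)
    then have "emeasure (distr exp_law (Pi\<^sub>M I (\<lambda>i. borel)) (\<lambda>x. \<lambda>i\<in>I. ereal (x i))) (Pi\<^sub>E I A)
       = emeasure exp_law (Pi\<^sub>E I (\<lambda>i. ereal -` A i))"
      by (subst emeasure_distr) (auto intro!: sets_PiM_I_finite)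
    also have "\<dots> = (\<Prod>i\<in>I. emeasure (?E i) (ereal -` A i))"
      unfolding exp_law_def by (rule E.emeasure_PiM) (auto intro!: measurable_sets_borel[of _ borel])
    also have "\<dots> = (\<Prod>i\<in>I. emeasure (distr MW borel (\<lambda>\<omega>. \<omega> i)) (A i))"
      by (intro prod.cong refl) (auto simp: distr_MW_coord emeasure_distr)
    finally show "emeasure (distr exp_law (Pi\<^sub>M I (\<lambda>i. borel)) (\<lambda>x. \<lambda>i\<in>I. ereal (x i))) (Pi\<^sub>E I A)
      = (\<Prod>i\<in>I. emeasure (distr MW borel (\<lambda>\<omega>. \<omega> i)) (A i))" .
  qed simp
  finally show "distr MW (Pi\<^sub>M I (\<lambda>i. borel)) (\<lambda>x. \<lambda>i\<in>I. x i) = (\<Pi>\<^sub>M i\<in>I. distr MW borel (\<lambda>\<omega>. \<omega> i))" .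
qed

lemma MW_survivor_I:
  assumes i: "i \<in> I" and s: "0 < s"
  shows "measure MW {\<omega> \<in> space MW. ereal s < \<omega> i} = exp (- s * rate i)"
proof -
  let ?E = "density lborel (exponential_density (rate i))"
  interpret E: prob_space ?E using exp_prob[of i] i by simp
  have "measure MW {\<omega> \<in> space MW. ereal s < \<omega> i} = measure (distr MW borel (\<lambda>\<omega>. \<omega> i)) {ereal s<..}"
    by (subst measure_distr) (auto intro!: arg_cong[where f="measure MW"])
  also have "\<dots> = measure ?E {x. s < x}"
    unfolding distr_MW_coord[OF i] by (subst measure_distr) (auto intro!: arg_cong[where f="measure _"])
  also have "\<dots> = \<P>(x in ?E. s < x)" by simp
  also have "\<dots> = exp (- s * rate i)"
    by (rule E.exponential_distributedD_gt) (use rate[OF i] s in \<open>auto simp: distributed_def distr_id2\<close>)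
  finally show ?thesis .
qed

lemma MW_indep_IJ:
  "MW.indep_var (\<Pi>\<^sub>M i\<in>I. borel) (\<lambda>\<omega>. restrict \<omega> I) (\<Pi>\<^sub>M j\<in>-I. borel) (\<lambda>\<omega>. restrict \<omega> (-I))"
proof -
  let ?a = "\<lambda>x. \<lambda>i\<in>I. ereal (x i)" and ?b = "\<lambda>z. \<lambda>j\<in>-I. if j \<in> T then ereal (z j) else \<infinity>"
  have [measurable]: "?b \<in> gauss_law \<rightarrow>\<^sub>M (\<Pi>\<^sub>M j\<in>-I. borel)"
    by (rule measurable_restrict) measurable
  have 1: "distr MW (\<Pi>\<^sub>M i\<in>I. borel) (\<lambda>\<omega>. restrict \<omega> I) = distr exp_law (\<Pi>\<^sub>M i\<in>I. borel) ?a"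
    by (rule distr_MW_I) (measurable, auto simp: limit_point_def fun_eq_iff)
  have 2: "distr MW (\<Pi>\<^sub>M i\<in>-I. borel) (\<lambda>\<omega>. restrict \<omega> (-I)) = distr gauss_law (\<Pi>\<^sub>M i\<in>-I. borel) ?b"
    by (rule distr_MW_J) (measurable, auto simp: limit_point_def fun_eq_iff)
  have "distr exp_law (\<Pi>\<^sub>M i\<in>I. borel) ?a \<Otimes>\<^sub>M distr gauss_law (\<Pi>\<^sub>M i\<in>-I. borel) ?b
    = distr (exp_law \<Otimes>\<^sub>M gauss_law) ((\<Pi>\<^sub>M i\<in>I. borel) \<Otimes>\<^sub>M (\<Pi>\<^sub>M i\<in>-I. borel)) (\<lambda>(x, z). (?a x, ?b z))"
    by (rule pair_measure_distr) (auto intro!: prob_space_imp_sigma_finite gauss_law.prob_space_distr)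
  also have "\<dots> = distr MW ((\<Pi>\<^sub>M i\<in>I. borel) \<Otimes>\<^sub>M (\<Pi>\<^sub>M i\<in>-I. borel)) (\<lambda>\<omega>. (restrict \<omega> I, restrict \<omega> (-I)))"
    unfolding MW_def by (subst distr_distr) (auto simp: o_def limit_point_def fun_eq_iff intro!: distr_cong)
  finally show ?thesis unfolding MW.indep_var_distribution_eq 1 2 by auto
qed

lemma MW_survivor_J:
  assumes x: "\<And>j. 0 \<le> x j" and L: "L \<subseteq> - I"
  shows "measure MW {\<omega> \<in> space MW. \<forall>j\<in>L. ereal (x j) < \<omega> j} = gauss_mass (\<lambda>j. if j \<in> L then x j else 0) / gauss_mass (\<lambda>_. 0)"
proof -
  have [measurable]: "{\<omega>::'k \<Rightarrow> ereal. \<forall>j\<in>L. ereal (x j) < \<omega> j} \<in> sets borel" by measurable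
  have meas[measurable]: "{z \<in> space gauss_law. \<forall>j\<in>L \<inter> T. x j < z j} \<in> sets gauss_law"
    by measurable (use T in auto)
  have "measure MW {\<omega> \<in> space MW. \<forall>j\<in>L. ereal (x j) < \<omega> j} = measure (exp_law \<Otimes>\<^sub>M gauss_law) (limit_point -` {\<omega>. \<forall>j\<in>L. ereal (x j) < \<omega> j} \<inter> space (exp_law \<Otimes>\<^sub>M gauss_law))"
    unfolding MW_def by (subst measure_distr) (auto intro!: arg_cong[where f="measure _"])
  also have "limit_point -` {\<omega>. \<forall>j\<in>L. ereal (x j) < \<omega> j} \<inter> space (exp_law \<Otimes>\<^sub>M gauss_law) = space exp_law \<times> {z \<in> space gauss_law. \<forall>j\<in>L \<inter> T. x j < z j}"
    using L by (auto simp: limit_point_def space_pair_measure subset_iff split: if_splits)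
  also have "measure (exp_law \<Otimes>\<^sub>M gauss_law) \<dots> = measure gauss_law {z \<in> space gauss_law. \<forall>j\<in>L \<inter> T. x j < z j}"
    using meas by (simp add: measure_def gauss_law.emeasure_pair_measure_Times exp_law.emeasure_space_1)
  also have "\<dots> = measure gauss_law (tied_orthant (\<lambda>j. if j \<in> L then x j else 0))"
  proof (rule gauss_law.finite_measure_eq_AE)
    have "AE z in gauss_law. z \<in> tied_orthant (\<lambda>_. 0)"
      unfolding gauss_law_def by (subst AE_density) (auto simp: indicator_def split: if_splits)
    then show "AE z in gauss_law. z \<in> {z \<in> space gauss_law. \<forall>j\<in>L \<inter> T. x j < z j} \<longleftrightarrow> z \<in> tied_orthant (\<lambda>j. if j \<in> L then x j else 0)"
      by eventually_elim (auto simp: tied_orthant_def sets_eq_imp_space_eq[OF sets_gauss_law])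
  qed measurable
  also have "\<dots> = gauss_mass (\<lambda>j. if j \<in> L then x j else 0) / gauss_mass (\<lambda>_. 0)"
  proof -
    have "(\<lambda>j. max 0 (if j \<in> L then x j else 0)) = (\<lambda>j. if j \<in> L then x j else 0)" using x by (auto simp: max_def)
    moreover have "0 \<le> gauss_mass \<theta>" for \<theta> by (auto simp: gauss_mass_def gauss_weight_pos less_imp_le intro!: integral_nonneg_AE)
    ultimately show ?thesis using gauss_law_emeasure[of "\<lambda>j. if j \<in> L then x j else 0"] gauss_mass_pos
      by (simp add: measure_def)
  qed
  finally show ?thesis .
qed

text \<open>
  The limit law is the normalised measure with density \<open>exp (- \<Lambda>)\<close> on the orthant of the coordinates in
  \<open>I\<close> and \<open>T\<close>. This connects the product construction with the integrals that arise as limits.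
\<close>

lemma nn_integral_MW:
  assumes F[measurable]: "F \<in> borel_measurable borel"
  shows "(\<integral>\<^sup>+ y. F (\<lambda>i. if i \<in> I \<union> T then ereal (y $ i) else \<infinity>) * indicator {y. \<forall>i\<in>I \<union> T. 0 < y $ i} y *
      ennreal (exp (- (\<Sum>i\<in>I. rate i * y $ i)) * gauss_weight (($) y)) \<partial>lborel)
    = ennreal (gauss_mass (\<lambda>_. 0) / (\<Prod>i\<in>I. rate i)) * (\<integral>\<^sup>+ w. F w \<partial>MW)"
proof -
  interpret product_sigma_finite "\<lambda>_::'k. lborel :: real measure" ..
  let ?W = "\<lambda>x z. limit_point (x, z)"
  let ?h = "\<lambda>y. F (\<lambda>i. if i \<in> I \<union> T then ereal (y $ i) else \<infinity>) * indicator {y. \<forall>i\<in>I \<union> T. 0 < y $ i} y *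
      ennreal (exp (- (\<Sum>i\<in>I. rate i * y $ i)) * gauss_weight (($) y))"
  define Z where "Z = gauss_mass (\<lambda>_. 0)"
  define pr where "pr = (\<Prod>i\<in>I. rate i)"
  have Z: "0 < Z" and pr: "0 < pr" using gauss_mass_pos rate by (auto simp: Z_def pr_def intro!: prod_pos)
  let ?dI = "\<lambda>x. \<Prod>i\<in>I. ennreal (exponential_density (if i \<in> I then rate i else 1) (x i))"
  let ?dJ = "\<lambda>z. ennreal (gauss_weight z) * indicator (tied_orthant (\<lambda>_. 0)) z / ennreal Z"
  have exp_law: "exp_law = density lebI ?dI"
    unfolding exp_law_def
  proof (rule PiM_density)
    show "sigma_finite_measure (lborel :: real measure)" for i :: 'k by (rule sigma_finite_lborel)
    show "(\<lambda>x. ennreal (exponential_density (if i \<in> I then rate i else 1) x)) \<in> borel_measurable lborel" for i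
      by measurable
    show "sigma_finite_measure (density lborel (\<lambda>x. ennreal (exponential_density (if i \<in> I then rate i else 1) x)))" for i
      by (rule prob_space_imp_sigma_finite[OF exp_prob])
  qed simp
  have "sets (exp_law \<Otimes>\<^sub>M gauss_law) = sets (lebI \<Otimes>\<^sub>M lebJ)" by (rule sets_pair_measure_cong[OF sets_exp_law sets_gauss_law])
  then have [measurable]: "limit_point \<in> borel_measurable (lebI \<Otimes>\<^sub>M lebJ)"
    using limit_point_measurable measurable_cong_sets by blast
  have [measurable]: "(\<lambda>y :: real^'k. (\<lambda>i. if i \<in> I \<union> T then ereal (y $ i) else \<infinity>)) \<in> borel_measurable borel"
    by (rule borel_measurable_funI) auto
  have [measurable]: "(\<lambda>y :: real^'k. gauss_weight (($) y)) \<in> borel_measurable borel"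
    unfolding gauss_weight_def by measurable
  have [measurable]: "{y :: real^'k. \<forall>i\<in>I \<union> T. 0 < y $ i} \<in> sets borel" by measurable
  have hm: "?h \<in> borel_measurable borel" by measurable
  have "(\<integral>\<^sup>+ y. ?h y \<partial>lborel) = (\<integral>\<^sup>+ y. ?h (\<chi> i. y i) \<partial>(\<Pi>\<^sub>M i\<in>UNIV. lborel))"
    by (rule nn_integral_lborel_vec[OF hm])
  also have "\<dots> = (\<integral>\<^sup>+ x. (\<integral>\<^sup>+ z. ?h (\<chi> i. merge I (-I) (x, z) i) \<partial>lebJ) \<partial>lebI)"
  proof -
    have "(\<lambda>y. ?h (\<chi> i. y i)) \<in> borel_measurable (\<Pi>\<^sub>M i\<in>I \<union> - I. lborel)"
      using measurable_compose[OF vec_lambda_measurable hm] by simp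
    from product_nn_integral_fold[OF _ _ _ this] show ?thesis by simp
  qed
  also have "\<dots> = (\<integral>\<^sup>+ x. (\<integral>\<^sup>+ z. ennreal (Z / pr) * (?dI x * (?dJ z * F (?W x z))) \<partial>lebJ) \<partial>lebI)"
  proof (rule nn_integral_cong_AE)
    have ae: "AE x in lebI. \<forall>i\<in>I. x i \<noteq> 0"
    proof (subst AE_finite_all)
      show "\<forall>i\<in>I. AE x in lebI. x i \<noteq> 0"
      proof
        fix i assume i: "i \<in> I"
        show "AE x in lebI. x i \<noteq> 0"
          by (rule AE_PiM_component_lborel[OF i]) simp
      qed
    qed simp
    show "AE x in lebI. (\<integral>\<^sup>+ z. ?h (\<chi> i. merge I (-I) (x, z) i) \<partial>lebJ)
      = (\<integral>\<^sup>+ z. ennreal (Z / pr) * (?dI x * (?dJ z * F (?W x z))) \<partial>lebJ)"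
      using ae
    proof eventually_elim
      fix x :: "'k \<Rightarrow> real" assume x0: "\<forall>i\<in>I. x i \<noteq> 0"
      show "(\<integral>\<^sup>+ z. ?h (\<chi> i. merge I (-I) (x, z) i) \<partial>lebJ)
        = (\<integral>\<^sup>+ z. ennreal (Z / pr) * (?dI x * (?dJ z * F (?W x z))) \<partial>lebJ)"
      proof (rule nn_integral_cong)
        fix z assume z: "z \<in> space lebJ"
        let ?y = "(\<chi> i. merge I (-I) (x, z) i) :: real ^ 'k"
        have yI: "?y $ i = x i" if "i \<in> I" for i using that by simp
        have yJ: "?y $ i = z i" if "i \<notin> I" for i using that by simp
        have W: "(\<lambda>i. if i \<in> I \<union> T then ereal (?y $ i) else \<infinity>) = ?W x z" using T by (auto simp: fun_eq_iff limit_point_def)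
        have "(\<Sum>i\<in>-I. \<Sum>j\<in>-I. ?y $ i * D $ i $ j * ?y $ j) = (\<Sum>i\<in>-I. \<Sum>j\<in>-I. z i * D $ i $ j * z j)"
          by (intro sum.cong refl) auto
        then have g: "gauss_weight (($) ?y) = gauss_weight z" unfolding gauss_weight_def by (simp only:)
        have s: "(\<Sum>i\<in>I. rate i * ?y $ i) = (\<Sum>i\<in>I. rate i * x i)" by (intro sum.cong) auto
        have ind: "indicator {y. \<forall>i\<in>I \<union> T. 0 < y $ i} ?y = (indicator {x. \<forall>i\<in>I. 0 < x i} x * indicator (tied_orthant (\<lambda>_. 0)) z :: ennreal)"
        proof -
          have "(\<forall>i\<in>I. 0 < ?y $ i) = (\<forall>i\<in>I. 0 < x i)" by (intro ball_cong refl) (simp only: yI)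
          moreover have "(\<forall>j\<in>T. 0 < ?y $ j) = (\<forall>j\<in>T. 0 < z j)"
          proof (intro ball_cong refl)
            fix j assume "j \<in> T"
            with T have "j \<notin> I" by auto
            show "(0 < ?y $ j) = (0 < z j)" by (simp only: yJ[OF \<open>j \<notin> I\<close>])
          qed
          ultimately have "(?y \<in> {y. \<forall>i\<in>I \<union> T. 0 < y $ i}) = (x \<in> {x. \<forall>i\<in>I. 0 < x i} \<and> z \<in> tied_orthant (\<lambda>_. 0))"
            unfolding tied_orthant_def mem_Collect_eq ball_Un using z by simp
          then show ?thesis unfolding indicator_def by simp
        qed
        have dI: "?dI x = ennreal pr * (ennreal (exp (- (\<Sum>i\<in>I. rate i * x i))) * indicator {x. \<forall>i\<in>I. 0 < x i} x)"
        proof (cases "\<forall>i\<in>I. 0 < x i")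
          case True
          then have "?dI x = (\<Prod>i\<in>I. ennreal (rate i * exp (- (rate i * x i))))"
            by (intro prod.cong refl) (auto simp: exponential_density_def mult.commute not_less order.order_iff_strict dest: bspec)
          also have "\<dots> = ennreal (\<Prod>i\<in>I. rate i * exp (- (rate i * x i)))" using rate by (intro prod_ennreal) (auto simp: less_imp_le)
          also have "(\<Prod>i\<in>I. rate i * exp (- (rate i * x i))) = pr * exp (- (\<Sum>i\<in>I. rate i * x i))"
            by (simp add: prod.distrib pr_def exp_sum[symmetric] sum_negf)
          finally show ?thesis using True pr by (simp add: ennreal_mult)
        next
          case False
          then obtain i where i: "i \<in> I" "x i < 0" using x0 by (metis linorder_neqE)
          then have "?dI x = 0" by (intro prod_zero) (auto simp: exponential_density_def)
          then show ?thesis using False by simp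
        qed
        have Zc: "ennreal (Z / pr) * (ennreal pr * (A / ennreal Z)) = A" for A
        proof -
          have "ennreal (Z / pr) * (ennreal pr * (A / ennreal Z)) = (ennreal (Z / pr) * ennreal pr * ennreal (1 / Z)) * A"
            using Z by (simp add: divide_ennreal_def inverse_ennreal inverse_eq_divide ac_simps)
          also have "ennreal (Z / pr) * ennreal pr * ennreal (1 / Z) = 1" using Z pr by (simp add: ennreal_mult[symmetric])
          finally show ?thesis by simp
        qed
        have "ennreal (Z / pr) * (?dI x * (?dJ z * F (?W x z)))
          = ennreal (Z / pr) * (ennreal pr * (((ennreal (exp (- (\<Sum>i\<in>I. rate i * x i))) * indicator {x. \<forall>i\<in>I. 0 < x i} x) *
              (ennreal (gauss_weight z) * indicator (tied_orthant (\<lambda>_. 0)) z) * F (?W x z)) / ennreal Z))"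
          unfolding dI by (simp add: divide_ennreal_def ac_simps)
        also have "\<dots> = (ennreal (exp (- (\<Sum>i\<in>I. rate i * x i))) * indicator {x. \<forall>i\<in>I. 0 < x i} x) *
              (ennreal (gauss_weight z) * indicator (tied_orthant (\<lambda>_. 0)) z) * F (?W x z)" by (rule Zc)
        also have "\<dots> = ?h ?y"
          unfolding W g s ind using gauss_weight_pos[of z] by (simp add: ennreal_mult less_imp_le ac_simps)
        finally show "?h ?y = ennreal (Z / pr) * (?dI x * (?dJ z * F (?W x z)))" ..
      qed
    qed
  qed
  also have "\<dots> = (\<integral>\<^sup>+ x. ennreal (Z / pr) * (?dI x * (\<integral>\<^sup>+ z. ?dJ z * F (?W x z) \<partial>lebJ)) \<partial>lebI)"
  proof (rule nn_integral_cong)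
    fix x assume x: "x \<in> space lebI"
    have [measurable]: "(\<lambda>z. F (?W x z)) \<in> borel_measurable lebJ"
      by (rule measurable_compose[OF limit_point_section F])
    show "(\<integral>\<^sup>+ z. ennreal (Z / pr) * (?dI x * (?dJ z * F (?W x z))) \<partial>lebJ)
      = ennreal (Z / pr) * (?dI x * (\<integral>\<^sup>+ z. ?dJ z * F (?W x z) \<partial>lebJ))"
      by (subst nn_integral_cmult, measurable) (subst nn_integral_cmult, measurable)
  qed
  also have "\<dots> = ennreal (Z / pr) * (\<integral>\<^sup>+ x. ?dI x * (\<integral>\<^sup>+ z. ?dJ z * F (?W x z) \<partial>lebJ) \<partial>lebI)"
  proof (rule nn_integral_cmult)
    interpret J: sigma_finite_measure lebJ by (rule sigma_finite) simp
    have "(\<lambda>p. ?dJ (snd p) * F (?W (fst p) (snd p))) \<in> borel_measurable (lebI \<Otimes>\<^sub>M lebJ)" by measurable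
    then have [measurable]: "(\<lambda>x. (\<integral>\<^sup>+ z. ?dJ z * F (?W x z) \<partial>lebJ)) \<in> borel_measurable lebI"
      by (intro J.borel_measurable_nn_integral) (simp add: case_prod_beta)
    show "(\<lambda>x. ?dI x * (\<integral>\<^sup>+ z. ?dJ z * F (?W x z) \<partial>lebJ)) \<in> borel_measurable lebI" by measurable
  qed
  also have "(\<integral>\<^sup>+ x. ?dI x * (\<integral>\<^sup>+ z. ?dJ z * F (?W x z) \<partial>lebJ) \<partial>lebI) = (\<integral>\<^sup>+ x. (\<integral>\<^sup>+ z. F (?W x z) \<partial>gauss_law) \<partial>exp_law)"
  proof -
    have 1: "(\<integral>\<^sup>+ z. F (?W x z) \<partial>gauss_law) = (\<integral>\<^sup>+ z. ?dJ z * F (?W x z) \<partial>lebJ)" for x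
      unfolding gauss_law_def Z_def
      by (intro nn_integral_density measurable_compose[OF limit_point_section F]) measurable
    have "(\<lambda>p. F (?W (fst p) (snd p))) \<in> borel_measurable (exp_law \<Otimes>\<^sub>M gauss_law)"
      using measurable_compose[OF limit_point_measurable F] by simp
    then have "(\<lambda>x. (\<integral>\<^sup>+ z. F (?W x z) \<partial>gauss_law)) \<in> borel_measurable exp_law"
      by (intro gauss_law.borel_measurable_nn_integral) (simp add: case_prod_beta)
    then have "(\<lambda>x. (\<integral>\<^sup>+ z. F (?W x z) \<partial>gauss_law)) \<in> borel_measurable lebI"
      using measurable_cong_sets[OF sets_exp_law refl] by blast
    then have "(\<integral>\<^sup>+ x. (\<integral>\<^sup>+ z. F (?W x z) \<partial>gauss_law) \<partial>density lebI ?dI) = (\<integral>\<^sup>+ x. ?dI x * (\<integral>\<^sup>+ z. F (?W x z) \<partial>gauss_law) \<partial>lebI)"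
      by (intro nn_integral_density) measurable
    then show ?thesis unfolding 1[symmetric] exp_law[symmetric] by (rule sym)
  qed
  also have "\<dots> = (\<integral>\<^sup>+ p. F (limit_point p) \<partial>(exp_law \<Otimes>\<^sub>M gauss_law))"
    by (subst gauss_law.nn_integral_fst[symmetric]) auto
  also have "\<dots> = (\<integral>\<^sup>+ w. F w \<partial>MW)" unfolding MW_def by (subst nn_integral_distr) auto
  finally show ?thesis by (simp add: Z_def pr_def)
qed

end

section \<open>Local coordinates at the minimiser\<close>

lemma linear_subvec: "linear (\<lambda>y. subvec y K)"
  unfolding subvec_eq_proj by (rule matrix_vector_mul_linear)

text \<open>
  The vector \<open>b\<close> is the minimiser of the quadratic programme, normalised to Mahalanobis norm 1. Its
  multipliers on \<open>I\<close> are positive, and off \<open>I\<close> it is the regression of its coordinates in \<open>I\<close>.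
\<close>

locale kotz =
  fixes A S :: "real ^ 'k ^ 'k::finite" and I :: "'k set" and b :: "real ^ 'k"
    and M :: "'m measure" and R :: "'m \<Rightarrow> real" and U :: "'m \<Rightarrow> real ^ 'k" and \<delta> p q N :: real
  assumes A_inv: "invertible A" and S_eq: "S = transpose A ** A" and S_pos: "posdef_on UNIV S"
    and prob_M: "prob_space M" and R_rv[measurable]: "R \<in> borel_measurable M" and U_rv[measurable]: "U \<in> borel_measurable M"
    and U_unif: "distr M borel U = sphere_uniform" and R_pos: "AE \<omega> in M. 0 < R \<omega>" and R_U_indep: "indep_rv M R U"
    and params: "0 < p" "0 < q" "0 < \<delta>"
    and R_tail: "(\<lambda>u. measure M {\<omega> \<in> space M. u < R \<omega>}) \<sim>[at_top] weibull_tail p N q \<delta>"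
    and I_ne: "I \<noteq> {}" and rate_pos: "\<And>i. i \<in> I \<Longrightarrow> 0 < (sub_inv S I *v subvec b I) $ i"
    and b_norm: "subvec b I \<bullet> (sub_inv S I *v subvec b I) = 1"
    and b_J: "subvec b (- I) = submat S (- I) I *v (sub_inv S I *v subvec b I)"
begin

sublocale prob_space M by (rule prob_M)

definition tail_prob :: "real \<Rightarrow> real" where "tail_prob v = prob {\<omega> \<in> space M. v < R \<omega>}"
text \<open>
  \<open>B\<close> and \<open>D\<close> are the matrices of the two forms in the block decomposition of the inverse of \<open>S\<close>. The
  sum \<open>limit_exponent y / m + quad_rest y / (2 * m\<^sup>2)\<close> is half the relative increase of the squared
  Mahalanobis norm at displacement \<open>y\<close>. The last term of \<open>displacement\<close> moves the coordinates outside \<open>I\<close> along the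
  regression, so that \<open>y\<close> describes their residual. \<open>speed\<close> is \<open>u\<close> times the hazard rate of the tail at \<open>u\<close>.
  \<open>rel_density\<close> is the density of the smoothed vector in these coordinates, up to a factor that
  depends on \<open>u\<close> alone.
\<close>

definition B where "B = sub_inv S I"
definition D where "D = sub_inv (schur_compl S I) (- I)"
definition rate :: "'k \<Rightarrow> real" where "rate i = (B *v subvec b I) $ i"
definition limit_exponent :: "real ^ 'k \<Rightarrow> real" where
  "limit_exponent y = (\<Sum>i\<in>I. rate i * y $ i) + subvec y (- I) \<bullet> (D *v subvec y (- I)) / 2"
definition quad_rest :: "real ^ 'k \<Rightarrow> real" where "quad_rest y = subvec y I \<bullet> (B *v subvec y I)"
definition displacement :: "real \<Rightarrow> real ^ 'k \<Rightarrow> real ^ 'k" where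
  "displacement m y = (1 / m) *\<^sub>R subvec y I + (1 / sqrt m) *\<^sub>R subvec y (- I) + (1 / m) *\<^sub>R (submat S (- I) I *v (B *v subvec y I))"
definition rel_radius :: "real \<Rightarrow> real ^ 'k \<Rightarrow> real" where "rel_radius m y = sqrt (1 + 2 * limit_exponent y / m + quad_rest y / m\<^sup>2)"
definition speed :: "real \<Rightarrow> real" where "speed u = q * \<delta> * u powr \<delta>"
definition scaled_point :: "real \<Rightarrow> real ^ 'k \<Rightarrow> real ^ 'k" where "scaled_point u y = u *\<^sub>R (b + displacement (speed u) y)"
definition rel_density :: "real \<Rightarrow> real \<Rightarrow> real ^ 'k \<Rightarrow> real" where
  "rel_density \<eta> u y = (tail_prob (u * (rel_radius (speed u) y * exp (- (\<eta> / speed u)))) - tail_prob (u * rel_radius (speed u) y)) / (tail_prob u * (\<eta> * rel_radius (speed u) y ^ CARD('k)))"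
definition elliptical_rv :: "'m \<Rightarrow> real ^ 'k" where "elliptical_rv \<omega> = transpose A *v (R \<omega> *\<^sub>R U \<omega>)"

lemma tail_prob_nonneg: "0 \<le> tail_prob v" by (simp add: tail_prob_def)

lemma tail_prob_diff:
  assumes "v \<le> w"
  shows "prob {\<omega> \<in> space M. v < R \<omega> \<and> R \<omega> \<le> w} = tail_prob v - tail_prob w"
proof -
  have "{\<omega> \<in> space M. v < R \<omega> \<and> R \<omega> \<le> w} = {\<omega> \<in> space M. v < R \<omega>} - {\<omega> \<in> space M. w < R \<omega>}" by auto
  also have "prob \<dots> = tail_prob v - tail_prob w"
    unfolding tail_prob_def by (rule finite_measure_Diff) (use assms in auto)
  finally show ?thesis .
qed

lemma tail_prob_antimono: "v \<le> w \<Longrightarrow> tail_prob w \<le> tail_prob v"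
  using tail_prob_diff[of v w] by (metis diff_ge_0_iff_ge measure_nonneg)

lemma tail_prob_measurable[measurable]: "tail_prob \<in> borel_measurable borel"
proof -
  have "mono (\<lambda>v. - tail_prob v)" by (auto intro!: monoI tail_prob_antimono)
  then have "(\<lambda>v. - (- tail_prob v)) \<in> borel_measurable borel" by (intro borel_measurable_uminus borel_measurable_mono)
  then show ?thesis by simp
qed

lemma S_posI: "posdef_on I S" by (rule posdef_on_subset[OF S_pos])
lemmas schur = schur_compl_laws[OF S_pos, of I]

lemma subvec_measurable[measurable]: "(\<lambda>y::real^'k. subvec y K) \<in> borel_measurable borel"
  using linear_subvec by (intro borel_measurable_continuous_onI linear_continuous_on) (simp add: linear_conv_bounded_linear)

lemma matvec_measurable[measurable]: "(\<lambda>y::real^'k. (Q :: real^'k^'k) *v y) \<in> borel_measurable borel"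
  by (intro borel_measurable_continuous_onI linear_continuous_on matrix_vector_mul_bounded_linear)

lemma limit_exponent_measurable[measurable]: "limit_exponent \<in> borel_measurable borel" unfolding limit_exponent_def by measurable
lemma quad_rest_measurable[measurable]: "quad_rest \<in> borel_measurable borel" unfolding quad_rest_def by measurable
lemma rel_radius_measurable[measurable]: "rel_radius m \<in> borel_measurable borel" unfolding rel_radius_def by measurable
lemma displacement_measurable[measurable]: "displacement m \<in> borel_measurable borel" unfolding displacement_def by measurable
lemma scaled_point_measurable[measurable]: "scaled_point u \<in> borel_measurable borel" unfolding scaled_point_def by measurable
lemma rel_density_measurable[measurable]: "rel_density \<eta> u \<in> borel_measurable borel" unfolding rel_density_def by measurable

lemma linear_displacement: "linear (displacement m)"
  unfolding displacement_def subvec_eq_proj matrix_vector_mul_assoc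
  by (intro linear_compose_add linear_compose_scale_right matrix_vector_mul_linear)

lemma subvec_subvec: "subvec (subvec y K) L = subvec y (K \<inter> L)"
  by (auto simp: subvec_def vec_eq_iff)

lemma subvec_empty: "subvec y {} = 0" by (simp add: subvec_def vec_eq_iff)

lemma subvec_add: "subvec (x + y) K = subvec x K + subvec y K"
  by (simp add: subvec_def vec_eq_iff)

lemma subvec_scale: "subvec (r *\<^sub>R y) K = r *\<^sub>R subvec y K"
  by (simp add: subvec_def vec_eq_iff)

lemma subvec_compl_add: "subvec y K + subvec y (- K) = y"
  by (simp add: subvec_def vec_eq_iff)

lemma subvec_submat: "K' \<inter> K = {} \<Longrightarrow> subvec (submat Q K L *v y) K' = 0"
  by (auto simp: subvec_def submat_def vec_eq_iff matrix_vector_mult_def disjoint_iff intro!: sum.neutral)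

lemma subvec_submat_same: "subvec (submat Q K L *v y) K = submat Q K L *v y"
  by (auto simp: subvec_def submat_def vec_eq_iff matrix_vector_mult_def)

lemma displacement_I: "subvec (displacement m y) I = (1 / m) *\<^sub>R subvec y I"
  unfolding displacement_def subvec_add subvec_scale subvec_subvec
  by (simp add: subvec_submat subvec_empty)

lemma displacement_J: "subvec (displacement m y) (- I) = (1 / sqrt m) *\<^sub>R subvec y (- I) + (1 / m) *\<^sub>R (submat S (- I) I *v (B *v subvec y I))"
  unfolding displacement_def subvec_add subvec_scale subvec_subvec subvec_submat_same by (simp add: subvec_empty)

lemma inj_displacement:
  assumes "0 < m"
  shows "inj (displacement m)"
  unfolding linear_injective_0[OF linear_displacement]
proof (intro allI impI)
  fix y assume 0: "displacement m y = 0"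
  have s0: "subvec (0 :: real^'k) K = 0" for K by (simp add: subvec_def vec_eq_iff)
  have 1: "subvec y I = 0" using displacement_I[of m y] assms unfolding 0 s0 by simp
  have 2: "subvec y (- I) = 0" using displacement_J[of m y] assms unfolding 0 s0 1 by simp
  show "y = 0" using subvec_compl_add[of y I] 1 2 by simp
qed

lemma quad_rest_nonneg: "0 \<le> quad_rest y"
proof (cases "subvec y I = 0")
  case False
  moreover have "coord_proj I *v subvec y I = subvec y I"
    by (simp add: subvec_eq_proj[symmetric] subvec_subvec)
  ultimately show ?thesis unfolding quad_rest_def B_def using sub_inv_pos[OF S_posI] by (simp add: less_imp_le)
qed (simp add: quad_rest_def)

text \<open>
  The cross term between \<open>b\<close> and \<open>y\<close> gives the linear part of \<open>limit_exponent\<close>, and there is none outside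
  \<open>I\<close> because the residual of \<open>b\<close> is zero.
\<close>

lemma norm_scaled_point:
  assumes u: "0 < u" and g: "transpose A *v g = scaled_point u y"
  shows "norm g = u * rel_radius (speed u) y"
proof -
  define m where "m = speed u"
  have m: "0 < m" unfolding m_def speed_def using params u by simp
  obtain A' where A': "A ** A' = mat 1" using A_inv unfolding invertible_def by blast
  define h where "h = A' *v g"
  have Ah: "A *v h = g" unfolding h_def by (simp add: matrix_vector_mul_assoc A')
  have Sh: "scaled_point u y = S *v h" 
  proof -
    have "S *v h = transpose A *v (A *v h)" by (subst S_eq) (simp add: matrix_vector_mul_assoc)
    then show ?thesis using g Ah by simp
  qed
  have "h \<bullet> (S *v h) = (A *v h) \<bullet> (A *v h)"
    unfolding S_eq using dot_lmul_matrix[of "A *v h" A h] transpose_matrix_vector[of A "A *v h"]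
    by (simp add: matrix_vector_mul_assoc[symmetric] inner_commute)
  then have ng: "(norm g)\<^sup>2 = h \<bullet> (S *v h)" by (simp add: Ah power2_norm_eq_inner)
  let ?z = "(u / sqrt m) *\<^sub>R subvec y (- I)"
  have xI: "subvec (scaled_point u y) I = u *\<^sub>R (subvec b I + (1 / m) *\<^sub>R subvec y I)"
    unfolding scaled_point_def m_def[symmetric] subvec_scale subvec_add displacement_I ..
  have "subvec (scaled_point u y) (- I) - submat S (- I) I *v (B *v subvec (scaled_point u y) I) = ?z"
    unfolding xI unfolding scaled_point_def m_def[symmetric] subvec_scale subvec_add displacement_J b_J B_def[symmetric]
    by (simp add: matrix_vector_mult_scaleR matrix_vector_right_distrib algebra_simps)
  from inverse_form_blocks[OF S_pos Sh this[unfolded B_def, symmetric]]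
  have "(norm g)\<^sup>2 = subvec (scaled_point u y) I \<bullet> (B *v subvec (scaled_point u y) I) + ?z \<bullet> (D *v ?z)"
    unfolding ng B_def D_def .
  also have "?z \<bullet> (D *v ?z) = u\<^sup>2 * (subvec y (- I) \<bullet> (D *v subvec y (- I)) / m)"
    using m by (simp add: matrix_vector_mult_scaleR power2_eq_square)
  also have "subvec (scaled_point u y) I \<bullet> (B *v subvec (scaled_point u y) I) = u\<^sup>2 * (1 + 2 * (\<Sum>i\<in>I. rate i * y $ i) / m + quad_rest y / m\<^sup>2)"
  proof -
    have sym: "subvec b I \<bullet> (B *v subvec y I) = subvec y I \<bullet> (B *v subvec b I)"
      unfolding B_def using inner_matrix_sym[OF sub_inv_laws(5)[OF S_posI]] by (metis inner_commute)
    have l: "subvec y I \<bullet> (B *v subvec b I) = (\<Sum>i\<in>I. rate i * y $ i)"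
      unfolding inner_vec_def rate_def by (rule sum.mono_neutral_cong_right) (auto simp: subvec_def)
    show ?thesis unfolding xI
      using b_norm[folded B_def] m
      by (simp add: matrix_vector_mult_scaleR matrix_vector_right_distrib inner_add_left inner_add_right sym l quad_rest_def
          power2_eq_square field_simps)
  qed
  finally have "(norm g)\<^sup>2 = u\<^sup>2 * (1 + 2 * limit_exponent y / m + quad_rest y / m\<^sup>2)"
    unfolding limit_exponent_def using m by (simp add: field_simps)
  then have "norm g = sqrt (u\<^sup>2 * (1 + 2 * limit_exponent y / m + quad_rest y / m\<^sup>2))" by (metis norm_ge_zero real_sqrt_abs2 real_sqrt_pow2_iff real_sqrt_unique)
  then show ?thesis unfolding rel_radius_def m_def using u by (simp add: real_sqrt_mult)
qed

text \<open>
  The expectation of \<open>f\<close> at the elliptical vector multiplied by an independent log-uniform factor with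
  range \<open>\<eta> / speed u\<close>. This range is comparable with the local scale, so that \<open>\<eta>\<close> stays visible in the limit.
\<close>

definition smoothed :: "real \<Rightarrow> real \<Rightarrow> (real ^ 'k \<Rightarrow> ennreal) \<Rightarrow> ennreal" where
  "smoothed \<eta> u f = (\<integral>\<^sup>+ \<omega>. (\<integral>\<^sup>+ l. f (l *\<^sub>R elliptical_rv \<omega>) * ennreal (1 / (\<eta> / speed u * l)) * indicator {1..<exp (\<eta> / speed u)} l \<partial>lborel) \<partial>M)"

text \<open>
  The constant may depend on \<open>u\<close>, but it is the same for all \<open>\<eta>\<close> and \<open>f\<close>: letting \<open>\<eta>\<close> tend to zero later would
  otherwise not identify the limit.
\<close>

lemma smoothing_identity:
  assumes u: "0 < u" and tu: "0 < tail_prob u"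
  shows "\<exists>C>0. \<forall>(\<eta>::real) f. 0 < \<eta> \<longrightarrow> f \<in> borel_measurable borel \<longrightarrow>
     smoothed \<eta> u f = ennreal C * (\<integral>\<^sup>+ y. f (scaled_point u y) * ennreal (rel_density \<eta> u y) \<partial>lborel)"
proof -
  define m where "m = speed u"
  have m: "0 < m" unfolding m_def speed_def using params u by simp
  obtain A' where A': "transpose A ** A' = mat 1" "A' ** transpose A = mat 1"
    using A_inv unfolding invertible_def by (metis matrix_transpose_mul transpose_mat)
  define L where "L y = A' *v (u *\<^sub>R displacement m y)" for y
  have "linear L" unfolding L_def
    by (intro linear_compose[OF linear_compose_scale_right[OF linear_displacement] matrix_vector_mul_linear, unfolded o_def])
  moreover have "inj L"
  proof (rule injI)
    fix x y assume "L x = L y"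
    then have "transpose A *v L x = transpose A *v L y" by simp
    then have "displacement m x = displacement m y" using u by (simp add: L_def matrix_vector_mul_assoc A')
    then show "x = y" using inj_displacement[OF m] by (simp add: inj_def)
  qed
  ultimately obtain \<kappa> where \<kappa>: "0 < \<kappa>" "\<And>c f. f \<in> borel_measurable borel \<Longrightarrow>
     (\<integral>\<^sup>+ x. f x \<partial>lborel) = ennreal \<kappa> * (\<integral>\<^sup>+ y. f (c + L y) \<partial>lborel)"
    using nn_integral_linear_substitution[of L] by blast
  define c0 where "c0 = 1 / (DIM(real^'k) * measure lborel (ball 0 1 :: (real^'k) set))"
  have c0: "0 < c0" unfolding c0_def by (simp add: content_ball_pos)
  define C where "C = c0 * \<kappa> * (m * tail_prob u / u ^ CARD('k))"
  have C: "0 < C" using c0 \<kappa> m tu u by (simp add: C_def)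
  have e0: "0 \<le> m * tail_prob u / u ^ CARD('k)" using m tu u by simp
  have C': "ennreal C = ennreal c0 * ennreal \<kappa> * ennreal (m * tail_prob u / u ^ CARD('k))"
    unfolding C_def
    by (simp only: ennreal_mult[OF mult_nonneg_nonneg[OF less_imp_le[OF c0] less_imp_le[OF \<kappa>(1)]] e0]
        ennreal_mult[OF less_imp_le[OF c0] less_imp_le[OF \<kappa>(1)]])
  show ?thesis
  proof (intro exI[of _ C] conjI allI impI C)
    fix \<eta> :: real and f :: "real^'k \<Rightarrow> ennreal" assume \<eta>: "0 < \<eta>" and f[measurable]: "f \<in> borel_measurable borel"
    define h where "h = \<eta> / m"
    have h: "0 < h" using \<eta> m by (simp add: h_def)
    have fA[measurable]: "(\<lambda>x. f (transpose A *v x)) \<in> borel_measurable borel" by measurable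
    have [measurable]: "(\<lambda>y :: real^'k. ennreal ((tail_prob (norm y * exp (- h)) - tail_prob (norm y)) / (h * norm y ^ DIM(real^'k)))) \<in> borel_measurable borel"
      by measurable
    have "smoothed \<eta> u f = (\<integral>\<^sup>+ \<omega>. (\<integral>\<^sup>+ l. f (transpose A *v (l *\<^sub>R (R \<omega> *\<^sub>R U \<omega>))) * ennreal (1 / (h * l)) * indicator {1..<exp h} l \<partial>lborel) \<partial>M)"
      unfolding smoothed_def elliptical_rv_def h_def m_def by (simp add: matrix_vector_mult_scaleR)
    also have "\<dots> = ennreal c0 * (\<integral>\<^sup>+ y. f (transpose A *v y) * ennreal (prob {\<omega>\<in>space M. norm y * exp (- h) < R \<omega> \<and> R \<omega> \<le> norm y}
          / (h * norm y ^ DIM(real^'k))) \<partial>lborel)"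
      unfolding c0_def
      by (rule log_uniform_smoothing_density[OF prob_M R_rv U_rv R_U_indep R_pos U_unif fA h])
    also have "\<dots> = ennreal c0 * (\<integral>\<^sup>+ y. f (transpose A *v y) * ennreal ((tail_prob (norm y * exp (- h)) - tail_prob (norm y)) / (h * norm y ^ DIM(real^'k))) \<partial>lborel)"
    proof -
      have "norm y * exp (- h) \<le> norm y" for y :: "real^'k" using h by (simp add: mult_left_le)
      then show ?thesis by (simp add: tail_prob_diff)
    qed
    also have "(\<integral>\<^sup>+ y. f (transpose A *v y) * ennreal ((tail_prob (norm y * exp (- h)) - tail_prob (norm y)) / (h * norm y ^ DIM(real^'k))) \<partial>lborel)
      = ennreal \<kappa> * (\<integral>\<^sup>+ y. f (transpose A *v (A' *v (u *\<^sub>R b) + L y)) * ennreal ((tail_prob (norm (A' *v (u *\<^sub>R b) + L y) * exp (- h)) - tail_prob (norm (A' *v (u *\<^sub>R b) + L y)))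
        / (h * norm (A' *v (u *\<^sub>R b) + L y) ^ DIM(real^'k))) \<partial>lborel)"
      by (rule \<kappa>(2)) measurable
    also have "\<dots> = ennreal \<kappa> * (\<integral>\<^sup>+ y. ennreal (m * tail_prob u / u ^ CARD('k)) * (f (scaled_point u y) * ennreal (rel_density \<eta> u y)) \<partial>lborel)"
    proof (intro arg_cong[where f="\<lambda>x. ennreal \<kappa> * x"] nn_integral_cong)
      fix y
      let ?g = "A' *v (u *\<^sub>R b) + L y"
      have g: "transpose A *v ?g = scaled_point u y"
        unfolding L_def scaled_point_def m_def[symmetric] by (simp add: matrix_vector_right_distrib matrix_vector_mul_assoc A' scaleR_add_right)
      have n: "norm ?g = u * rel_radius m y" using norm_scaled_point[OF u g] by (simp add: m_def)
      \<comment> \<open>The common factor of the density goes into C, which therefore depends neither on \<eta> nor on f.\<close>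
      have e: "m * tail_prob u / u ^ CARD('k) * (c / (tail_prob u * (\<eta> * G))) = c / (\<eta> / m * (u ^ CARD('k) * G))" for c G
        using m tu u \<eta> by (cases "G = 0") (simp_all add: field_simps)
      have "m * tail_prob u / u ^ CARD('k) * rel_density \<eta> u y = (tail_prob (norm ?g * exp (- h)) - tail_prob (norm ?g)) / (h * norm ?g ^ DIM(real^'k))"
        unfolding n rel_density_def m_def[symmetric] h_def e by (simp add: power_mult_distrib mult.assoc)
      then have "ennreal (m * tail_prob u / u ^ CARD('k)) * ennreal (rel_density \<eta> u y)
        = ennreal ((tail_prob (norm ?g * exp (- h)) - tail_prob (norm ?g)) / (h * norm ?g ^ DIM(real^'k)))"
        using m tu u by (subst ennreal_mult'[symmetric]) auto
      then show "f (transpose A *v ?g) * ennreal ((tail_prob (norm ?g * exp (- h)) - tail_prob (norm ?g)) / (h * norm ?g ^ DIM(real^'k)))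
        = ennreal (m * tail_prob u / u ^ CARD('k)) * (f (scaled_point u y) * ennreal (rel_density \<eta> u y))"
        unfolding g by (simp add: ac_simps)
    qed
    also have "\<dots> = ennreal \<kappa> * (ennreal (m * tail_prob u / u ^ CARD('k)) * (\<integral>\<^sup>+ y. f (scaled_point u y) * ennreal (rel_density \<eta> u y) \<partial>lborel))"
      by (subst nn_integral_cmult) measurable
    finally show "smoothed \<eta> u f = ennreal C * (\<integral>\<^sup>+ y. f (scaled_point u y) * ennreal (rel_density \<eta> u y) \<partial>lborel)"
      unfolding C' by (simp only: mult.assoc)
  qed
qed

lemma D_lower: "\<exists>c>0. \<forall>z. c * (\<Sum>i\<in>-I. (z $ i)\<^sup>2) \<le> subvec z (- I) \<bullet> (D *v subvec z (- I))"
proof -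
  let ?P = "D + coord_proj I"
  have pos: "0 < x \<bullet> (?P *v x)" if "x \<noteq> 0" for x
  proof -
    have 1: "subvec x (- I) \<bullet> (D *v subvec x (- I)) = x \<bullet> (D *v x)"
      using sub_inv_laws(1,2)[OF schur(4)] unfolding D_def subvec_eq_proj
      by (metis inner_coord_proj matrix_vector_mul_assoc)
    have 2: "x \<bullet> (coord_proj I *v x) = subvec x I \<bullet> subvec x I"
      unfolding subvec_eq_proj by (metis coord_proj_idem inner_coord_proj matrix_vector_mul_assoc)
    have eq: "x \<bullet> (?P *v x) = subvec x (- I) \<bullet> (D *v subvec x (- I)) + subvec x I \<bullet> subvec x I"
      by (simp add: matrix_vector_mult_add_rdistrib inner_add_right 1 2)
    have p: "subvec x (- I) \<noteq> 0 \<Longrightarrow> 0 < subvec x (- I) \<bullet> (D *v subvec x (- I))"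
      unfolding D_def by (rule sub_inv_pos[OF schur(4)]) (simp_all add: subvec_eq_proj[symmetric] subvec_subvec)
    have "subvec x I \<noteq> 0 \<or> subvec x (- I) \<noteq> 0" using that subvec_compl_add[of x I] by auto
    then show ?thesis unfolding eq using p by (cases "subvec x (- I) = 0") (auto intro: add_pos_nonneg)
  qed
  from posdef_form_lower_bound[OF this] obtain c where c: "0 < c" "\<And>x. c * (norm x)\<^sup>2 \<le> x \<bullet> (?P *v x)" by blast
  show ?thesis
  proof (intro exI[of _ c] conjI allI c(1))
    fix z :: "real^'k"
    let ?x = "subvec z (- I)"
    have 0: "coord_proj I *v ?x = 0" by (simp add: subvec_eq_proj[symmetric] subvec_subvec subvec_empty)
    have "(norm ?x)\<^sup>2 = ?x \<bullet> ?x" by (rule power2_norm_eq_inner)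
    also have "\<dots> = (\<Sum>i\<in>UNIV. (?x $ i)\<^sup>2)" by (simp only: inner_vec_def inner_real_def power2_eq_square)
    also have "\<dots> = (\<Sum>i\<in>-I. (z $ i)\<^sup>2)" by (rule sum.mono_neutral_cong_right) (auto simp: subvec_def)
    finally show "c * (\<Sum>i\<in>-I. (z $ i)\<^sup>2) \<le> ?x \<bullet> (D *v ?x)"
      using c(2)[of ?x] by (simp add: matrix_vector_mult_add_rdistrib 0)
  qed
qed

lemma tail_prob_tail: "tail_prob \<sim>[at_top] weibull_tail p N q \<delta>"
  using R_tail unfolding tail_prob_def .

text \<open>
  The coordinates in \<open>I\<close> must be bounded below for integrability of \<open>exp (- \<Lambda>)\<close>. The bound is -1 and not 0, to
  leave room for the displacement caused by the smoothing factor.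
\<close>

definition shifted_cone :: "(real ^ 'k) set" where "shifted_cone = {y. \<forall>i\<in>I. - 1 \<le> y $ i}"

lemma shifted_cone_measurable[measurable]: "shifted_cone \<in> sets borel" unfolding shifted_cone_def by measurable

text \<open>
  The number under the root is a squared Mahalanobis norm, hence nonnegative for every \<open>y\<close>.
\<close>

lemma rel_density_nonneg:
  assumes "0 < \<eta>" "0 < u"
  shows "0 \<le> rel_density \<eta> u y"
proof -
  have m: "0 < speed u" unfolding speed_def using params assms by simp
  show ?thesis
  proof (cases "0 \<le> 1 + 2 * limit_exponent y / speed u + quad_rest y / (speed u)\<^sup>2")
    case True
    then have g: "0 \<le> rel_radius (speed u) y" unfolding rel_radius_def by simp
    then have "u * (rel_radius (speed u) y * exp (- (\<eta> / speed u))) \<le> u * rel_radius (speed u) y"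
      using assms m by (intro mult_left_mono mult_left_le) auto
    then have "tail_prob (u * rel_radius (speed u) y) \<le> tail_prob (u * (rel_radius (speed u) y * exp (- (\<eta> / speed u))))" by (rule tail_prob_antimono)
    then show ?thesis unfolding rel_density_def using g assms tail_prob_nonneg[of u] by (intro divide_nonneg_nonneg mult_nonneg_nonneg) auto
  next
    case False
    obtain A' where A': "transpose A ** A' = mat 1"
      using A_inv unfolding invertible_def by (metis matrix_transpose_mul transpose_mat)
    have "transpose A *v (A' *v scaled_point u y) = scaled_point u y" by (simp add: matrix_vector_mul_assoc A')
    from norm_scaled_point[OF assms(2) this] have "0 \<le> u * rel_radius (speed u) y" by (metis norm_ge_zero)
    then have "0 \<le> rel_radius (speed u) y" using assms by (simp add: zero_le_mult_iff)
    then show ?thesis using False unfolding rel_radius_def by simp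
  qed
qed

lemma rel_density_tendsto:
  assumes u: "filterlim u at_top sequentially"
  shows "(\<lambda>n. rel_density \<eta> (u n) y) \<longlonglongrightarrow> (exp \<eta> - 1) / \<eta> * exp (- limit_exponent y)"
  unfolding rel_density_def
  by (rule shell_density_tendsto[OF tail_prob_tail params u, of "\<lambda>n. speed (u n)" "\<lambda>n. rel_radius (speed (u n)) y" "limit_exponent y" "quad_rest y"])
     (simp_all add: speed_def rel_radius_def)

text \<open>
  Growth is linear in the coordinates in \<open>I\<close> and quadratic in the others, and a sum of nonnegative terms
  dominates each of them. So a power of the sum dominates the product over all coordinates.
\<close>

lemma dominating_product:
  "\<exists>j>0. \<exists>e>0. \<exists>\<Lambda>0\<ge>0. \<forall>y\<in>shifted_cone. - \<Lambda>0 \<le> limit_exponent y \<and> 1 / (1 + (limit_exponent y + \<Lambda>0) / (4 * real j)) ^ j \<le> e * (\<Prod>i\<in>UNIV. 1 / (1 + \<bar>y $ i\<bar>)\<^sup>2)"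
proof -
  obtain c where c: "0 < c" "\<And>z. c * (\<Sum>i\<in>-I. (z $ i)\<^sup>2) \<le> subvec z (- I) \<bullet> (D *v subvec z (- I))"
    using D_lower by blast
  \<comment> \<open>Two factors for every coordinate.\<close>
  define j where "j = 2 * CARD('k)"
  define J where "J = 4 * real j"
  have J: "0 < J" by (simp add: J_def j_def)
  define \<Lambda>0 where "\<Lambda>0 = (\<Sum>i\<in>I. rate i)"
  have rate: "0 < rate i" if "i \<in> I" for i using rate_pos[OF that] by (simp add: rate_def B_def)
  \<comment> \<open>The constants by which one coordinate of 1 + (limit_exponent y + \<Lambda>0) / J beats 1 + |y i|, before or after squaring.\<close>
  define s where "s i = (if i \<in> I then (min 1 (rate i / J) / 3)\<^sup>2 else min 1 (c / (2 * J)) / 2)" for i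
  have s: "0 < s i" for i
  proof (cases "i \<in> I")
    case True
    then have "0 < min 1 (rate i / J)" using rate J by simp
    then have "0 < (min 1 (rate i / J) / 3)\<^sup>2" by (intro zero_less_power divide_pos_pos) auto
    then show ?thesis using True by (simp only: s_def if_True)
  qed (use c J in \<open>simp add: s_def\<close>)
  define e where "e = (\<Prod>i\<in>UNIV. 1 / s i)"
  have e: "0 < e" unfolding e_def using s by (intro prod_pos) auto
  have main: "- \<Lambda>0 \<le> limit_exponent y \<and> 1 / (1 + (limit_exponent y + \<Lambda>0) / (4 * real j)) ^ j \<le> e * (\<Prod>i\<in>UNIV. 1 / (1 + \<bar>y $ i\<bar>)\<^sup>2)"
    if y: "y \<in> shifted_cone" for y
  proof -
    define \<tau> where "\<tau> i = (if i \<in> I then rate i / J * (y $ i + 1) else c / (2 * J) * (y $ i)\<^sup>2)" for i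
    have y1: "- 1 \<le> y $ i" if "i \<in> I" for i using y that by (simp add: shifted_cone_def)
    have \<tau>0: "0 \<le> \<tau> i" for i using rate[of i] c J y1[of i] by (auto simp: \<tau>_def)
    have "(\<Sum>i\<in>UNIV. \<tau> i) = (\<Sum>i\<in>I. \<tau> i) + (\<Sum>i\<in>-I. \<tau> i)"
      by (subst sum.union_disjoint[symmetric]) auto
    also have "(\<Sum>i\<in>I. \<tau> i) = ((\<Sum>i\<in>I. rate i * y $ i) + \<Lambda>0) / J"
      by (simp add: \<tau>_def \<Lambda>0_def sum_divide_distrib[symmetric] sum.distrib[symmetric] algebra_simps cong: sum.cong)
    also have "(\<Sum>i\<in>-I. \<tau> i) = c * (\<Sum>i\<in>-I. (y $ i)\<^sup>2) / 2 / J"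
    proof -
      have "(\<Sum>i\<in>-I. \<tau> i) = (\<Sum>i\<in>-I. c * (y $ i)\<^sup>2 / 2 / J)"
        by (intro sum.cong refl) (simp add: \<tau>_def)
      then show ?thesis by (simp add: sum_distrib_left sum_divide_distrib)
    qed
    also have "\<dots> \<le> subvec y (- I) \<bullet> (D *v subvec y (- I)) / 2 / J"
      using c(2)[of y] J by (intro divide_right_mono) auto
    finally have sum: "(\<Sum>i\<in>UNIV. \<tau> i) \<le> (limit_exponent y + \<Lambda>0) / J"
      unfolding limit_exponent_def by (simp add: add_divide_distrib algebra_simps)
    have "0 \<le> (\<Sum>i\<in>UNIV. \<tau> i)" using \<tau>0 by (intro sum_nonneg) auto
    then have L0: "0 \<le> limit_exponent y + \<Lambda>0" using sum J by (metis (no_types) order_trans zero_le_divide_iff not_less less_imp_le order.asym)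
    have le: "s i * (1 + \<bar>y $ i\<bar>)\<^sup>2 \<le> (1 + (limit_exponent y + \<Lambda>0) / J)\<^sup>2" for i
    proof -
      have "\<tau> i \<le> (\<Sum>i\<in>UNIV. \<tau> i)" using \<tau>0 by (intro member_le_sum) auto
      then have t: "1 + \<tau> i \<le> 1 + (limit_exponent y + \<Lambda>0) / J" using sum by simp
      have "s i * (1 + \<bar>y $ i\<bar>)\<^sup>2 \<le> (1 + \<tau> i)\<^sup>2"
      proof (cases "i \<in> I")
        case True
        let ?r = "min 1 (rate i / J)"
        have r: "0 < ?r" "?r \<le> 1" "?r \<le> rate i / J" using rate[OF True] J by auto
        have "?r / 3 * (1 + \<bar>y $ i\<bar>) \<le> ?r / 3 * (2 + (y $ i + 1))" using y1[OF True] r by (intro mult_left_mono) auto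
        also have "\<dots> = 2 / 3 * ?r + ?r / 3 * (y $ i + 1)" by (simp add: algebra_simps)
        also have "\<dots> \<le> 1 + rate i / J * (y $ i + 1)"
        proof (intro add_mono mult_right_mono)
          have third: "z / 3 \<le> z" "z \<le> 1 \<Longrightarrow> 2 / 3 * z \<le> 1" if "0 < z" for z :: real using that by simp_all
          show "2 / 3 * ?r \<le> 1" by (rule third(2)[OF r(1,2)])
          have "?r / 3 \<le> ?r" by (rule third(1)[OF r(1)])
          then show "?r / 3 \<le> rate i / J" using r(3) by (rule order_trans)
          show "0 \<le> y $ i + 1" using y1[OF True] by linarith
        qed
        finally have "(?r / 3 * (1 + \<bar>y $ i\<bar>))\<^sup>2 \<le> (1 + \<tau> i)\<^sup>2"
          using r True by (intro power_mono) (auto simp: \<tau>_def)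
        then show ?thesis using True by (simp only: s_def if_True power_mult_distrib[of "?r / 3"])
      next
        case False
        have "s i * (1 + \<bar>y $ i\<bar>)\<^sup>2 \<le> 1 + \<tau> i"
          using one_plus_square_bound[of "c / (2 * J)" "y $ i"] c J False by (simp add: s_def \<tau>_def)
        also have "\<dots> \<le> (1 + \<tau> i)\<^sup>2" using \<tau>0[of i] by (simp add: power2_eq_square)
        finally show ?thesis .
      qed
      also have "\<dots> \<le> (1 + (limit_exponent y + \<Lambda>0) / J)\<^sup>2" using t \<tau>0[of i] by (intro power_mono) auto
      finally show ?thesis .
    qed
    have "(\<Prod>i\<in>UNIV. s i * (1 + \<bar>y $ i\<bar>)\<^sup>2) \<le> (\<Prod>i\<in>(UNIV::'k set). (1 + (limit_exponent y + \<Lambda>0) / J)\<^sup>2)"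
      using le s by (intro prod_mono) (auto simp: less_imp_le)
    also have "\<dots> = (1 + (limit_exponent y + \<Lambda>0) / J) ^ j" by (simp add: j_def power_mult)
    finally have le2: "(\<Prod>i\<in>UNIV. s i * (1 + \<bar>y $ i\<bar>)\<^sup>2) \<le> (1 + (limit_exponent y + \<Lambda>0) / J) ^ j" .
    have "1 / (1 + (limit_exponent y + \<Lambda>0) / J) ^ j \<le> 1 / (\<Prod>i\<in>UNIV. s i * (1 + \<bar>y $ i\<bar>)\<^sup>2)"
    proof (rule frac_le[OF zero_le_one order_refl _ le2])
      show "0 < (\<Prod>i\<in>UNIV. s i * (1 + \<bar>y $ i\<bar>)\<^sup>2)" using s by (intro prod_pos mult_pos_pos ballI) (auto simp: add_pos_nonneg)
    qed
    also have "\<dots> = e * (\<Prod>i\<in>UNIV. 1 / (1 + \<bar>y $ i\<bar>)\<^sup>2)"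
      by (simp add: e_def prod.distrib[symmetric] prod_dividef)
    finally show ?thesis using L0 unfolding J_def by simp
  qed
  show ?thesis
  proof (rule exI[of _ j], rule conjI)
    show "0 < j" by (simp add: j_def)
    have "0 \<le> \<Lambda>0" unfolding \<Lambda>0_def using rate by (intro sum_nonneg) (auto simp: less_imp_le)
    then show "\<exists>e>0. \<exists>\<Lambda>0\<ge>0. \<forall>y\<in>shifted_cone. - \<Lambda>0 \<le> limit_exponent y \<and> 1 / (1 + (limit_exponent y + \<Lambda>0) / (4 * real j)) ^ j \<le> e * (\<Prod>i\<in>UNIV. 1 / (1 + \<bar>y $ i\<bar>)\<^sup>2)"
      using e main by blast
  qed
qed

lemma rel_density_dominated:
  assumes \<eta>: "0 < \<eta>" "\<eta> \<le> 1"
  shows "\<exists>u0 C. \<forall>u\<ge>u0. \<forall>y\<in>shifted_cone. rel_density \<eta> u y \<le> C * (\<Prod>i\<in>UNIV. 1 / (1 + \<bar>y $ i\<bar>)\<^sup>2)"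
proof -
  obtain j e \<Lambda>0 where je: "0 < j" "0 < e" "0 \<le> \<Lambda>0"
    and dom: "\<And>y. y \<in> shifted_cone \<Longrightarrow> - \<Lambda>0 \<le> limit_exponent y \<and> 1 / (1 + (limit_exponent y + \<Lambda>0) / (4 * real j)) ^ j \<le> e * (\<Prod>i\<in>UNIV. 1 / (1 + \<bar>y $ i\<bar>)\<^sup>2)"
    using dominating_product by blast
  obtain u0 C where uC: "\<And>u \<Lambda> \<beta> m g. u \<ge> u0 \<Longrightarrow> m = q * \<delta> * u powr \<delta> \<Longrightarrow> g = sqrt (1 + 2 * \<Lambda> / m + \<beta> / m\<^sup>2) \<Longrightarrow> - \<Lambda>0 \<le> \<Lambda> \<Longrightarrow> 0 \<le> \<beta> \<Longrightarrow>
     (tail_prob (u * (g * exp (- (\<eta> / m)))) - tail_prob (u * g)) / (tail_prob u * (\<eta> * g ^ CARD('k))) \<le> C / (1 + (\<Lambda> + \<Lambda>0) / (4 * real j)) ^ j"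
    using shell_density_bound[OF tail_prob_tail params tail_prob_nonneg \<eta> je(3,1), of "CARD('k)"] by blast
  show ?thesis
  proof (rule exI[of _ u0], rule exI[of _ "\<bar>C\<bar> * e"], intro allI impI ballI)
    fix u y assume u: "u0 \<le> u" and y: "y \<in> shifted_cone"
    let ?r = "1 / (1 + (limit_exponent y + \<Lambda>0) / (4 * real j)) ^ j"
    have "0 \<le> limit_exponent y + \<Lambda>0" using dom[OF y] by linarith
    then have r: "0 \<le> ?r" by simp
    have "rel_density \<eta> u y \<le> C / (1 + (limit_exponent y + \<Lambda>0) / (4 * real j)) ^ j"
      unfolding rel_density_def by (rule uC[OF u]) (use dom[OF y] quad_rest_nonneg in \<open>auto simp: speed_def rel_radius_def\<close>)
    also have "\<dots> = C * ?r" by simp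
    also have "\<dots> \<le> \<bar>C\<bar> * ?r" by (rule mult_right_mono[OF abs_ge_self r])
    also have "\<dots> \<le> \<bar>C\<bar> * (e * (\<Prod>i\<in>UNIV. 1 / (1 + \<bar>y $ i\<bar>)\<^sup>2))" using dom[OF y] by (intro mult_left_mono) auto
    finally show "rel_density \<eta> u y \<le> \<bar>C\<bar> * e * (\<Prod>i\<in>UNIV. 1 / (1 + \<bar>y $ i\<bar>)\<^sup>2)" by (simp add: mult.assoc)
  qed
qed

text \<open>
  Dominated convergence in the local coordinates, stated for functions that vary with \<open>n\<close> because the
  scaled excess of a coordinate outside \<open>I\<close> depends on \<open>n\<close>.
\<close>

lemma smoothed_convergence:
  fixes f :: "nat \<Rightarrow> real ^ 'k \<Rightarrow> real"
  assumes \<eta>: "0 < \<eta>" "\<eta> \<le> 1" and u: "filterlim u at_top sequentially"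
    and f[measurable]: "\<And>n. f n \<in> borel_measurable borel" and f0: "\<And>n x. 0 \<le> f n x" "\<And>n x. f n x \<le> K"
    and supp: "\<forall>\<^sub>F n in sequentially. \<forall>y. y \<notin> shifted_cone \<longrightarrow> f n (scaled_point (u n) y) = 0"
    and \<phi>[measurable]: "\<phi> \<in> borel_measurable borel" and lim: "AE y in lborel. (\<lambda>n. f n (scaled_point (u n) y)) \<longlonglongrightarrow> \<phi> y"
  shows "integrable lborel (\<lambda>y. \<phi> y * exp (- limit_exponent y))"
    and "(\<lambda>n. \<integral>y. f n (scaled_point (u n) y) * rel_density \<eta> (u n) y \<partial>lborel) \<longlonglongrightarrow> (exp \<eta> - 1) / \<eta> * (\<integral>y. \<phi> y * exp (- limit_exponent y) \<partial>lborel)"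
    and "\<forall>\<^sub>F n in sequentially. (\<integral>\<^sup>+ y. ennreal (f n (scaled_point (u n) y)) * ennreal (rel_density \<eta> (u n) y) \<partial>lborel)
        = ennreal (\<integral>y. f n (scaled_point (u n) y) * rel_density \<eta> (u n) y \<partial>lborel)"
proof -
  obtain u0 C where uC: "\<And>u y. u \<ge> u0 \<Longrightarrow> y \<in> shifted_cone \<Longrightarrow> rel_density \<eta> u y \<le> C * (\<Prod>i\<in>UNIV. 1 / (1 + \<bar>y $ i\<bar>)\<^sup>2)"
    using rel_density_dominated[OF \<eta>] by blast
  have K: "0 \<le> K" using f0[of 0 0] by linarith
  define \<kappa> where "\<kappa> = (exp \<eta> - 1) / \<eta>"
  have \<kappa>: "0 < \<kappa>" using \<eta> by (simp add: \<kappa>_def)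
  define w where "w y = K * (\<bar>C\<bar> * (\<Prod>i\<in>UNIV. 1 / (1 + \<bar>y $ i\<bar>)\<^sup>2))" for y :: "real^'k"
  have w: "integrable lborel w" unfolding w_def
    by (intro integrable_mult_right integrable_prod_inverse_square)
  have w0: "0 \<le> w y" for y unfolding w_def using K by (intro mult_nonneg_nonneg prod_nonneg) auto
  have ev: "\<forall>\<^sub>F n in sequentially. max 1 u0 \<le> u n \<and> (\<forall>y. y \<notin> shifted_cone \<longrightarrow> f n (scaled_point (u n) y) = 0)"
    using supp filterlim_at_top[THEN iffD1, OF u, rule_format, of "max 1 u0"] by eventually_elim auto
  then obtain n0 where n0: "\<And>n. n \<ge> n0 \<Longrightarrow> max 1 u0 \<le> u n" "\<And>n y. n \<ge> n0 \<Longrightarrow> y \<notin> shifted_cone \<Longrightarrow> f n (scaled_point (u n) y) = 0"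
    unfolding eventually_sequentially by blast
  \<comment> \<open>The sequence is shifted by n0, because the bound and the support condition hold only from n0 on.\<close>
  define s where "s n y = f (n + n0) (scaled_point (u (n + n0)) y) * rel_density \<eta> (u (n + n0)) y" for n y
  have bound: "0 \<le> s n y \<and> s n y \<le> w y" for n y
  proof -
    have un: "max 1 u0 \<le> u (n + n0)" by (rule n0) simp
    have h0: "0 \<le> rel_density \<eta> (u (n + n0)) y" by (rule rel_density_nonneg[OF \<eta>(1)]) (use un in auto)
    have s0: "0 \<le> s n y" unfolding s_def using h0 f0 by simp
    show ?thesis
    proof (cases "y \<in> shifted_cone")
      case True
      have "rel_density \<eta> (u (n + n0)) y \<le> \<bar>C\<bar> * (\<Prod>i\<in>UNIV. 1 / (1 + \<bar>y $ i\<bar>)\<^sup>2)"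
        by (rule order_trans[OF uC[OF _ True]]) (use un in \<open>auto intro!: mult_right_mono prod_nonneg\<close>)
      then have "s n y \<le> w y" unfolding s_def w_def using f0 h0 K by (intro mult_mono) auto
      then show ?thesis using s0 by simp
    next
      case False
      then show ?thesis using n0(2)[of "n + n0" y] w0 unfolding s_def by simp
    qed
  qed
  have AE: "AE y in lborel. (\<lambda>n. s n y) \<longlonglongrightarrow> \<phi> y * (\<kappa> * exp (- limit_exponent y))"
    using lim
  proof eventually_elim
    case (elim y)
    have "(\<lambda>n. f n (scaled_point (u n) y) * rel_density \<eta> (u n) y) \<longlonglongrightarrow> \<phi> y * (\<kappa> * exp (- limit_exponent y))"
      unfolding \<kappa>_def by (intro tendsto_mult elim rel_density_tendsto u)
    then show ?case unfolding s_def by (rule LIMSEQ_ignore_initial_segment)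
  qed
  have sm: "s n \<in> borel_measurable lborel" for n unfolding s_def by measurable
  have bnd: "AE y in lborel. norm (s n y) \<le> w y" for n using bound[of n] by simp
  have lm: "(\<lambda>y. \<phi> y * (\<kappa> * exp (- limit_exponent y))) \<in> borel_measurable lborel" by measurable
  note dc = lm sm w AE bnd
  have int: "integrable lborel (\<lambda>y. \<phi> y * (\<kappa> * exp (- limit_exponent y)))" by (rule integrable_dominated_convergence[OF dc])
  then have "integrable lborel (\<lambda>y. (1 / \<kappa>) * (\<phi> y * (\<kappa> * exp (- limit_exponent y))))" by (rule integrable_mult_right)
  then show "integrable lborel (\<lambda>y. \<phi> y * exp (- limit_exponent y))" using \<kappa> by (simp add: field_simps)
  have "(\<lambda>n. \<integral>y. s n y \<partial>lborel) \<longlonglongrightarrow> (\<integral>y. \<phi> y * (\<kappa> * exp (- limit_exponent y)) \<partial>lborel)"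
    by (rule integral_dominated_convergence[OF dc])
  also have "(\<integral>y. \<phi> y * (\<kappa> * exp (- limit_exponent y)) \<partial>lborel) = (\<integral>y. \<kappa> * (\<phi> y * exp (- limit_exponent y)) \<partial>lborel)" by (simp add: ac_simps)
  also have "\<dots> = \<kappa> * (\<integral>y. \<phi> y * exp (- limit_exponent y) \<partial>lborel)" by simp
  finally show "(\<lambda>n. \<integral>y. f n (scaled_point (u n) y) * rel_density \<eta> (u n) y \<partial>lborel) \<longlonglongrightarrow> (exp \<eta> - 1) / \<eta> * (\<integral>y. \<phi> y * exp (- limit_exponent y) \<partial>lborel)"
    unfolding s_def \<kappa>_def by (rule LIMSEQ_offset)
  have ints: "integrable lborel (s n)" for n 
  proof (rule Bochner_Integration.integrable_bound[OF w sm], rule AE_I2)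
    show "norm (s n y) \<le> norm (w y)" for y using bound[of n y] by simp
  qed
  show "\<forall>\<^sub>F n in sequentially. (\<integral>\<^sup>+ y. ennreal (f n (scaled_point (u n) y)) * ennreal (rel_density \<eta> (u n) y) \<partial>lborel)
        = ennreal (\<integral>y. f n (scaled_point (u n) y) * rel_density \<eta> (u n) y \<partial>lborel)"
    unfolding eventually_sequentially
  proof (intro exI[of _ n0] allI impI)
    fix n assume "n0 \<le> n"
    then have n: "n = (n - n0) + n0" by simp
    have "(\<integral>\<^sup>+ y. ennreal (s (n - n0) y) \<partial>lborel) = ennreal (\<integral>y. s (n - n0) y \<partial>lborel)"
      using bound by (intro nn_integral_eq_integral ints) auto
    then show "(\<integral>\<^sup>+ y. ennreal (f n (scaled_point (u n) y)) * ennreal (rel_density \<eta> (u n) y) \<partial>lborel)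
        = ennreal (\<integral>y. f n (scaled_point (u n) y) * rel_density \<eta> (u n) y \<partial>lborel)"
      unfolding s_def n[symmetric] using f0 by (simp add: ennreal_mult')
  qed
qed

end

section \<open>Test functions on extended real vectors\<close>

text \<open>
  The inverse of the homeomorphism \<open>r / (1 + |r|)\<close> from the extended real line to \<open>[- 1, 1]\<close>, continued by
  constants.
\<close>

definition unsquash :: "real \<Rightarrow> ereal" where
  "unsquash c = (if c \<le> - 1 then - \<infinity> else if 1 \<le> c then \<infinity> else ereal (c / (1 - \<bar>c\<bar>)))"

lemma unsquash_squash: "unsquash (r / (1 + \<bar>r\<bar>)) = ereal r"
proof -
  define c where "c = r / (1 + \<bar>r\<bar>)"
  have "\<bar>c\<bar> < 1" unfolding c_def by (simp add: abs_divide)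
  then have "\<not> c \<le> - 1" "\<not> 1 \<le> c" by auto
  moreover have "c / (1 - \<bar>c\<bar>) = r" unfolding c_def by (simp add: abs_divide field_simps)
  ultimately show ?thesis unfolding c_def[symmetric] unsquash_def by simp
qed

lemma continuous_unsquash: "continuous_on UNIV unsquash"
proof (rule continuous_onI_mono)
  have "range unsquash = UNIV"
  proof (intro set_eqI iffI UNIV_I)
    fix x :: ereal
    show "x \<in> range unsquash"
    proof (cases x)
      case (real r)
      then show ?thesis using unsquash_squash[of r] by (metis rangeI)
    next
      case PInf
      then show ?thesis by (intro image_eqI[of _ _ 1]) (auto simp: unsquash_def)
    next
      case MInf
      then show ?thesis by (intro image_eqI[of _ _ "-1"]) (auto simp: unsquash_def)
    qed
  qed
  then show "open (range unsquash)" by simp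
  have mono: "c / (1 - \<bar>c\<bar>) \<le> d / (1 - \<bar>d\<bar>)" if cd: "- 1 < c" "c \<le> d" "d < 1" for c d :: real
  proof -
    have pos: "0 < 1 - \<bar>c\<bar>" "0 < 1 - \<bar>d\<bar>" using cd by auto
    have "c * (1 - \<bar>d\<bar>) \<le> d * (1 - \<bar>c\<bar>)"
    proof (cases "0 \<le> c \<or> d \<le> 0")
      case True
      then show ?thesis using cd by (auto simp: algebra_simps)
    next
      case False
      then have "c * (1 - \<bar>d\<bar>) \<le> 0" "0 \<le> d * (1 - \<bar>c\<bar>)" using pos by (auto simp: mult_nonpos_nonneg)
      then show ?thesis by linarith
    qed
    then show ?thesis using pos by (simp add: divide_le_eq pos_le_divide_eq mult.commute)
  qed
  show "unsquash c \<le> unsquash d" if "c \<le> d" for c d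
    using mono[of c d] that by (auto simp: unsquash_def)
qed

text \<open>
  For arguments of the same sign the mixed terms cancel; for opposite signs the distance is the sum of
  the absolute values.
\<close>

lemma squash_contraction: "\<bar>r / (1 + \<bar>r\<bar>) - s / (1 + \<bar>s\<bar>)\<bar> \<le> \<bar>r - s\<bar>" for r s :: real
proof -
  have pos: "0 < 1 + \<bar>r\<bar>" "0 < 1 + \<bar>s\<bar>" by auto
  have "r / (1 + \<bar>r\<bar>) - s / (1 + \<bar>s\<bar>) = (r * (1 + \<bar>s\<bar>) - s * (1 + \<bar>r\<bar>)) / ((1 + \<bar>r\<bar>) * (1 + \<bar>s\<bar>))"
    using pos by (subst diff_frac_eq) auto
  then have eq: "\<bar>r / (1 + \<bar>r\<bar>) - s / (1 + \<bar>s\<bar>)\<bar> = \<bar>r * (1 + \<bar>s\<bar>) - s * (1 + \<bar>r\<bar>)\<bar> / ((1 + \<bar>r\<bar>) * (1 + \<bar>s\<bar>))"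
    using pos by (simp add: abs_divide abs_mult)
  have "\<bar>r * (1 + \<bar>s\<bar>) - s * (1 + \<bar>r\<bar>)\<bar> = \<bar>(r - s) + (r * \<bar>s\<bar> - s * \<bar>r\<bar>)\<bar>" by (simp add: algebra_simps)
  also have "\<dots> \<le> \<bar>r - s\<bar> + \<bar>r * \<bar>s\<bar> - s * \<bar>r\<bar>\<bar>" by (rule abs_triangle_ineq)
  also have "\<bar>r * \<bar>s\<bar> - s * \<bar>r\<bar>\<bar> \<le> \<bar>r - s\<bar> * (\<bar>r\<bar> + \<bar>s\<bar>)"
  proof (cases "0 \<le> r * s")
    case True
    then have "r * \<bar>s\<bar> - s * \<bar>r\<bar> = 0" by (auto simp: abs_if zero_le_mult_iff)
    then show ?thesis by simp
  next
    case False
    then have eq: "r * \<bar>s\<bar> - s * \<bar>r\<bar> = 2 * r * \<bar>s\<bar>" and ab: "\<bar>r - s\<bar> = \<bar>r\<bar> + \<bar>s\<bar>"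
      by (auto simp: abs_if zero_le_mult_iff)
    have "2 * \<bar>r\<bar> * \<bar>s\<bar> \<le> (\<bar>r\<bar> + \<bar>s\<bar>) * (\<bar>r\<bar> + \<bar>s\<bar>)"
      using zero_le_power2[of "\<bar>r\<bar>"] zero_le_power2[of "\<bar>s\<bar>"] by (simp add: power2_eq_square algebra_simps)
    then show ?thesis unfolding eq ab by (simp add: abs_mult)
  qed
  finally have "\<bar>r * (1 + \<bar>s\<bar>) - s * (1 + \<bar>r\<bar>)\<bar> \<le> \<bar>r - s\<bar> * (1 + \<bar>r\<bar> + \<bar>s\<bar>)" by (simp add: algebra_simps)
  also have "\<dots> \<le> \<bar>r - s\<bar> * ((1 + \<bar>r\<bar>) * (1 + \<bar>s\<bar>))" by (intro mult_left_mono) (auto simp: algebra_simps)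
  finally show ?thesis unfolding eq using pos by (simp add: divide_le_eq)
qed

text \<open>
  The cube is a compact model of the space of extended real vectors, and the embedding of finite vectors
  into the cube is a contraction in each coordinate.
\<close>

lemma continuous_ereal_fun_uniformly_continuous:
  fixes F :: "('k::finite \<Rightarrow> ereal) \<Rightarrow> real"
  assumes F: "continuous_on UNIV F" and e: "0 < e"
  shows "\<exists>d>0. \<forall>x y :: 'k \<Rightarrow> real. (\<forall>i. \<bar>x i - y i\<bar> \<le> d) \<longrightarrow> \<bar>F (\<lambda>i. ereal (x i)) - F (\<lambda>i. ereal (y i))\<bar> < e"
proof -
  define G :: "real ^ 'k \<Rightarrow> real" where "G c = F (\<lambda>i. unsquash (c $ i))" for c
  have "continuous_on UNIV (\<lambda>c :: real ^ 'k. (\<lambda>i. unsquash (c $ i)))"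
    by (intro continuous_on_coordinatewise_then_product continuous_on_compose2[OF continuous_unsquash]) (auto intro!: continuous_intros)
  then have "continuous_on UNIV G" unfolding G_def by (rule continuous_on_compose2[OF F]) auto
  then have "continuous_on (cbox (-1) 1) G" by (rule continuous_on_subset) simp
  then have "uniformly_continuous_on (cbox (-1) 1) G" by (intro compact_uniformly_continuous compact_cbox)
  then obtain d where d: "0 < d" "\<And>c c'. c \<in> cbox (-1) 1 \<Longrightarrow> c' \<in> cbox (-1) 1 \<Longrightarrow> dist c' c < d \<Longrightarrow> dist (G c') (G c) < e"
    unfolding uniformly_continuous_on_def using e by metis
  define d' where "d' = d / (2 * CARD('k))"
  have d': "0 < d'" using d by (simp add: d'_def)
  show ?thesis
  proof (intro exI[of _ d'] conjI allI impI d')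
    fix x y :: "'k \<Rightarrow> real" assume xy: "\<forall>i. \<bar>x i - y i\<bar> \<le> d'"
    define sq where "sq z = (\<chi> i. z i / (1 + \<bar>z i\<bar>) :: real ^ 'k)" for z :: "'k \<Rightarrow> real"
    have G: "G (sq z) = F (\<lambda>i. ereal (z i))" for z unfolding G_def sq_def by (simp add: unsquash_squash)
    have box: "sq z \<in> cbox (-1) 1" for z
    proof -
      have "\<bar>z i / (1 + \<bar>z i\<bar>)\<bar> \<le> 1" for i by (simp add: abs_divide)
      then have "- 1 \<le> z i / (1 + \<bar>z i\<bar>)" "z i / (1 + \<bar>z i\<bar>) \<le> 1" for i by (meson abs_le_iff minus_le_iff)+
      then show ?thesis unfolding mem_box_cart sq_def by simp
    qed
    have "dist (sq x) (sq y) \<le> (\<Sum>i\<in>UNIV. \<bar>(sq x - sq y) $ i\<bar>)" unfolding dist_norm by (rule norm_le_l1_cart)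
    also have "\<dots> \<le> (\<Sum>i\<in>(UNIV::'k set). d')"
      using xy squash_contraction by (intro sum_mono) (auto simp: sq_def intro: order_trans)
    also have "\<dots> < d" using d by (simp add: d'_def)
    finally have "dist (G (sq x)) (G (sq y)) < e" by (intro d(2) box)
    then show "\<bar>F (\<lambda>i. ereal (x i)) - F (\<lambda>i. ereal (y i))\<bar> < e" by (simp add: G dist_real_def)
  qed
qed

lemma tendsto_fun_coordinatewise:
  fixes f :: "'a \<Rightarrow> 'k \<Rightarrow> 'b::topological_space"
  assumes "\<And>i. ((\<lambda>n. f n i) \<longlongrightarrow> l i) G"
  shows "(f \<longlongrightarrow> l) G"
proof -
  have "limitin (product_topology (\<lambda>i. euclidean) UNIV) f l G"
    using assms by (subst limitin_componentwise) auto
  then show ?thesis by (simp add: euclidean_product_topology)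
qed

lemma AE_lborel_vec_coord: "AE y in (lborel :: (real ^ 'k::finite) measure). y $ i \<noteq> c"
proof -
  have "{y :: real ^ 'k. y $ i \<noteq> c} \<in> sets borel" by measurable
  then show ?thesis
    using AE_PiM_component_lborel[of i UNIV c]
    by (subst lborel_vec_eq_distr_PiM[symmetric], subst AE_distr_iff) auto
qed

lemma AE_lborel_vec_coords:
  assumes "finite C"
  shows "AE y in (lborel :: (real ^ 'k::finite) measure). \<forall>i. \<forall>c\<in>C. y $ i \<noteq> c"
proof -
  have "AE y in (lborel :: (real ^ 'k) measure). \<forall>i\<in>UNIV. \<forall>c\<in>C. y $ i \<noteq> c"
    using assms by (intro AE_finite_allI AE_lborel_vec_coord) auto
  then show ?thesis by simp
qed

section \<open>Removing the smoothing\<close>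

text \<open>
  The normalised threshold \<open>a'\<close> lies below the minimiser and agrees with it on \<open>I\<close>.
\<close>

locale kotz_threshold = kotz A S I b M R U \<delta> p q N
  for A S :: "real ^ 'k ^ 'k::finite" and I :: "'k set" and b :: "real ^ 'k"
    and M :: "'m measure" and R :: "'m \<Rightarrow> real" and U :: "'m \<Rightarrow> real ^ 'k" and \<delta> p q N :: real +
  fixes a' :: "real ^ 'k"
  assumes a'_I: "\<And>i. i \<in> I \<Longrightarrow> a' $ i = b $ i" and a'_le: "\<And>i. a' $ i \<le> b $ i"
begin

text \<open>
  \<open>T\<close> is the set of tied indices. \<open>norming\<close> is the norming vector of the theorem in terms of \<open>u\<close>, and
  \<open>scaled_excess\<close> is the normalised exceedance over the threshold \<open>u * a'\<close>.
\<close>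

definition T :: "'k set" where "T = {j. j \<notin> I \<and> a' $ j = b $ j}"
definition norming :: "real \<Rightarrow> 'k \<Rightarrow> real" where "norming u i = (if i \<in> I then speed u / u else sqrt (speed u) / u)"
definition scaled_excess :: "real \<Rightarrow> real ^ 'k \<Rightarrow> 'k \<Rightarrow> real" where "scaled_excess u x i = norming u i * (x $ i - u * a' $ i)"
definition limit_excess :: "real ^ 'k \<Rightarrow> 'k \<Rightarrow> ereal" where "limit_excess y i = (if i \<in> I \<union> T then ereal (y $ i) else \<infinity>)"

lemma speed_pos: "0 < u \<Longrightarrow> 0 < speed u" unfolding speed_def using params by simp

lemma speed_at_top: "filterlim speed at_top at_top"
  unfolding speed_def[abs_def] using params by real_asymp

lemma elliptical_rv_measurable[measurable]: "elliptical_rv \<in> borel_measurable M" unfolding elliptical_rv_def by measurable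

lemma scaled_excess_measurable[measurable]: "(\<lambda>x. scaled_excess u x i) \<in> borel_measurable borel" unfolding scaled_excess_def by measurable

lemma scaled_excess_scaled_point_I:
  assumes u: "0 < u" and i: "i \<in> I"
  shows "scaled_excess u (scaled_point u y) i = y $ i"
proof -
  have "displacement (speed u) y $ i = subvec (displacement (speed u) y) I $ i" using i by (simp add: subvec_def)
  also have "\<dots> = y $ i / speed u" unfolding displacement_I using i by (simp add: subvec_def)
  finally show ?thesis unfolding scaled_excess_def scaled_point_def norming_def using i u speed_pos[OF u] a'_I[OF i] by (simp add: field_simps)
qed

lemma scaled_excess_scaled_point_J:
  assumes u: "0 < u" and i: "i \<notin> I"
  shows "scaled_excess u (scaled_point u y) i = sqrt (speed u) * (b $ i - a' $ i) + y $ i + (submat S (- I) I *v (B *v subvec y I)) $ i / sqrt (speed u)"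
proof -
  let ?r = "(submat S (- I) I *v (B *v subvec y I)) $ i"
  have "displacement (speed u) y $ i = subvec (displacement (speed u) y) (- I) $ i" using i by (simp add: subvec_def)
  also have "\<dots> = y $ i / sqrt (speed u) + ?r / speed u" unfolding displacement_J using i by (simp add: subvec_def)
  finally have d: "displacement (speed u) y $ i = y $ i / sqrt (speed u) + ?r / speed u" .
  define s where "s = sqrt (speed u)"
  have s: "0 < s" "speed u = s * s" using speed_pos[OF u] by (simp_all add: s_def)
  have d': "displacement (speed u) y $ i = y $ i / s + ?r / (s * s)"
    using d unfolding s_def[symmetric] by (simp only: s(2)[symmetric])
  have "scaled_excess u (scaled_point u y) i = s * (b $ i + displacement (speed u) y $ i - a' $ i)"
    unfolding scaled_excess_def scaled_point_def norming_def s_def[symmetric] using i u by (simp add: field_simps)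
  also have "\<dots> = s * (b $ i - a' $ i) + y $ i + ?r / s" unfolding d' using s(1) by (simp add: field_simps)
  finally show ?thesis unfolding s_def .
qed

text \<open>
  A gap between minimiser and threshold is multiplied by the square root of \<open>speed\<close>, so an untied
  coordinate tends to infinity. The regression term of order \<open>1 / sqrt (speed u)\<close> disappears.
\<close>

lemma scaled_excess_tendsto:
  assumes u: "filterlim u at_top sequentially"
  shows "i \<in> I \<union> T \<Longrightarrow> (\<lambda>n. scaled_excess (u n) (scaled_point (u n) y) i) \<longlonglongrightarrow> y $ i"
    and "i \<notin> I \<union> T \<Longrightarrow> filterlim (\<lambda>n. scaled_excess (u n) (scaled_point (u n) y) i) at_top sequentially"
proof -
  let ?r = "(submat S (- I) I *v (B *v subvec y I)) $ i"
  have u0: "\<forall>\<^sub>F n in sequentially. 0 < u n"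
    using filterlim_at_top_dense[THEN iffD1, OF u, rule_format, of 0] .
  have sq: "filterlim (\<lambda>n. sqrt (speed (u n))) at_top sequentially"
    using filterlim_compose[OF sqrt_at_top filterlim_compose[OF speed_at_top u]] .
  have J: "\<forall>\<^sub>F n in sequentially. sqrt (speed (u n)) * (b $ i - a' $ i) + y $ i + ?r / sqrt (speed (u n)) = scaled_excess (u n) (scaled_point (u n) y) i" if "i \<notin> I"
    using u0 by eventually_elim (simp add: scaled_excess_scaled_point_J that)
  have r0: "(\<lambda>n. ?r / sqrt (speed (u n))) \<longlonglongrightarrow> 0"
    by (rule tendsto_divide_0[OF tendsto_const filterlim_at_top_imp_at_infinity[OF sq]])
  show "(\<lambda>n. scaled_excess (u n) (scaled_point (u n) y) i) \<longlonglongrightarrow> y $ i" if "i \<in> I \<union> T"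
  proof (cases "i \<in> I")
    case True
    have "\<forall>\<^sub>F n in sequentially. y $ i = scaled_excess (u n) (scaled_point (u n) y) i"
      using u0 by eventually_elim (simp add: scaled_excess_scaled_point_I True)
    then show ?thesis by (rule Lim_transform_eventually[OF tendsto_const])
  next
    case False
    then have "b $ i - a' $ i = 0" using that by (simp add: T_def)
    then have "(\<lambda>n. sqrt (speed (u n)) * (b $ i - a' $ i) + y $ i + ?r / sqrt (speed (u n))) \<longlonglongrightarrow> 0 + y $ i + 0"
      by (intro tendsto_add r0 tendsto_const) simp
    then show ?thesis using Lim_transform_eventually[OF _ J[OF False]] by simp
  qed
  show "filterlim (\<lambda>n. scaled_excess (u n) (scaled_point (u n) y) i) at_top sequentially" if "i \<notin> I \<union> T"
  proof -
    have i: "i \<notin> I" and pos: "0 < b $ i - a' $ i" using that a'_le[of i] by (auto simp: T_def)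
    have "filterlim (\<lambda>n. (b $ i - a' $ i) * sqrt (speed (u n))) at_top sequentially"
      by (rule filterlim_tendsto_pos_mult_at_top[OF tendsto_const pos sq])
    from filterlim_tendsto_add_at_top[OF tendsto_add[OF tendsto_const[of "y $ i"] r0] this]
    have "filterlim (\<lambda>n. sqrt (speed (u n)) * (b $ i - a' $ i) + y $ i + ?r / sqrt (speed (u n))) at_top sequentially"
      by (simp add: ac_simps)
    then show ?thesis using filterlim_cong[OF refl refl J[OF i]] by simp
  qed
qed

lemma scaled_excess_threshold:
  assumes u: "filterlim u at_top sequentially" and y: "\<And>i. i \<in> I \<union> T \<Longrightarrow> y $ i \<noteq> r"
  shows "\<forall>\<^sub>F n in sequentially. (\<forall>i. r < scaled_excess (u n) (scaled_point (u n) y) i) = (\<forall>i\<in>I \<union> T. r < y $ i)"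
proof (cases "\<forall>i\<in>I \<union> T. r < y $ i")
  case True
  have "\<forall>\<^sub>F n in sequentially. \<forall>i. r < scaled_excess (u n) (scaled_point (u n) y) i"
  proof (rule eventually_all_finite)
    fix i
    show "\<forall>\<^sub>F n in sequentially. r < scaled_excess (u n) (scaled_point (u n) y) i"
    proof (cases "i \<in> I \<union> T")
      case i: True
      then show ?thesis using order_tendstoD(1)[OF scaled_excess_tendsto(1)[OF u i, of y]] True by auto
    next
      case False
      then show ?thesis using filterlim_at_top_dense[THEN iffD1, OF scaled_excess_tendsto(2)[OF u False, of y]] by auto
    qed
  qed
  then show ?thesis by eventually_elim (use True in auto)
next
  case False
  then obtain i where i: "i \<in> I \<union> T" "y $ i < r" using y by (metis linorder_neqE_linordered_idom)
  have "\<forall>\<^sub>F n in sequentially. scaled_excess (u n) (scaled_point (u n) y) i < r"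
    using order_tendstoD(2)[OF scaled_excess_tendsto(1)[OF u i(1), of y]] i(2) by auto
  then show ?thesis
  proof eventually_elim
    case (elim n)
    then have "\<not> (\<forall>i. r < scaled_excess (u n) (scaled_point (u n) y) i)" by (meson not_less_iff_gr_or_eq)
    then show ?case using False by blast
  qed
qed

definition excess_test :: "(('k \<Rightarrow> ereal) \<Rightarrow> real) \<Rightarrow> real \<Rightarrow> real ^ 'k \<Rightarrow> real" where
  "excess_test F u x = F (\<lambda>i. ereal (scaled_excess u x i)) * of_bool (\<forall>i. 0 < scaled_excess u x i)"

text \<open>
  A bound for the coordinates of \<open>b\<close> with a margin of 1. Points with larger relative coordinates are
  irrelevant in the limit.
\<close>

definition c0 :: real where "c0 = 1 + (\<Sum>i\<in>UNIV. \<bar>b $ i\<bar>)"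

text \<open>
  The three terms pay for the oscillation of the test function, for a change of the orthant indicator
  within distance \<open>\<theta>\<close> of its boundary, and for points far from the minimiser.
\<close>

definition scaling_error :: "real \<Rightarrow> real \<Rightarrow> real \<Rightarrow> real \<Rightarrow> real ^ 'k \<Rightarrow> real" where
  "scaling_error \<epsilon> K \<theta> u x = of_bool (\<forall>i\<in>I. - 1 < scaled_excess u x i) *
     (\<epsilon> + K * of_bool ((\<forall>i. - \<theta> < scaled_excess u x i) \<and> \<not> (\<forall>i. \<theta> < scaled_excess u x i)) + K * of_bool (\<exists>i. c0 * u < \<bar>x $ i\<bar>))"

lemma b_c0: "\<bar>b $ i\<bar> + 1 \<le> c0"
  unfolding c0_def using member_le_sum[of i UNIV "\<lambda>i. \<bar>b $ i\<bar>"] by simp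

text \<open>
  The error is a function of the dilated point only, and so it can be integrated with the density of the
  smoothed vector.
\<close>

lemma excess_test_scaling_error:
  assumes u: "0 < u" and m: "1 \<le> speed u" and \<eta>: "0 < \<eta>" "\<eta> \<le> 1" and \<theta>: "\<theta> = \<eta> * c0" "\<theta> < 1/2"
    and l: "1 \<le> l" "l < exp (\<eta> / speed u)"
    and F: "\<And>w. 0 \<le> F w" "\<And>w. F w \<le> K"
    and unif: "\<And>x y :: 'k \<Rightarrow> real. (\<And>i. \<bar>x i - y i\<bar> \<le> \<theta>) \<Longrightarrow> \<bar>F (\<lambda>i. ereal (x i)) - F (\<lambda>i. ereal (y i))\<bar> \<le> \<epsilon>" and \<epsilon>: "0 \<le> \<epsilon>"
  shows "\<bar>excess_test F u x - excess_test F u (l *\<^sub>R x)\<bar> \<le> scaling_error \<epsilon> K \<theta> u (l *\<^sub>R x)"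
proof -
  define h where "h = \<eta> / speed u"
  have h: "0 < h" "h \<le> 1" "h * speed u = \<eta>" using \<eta> m by (auto simp: h_def divide_le_eq)
  let ?x = "l *\<^sub>R x"
  let ?Q = "\<lambda>i. scaled_excess u x i" and ?Q' = "\<lambda>i. scaled_excess u ?x i"
  have c0: "1 \<le> c0" using b_c0[of undefined] by linarith
  have \<theta>0: "0 < \<theta>" using \<eta> c0 \<theta> by simp
  have K: "0 \<le> K" using F(1)[of undefined] F(2)[of undefined] by linarith
  have Phi01: "0 \<le> excess_test F u z" "excess_test F u z \<le> K" for z unfolding excess_test_def using F K by auto
  have Err0: "0 \<le> scaling_error \<epsilon> K \<theta> u ?x" unfolding scaling_error_def using K \<epsilon> by simp
  show ?thesis
  proof (cases "(\<forall>i. 0 < ?Q i) \<or> (\<forall>i. 0 < ?Q' i)")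
    case False
    then have "excess_test F u x = 0" "excess_test F u ?x = 0" unfolding excess_test_def by auto
    then show ?thesis using Err0 by simp
  next
    case True
    \<comment> \<open>A positive excess on I stays above -1: dilation multiplies it by l and adds a term of order \<eta>.\<close>
    have Y: "\<forall>i\<in>I. - 1 < ?Q' i"
    proof
      fix i assume i: "i \<in> I"
      show "- 1 < ?Q' i"
      proof (cases "0 < ?Q' i")
        case False
        then have "0 < ?Q i" using True by blast
        then have xi: "u * b $ i < x $ i"
          unfolding scaled_excess_def norming_def using i u m a'_I[OF i] by (simp add: zero_less_mult_iff zero_less_divide_iff)
        have "l - 1 \<le> exp h - 1" using l h_def by simp
        also have "\<dots> \<le> 2 * h"
        proof -
          have "exp h \<le> 1 + h + h\<^sup>2" using h by (intro exp_bound) auto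
          also have "h\<^sup>2 \<le> h" using h by (simp add: power2_eq_square mult_left_le)
          finally show ?thesis by simp
        qed
        finally have l1: "l - 1 \<le> 2 * h" .
        have "l * (u * b $ i) \<le> l * x $ i" using xi l by (intro mult_left_mono) auto
        then have "speed u / u * ((l - 1) * u * b $ i) \<le> speed u / u * (l * x $ i - u * b $ i)"
          using u m by (intro mult_left_mono) (auto simp: algebra_simps)
        also have "\<dots> = ?Q' i" unfolding scaled_excess_def norming_def using i a'_I[OF i] by simp
        finally have le: "speed u * ((l - 1) * b $ i) \<le> ?Q' i" using u by simp
        have "\<bar>speed u * ((l - 1) * b $ i)\<bar> = speed u * (l - 1) * \<bar>b $ i\<bar>" using l m by (simp add: abs_mult)
        also have "\<dots> \<le> speed u * (2 * h) * c0" using l1 m l h b_c0[of i] by (intro mult_mono) auto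
        also have "\<dots> = 2 * \<theta>" using h \<theta> by (simp add: ac_simps)
        finally show ?thesis using le \<theta> by linarith
      qed simp
    qed
    show ?thesis
    proof (cases "\<exists>i. c0 * u < \<bar>?x $ i\<bar>")
      case big: True
      have "\<bar>excess_test F u x - excess_test F u ?x\<bar> \<le> K" using Phi01[of x] Phi01[of ?x] by (simp add: abs_le_iff)
      also have "\<dots> \<le> scaling_error \<epsilon> K \<theta> u ?x" unfolding scaling_error_def using Y big K \<epsilon> by simp
      finally show ?thesis .
    next
      case False
      \<comment> \<open>For bounded relative position the dilation moves every scaled coordinate by at most \<eta> * c0.\<close>
      have close: "\<bar>?Q i - ?Q' i\<bar> \<le> \<theta>" for i
      proof -
        have xi: "\<bar>?x $ i\<bar> \<le> c0 * u" using False by (meson not_less)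
        have "sqrt (speed u) \<le> speed u" using m by (intro real_le_lsqrt) (auto simp: power2_eq_square)
        then have v: "0 \<le> norming u i" "norming u i \<le> speed u / u" unfolding norming_def using u m by (auto intro: divide_right_mono)
        have "exp (- h) \<ge> 1 - h" using exp_ge_add_one_self[of "- h"] by simp
        moreover have "exp (- h) \<le> 1 / l" using l h_def by (simp add: exp_minus inverse_eq_divide frac_le)
        ultimately have l1: "1 - 1 / l \<le> h" by linarith
        have l2: "0 \<le> 1 - 1 / l" using l by simp
        have eq: "?Q' i - ?Q i = norming u i * ((1 - 1 / l) * ?x $ i)" unfolding scaled_excess_def using l by (simp add: field_simps)
        have "\<bar>?Q i - ?Q' i\<bar> = \<bar>?Q' i - ?Q i\<bar>" by (rule abs_minus_commute)
        also have "\<dots> = norming u i * ((1 - 1 / l) * \<bar>?x $ i\<bar>)"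
          by (simp only: eq abs_mult abs_of_nonneg[OF v(1)] abs_of_nonneg[OF l2])
        also have "\<dots> \<le> speed u / u * (h * (c0 * u))" using v l l1 xi h u m by (intro mult_mono) auto
        also have "\<dots> = \<theta>" using u h \<theta> by (simp add: ac_simps)
        finally show ?thesis .
      qed
      show ?thesis
      proof (cases "(\<forall>i. 0 < ?Q i) \<and> (\<forall>i. 0 < ?Q' i)")
        case both: True
        have "\<bar>excess_test F u x - excess_test F u ?x\<bar> \<le> \<epsilon>" unfolding excess_test_def using both unif[of ?Q ?Q', OF close] by simp
        also have "\<dots> \<le> scaling_error \<epsilon> K \<theta> u ?x" unfolding scaling_error_def using Y K by simp
        finally show ?thesis .
      next
        case one: False
        have near: "- \<theta> < ?Q' i" for i using close[of i] True \<theta>0 by (smt (verit))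
        have "\<not> (\<forall>i. \<theta> < ?Q' i)"
        proof
          assume all: "\<forall>i. \<theta> < ?Q' i"
          then have "0 < ?Q' i \<and> 0 < ?Q i" for i using close[of i] \<theta>0 by (smt (verit))
          then show False using one by blast
        qed
        then have "K \<le> scaling_error \<epsilon> K \<theta> u ?x" unfolding scaling_error_def using Y K \<epsilon> near by simp
        moreover have "\<bar>excess_test F u x - excess_test F u ?x\<bar> \<le> K" using Phi01[of x] Phi01[of ?x] by (simp add: abs_le_iff)
        ultimately show ?thesis by linarith
      qed
    qed
  qed
qed

end

section \<open>Convergence of conditional expectations\<close>

lemma exp_minus_one_bound:
  assumes "0 < \<eta>" "\<eta> \<le> (1::real)"
  shows "1 \<le> (exp \<eta> - 1) / \<eta>" "(exp \<eta> - 1) / \<eta> \<le> 1 + \<eta>"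
proof -
  have "\<eta> \<le> exp \<eta> - 1" using exp_ge_add_one_self[of \<eta>] by linarith
  then show "1 \<le> (exp \<eta> - 1) / \<eta>" using assms by (simp only: le_divide_eq) simp
  have "exp \<eta> \<le> 1 + \<eta> + \<eta>\<^sup>2" using assms by (intro exp_bound) auto
  then show "(exp \<eta> - 1) / \<eta> \<le> 1 + \<eta>" using assms by (simp add: divide_le_eq power2_eq_square algebra_simps)
qed

context kotz_threshold
begin

lemma excess_test_measurable:
  assumes [measurable]: "F \<in> borel_measurable borel"
  shows "excess_test F u \<in> borel_measurable borel"
proof -
  have [measurable]: "(\<lambda>x. (\<lambda>i. ereal (scaled_excess u x i))) \<in> borel_measurable borel"
    by (rule borel_measurable_funI) measurable
  show ?thesis unfolding excess_test_def by measurable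
qed

lemma scaling_error_measurable[measurable]: "scaling_error \<epsilon> K \<theta> u \<in> borel_measurable borel"
  unfolding scaling_error_def by measurable

lemma limit_excess_measurable[measurable]: "limit_excess \<in> borel_measurable borel"
proof (rule borel_measurable_funI)
  show "(\<lambda>y. limit_excess y i) \<in> borel_measurable borel" for i
    unfolding limit_excess_def by (cases "i \<in> I \<union> T") simp_all
qed

lemma smoothed_add:
  assumes [measurable]: "f \<in> borel_measurable borel" "g \<in> borel_measurable borel"
  shows "smoothed \<eta> u (\<lambda>x. f x + g x) = smoothed \<eta> u f + smoothed \<eta> u g"
proof -
  have "smoothed \<eta> u (\<lambda>x. f x + g x) = (\<integral>\<^sup>+ \<omega>.
      (\<integral>\<^sup>+ l. f (l *\<^sub>R elliptical_rv \<omega>) * ennreal (1 / (\<eta> / speed u * l)) * indicator {1..<exp (\<eta> / speed u)} l \<partial>lborel)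
    + (\<integral>\<^sup>+ l. g (l *\<^sub>R elliptical_rv \<omega>) * ennreal (1 / (\<eta> / speed u * l)) * indicator {1..<exp (\<eta> / speed u)} l \<partial>lborel) \<partial>M)"
    unfolding smoothed_def by (intro nn_integral_cong, subst nn_integral_add[symmetric]) (auto simp: distrib_right)
  also have "\<dots> = smoothed \<eta> u f + smoothed \<eta> u g"
    unfolding smoothed_def by (rule nn_integral_add) measurable
  finally show ?thesis .
qed

lemma smoothed_const:
  assumes "0 < u" "0 < \<eta>"
  shows "(\<integral>\<^sup>+ \<omega>. f \<omega> \<partial>M) = (\<integral>\<^sup>+ \<omega>. (\<integral>\<^sup>+ l. f \<omega> * ennreal (1 / (\<eta> / speed u * l)) * indicator {1..<exp (\<eta> / speed u)} l \<partial>lborel) \<partial>M)"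
proof (rule nn_integral_cong)
  fix \<omega>
  have "0 < \<eta> / speed u" using assms speed_pos by simp
  then have "f \<omega> * (\<integral>\<^sup>+ l. ennreal (1 / (\<eta> / speed u * l)) * indicator {1..<exp (\<eta> / speed u)} l \<partial>lborel) = f \<omega>"
    by (subst nn_integral_log_uniform_weight) auto
  moreover have "f \<omega> * (\<integral>\<^sup>+ l. ennreal (1 / (\<eta> / speed u * l)) * indicator {1..<exp (\<eta> / speed u)} l \<partial>lborel)
    = (\<integral>\<^sup>+ l. f \<omega> * ennreal (1 / (\<eta> / speed u * l)) * indicator {1..<exp (\<eta> / speed u)} l \<partial>lborel)"
    by (subst nn_integral_cmult[symmetric]) (auto simp: mult.assoc)
  ultimately show "f \<omega> = (\<integral>\<^sup>+ l. f \<omega> * ennreal (1 / (\<eta> / speed u * l)) * indicator {1..<exp (\<eta> / speed u)} l \<partial>lborel)" by simp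
qed

text \<open>
  Averaging the pointwise comparison over the dilation factor, whose density has total mass 1.
\<close>

lemma smoothing_sandwich:
  assumes u: "0 < u" and \<eta>: "0 < \<eta>"
    and f[measurable]: "f \<in> borel_measurable borel" and g[measurable]: "g \<in> borel_measurable borel"
    and f0: "\<And>x. 0 \<le> f x" and g0: "\<And>x. 0 \<le> g x"
    and le: "\<And>x l. 1 \<le> l \<Longrightarrow> l < exp (\<eta> / speed u) \<Longrightarrow> \<bar>f x - f (l *\<^sub>R x)\<bar> \<le> g (l *\<^sub>R x)"
  shows "(\<integral>\<^sup>+ \<omega>. ennreal (f (elliptical_rv \<omega>)) \<partial>M) \<le> smoothed \<eta> u (\<lambda>x. ennreal (f x)) + smoothed \<eta> u (\<lambda>x. ennreal (g x))"
    and "smoothed \<eta> u (\<lambda>x. ennreal (f x)) \<le> (\<integral>\<^sup>+ \<omega>. ennreal (f (elliptical_rv \<omega>)) \<partial>M) + smoothed \<eta> u (\<lambda>x. ennreal (g x))"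
proof -
  have pt: "ennreal (f x) \<le> ennreal (f (l *\<^sub>R x)) + ennreal (g (l *\<^sub>R x))"
    "ennreal (f (l *\<^sub>R x)) \<le> ennreal (f x) + ennreal (g (l *\<^sub>R x))" if "1 \<le> l" "l < exp (\<eta> / speed u)" for x l
    using le[OF that, of x] f0 g0 by (auto simp: ennreal_plus[symmetric] simp del: ennreal_plus intro!: ennreal_leI)
  note const = smoothed_const[OF u \<eta>, of "\<lambda>\<omega>. ennreal (f (elliptical_rv \<omega>))"]
  have "(\<integral>\<^sup>+ \<omega>. ennreal (f (elliptical_rv \<omega>)) \<partial>M) \<le> smoothed \<eta> u (\<lambda>x. ennreal (f x) + ennreal (g x))"
    unfolding const smoothed_def
    by (intro nn_integral_mono) (auto intro!: mult_right_mono pt split: split_indicator)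
  then show "(\<integral>\<^sup>+ \<omega>. ennreal (f (elliptical_rv \<omega>)) \<partial>M) \<le> smoothed \<eta> u (\<lambda>x. ennreal (f x)) + smoothed \<eta> u (\<lambda>x. ennreal (g x))"
    by (simp add: smoothed_add)
  have "smoothed \<eta> u (\<lambda>x. ennreal (f x)) \<le> (\<integral>\<^sup>+ \<omega>. (\<integral>\<^sup>+ l. ennreal (f (elliptical_rv \<omega>)) * ennreal (1 / (\<eta> / speed u * l)) * indicator {1..<exp (\<eta> / speed u)} l
     + ennreal (g (l *\<^sub>R elliptical_rv \<omega>)) * ennreal (1 / (\<eta> / speed u * l)) * indicator {1..<exp (\<eta> / speed u)} l \<partial>lborel) \<partial>M)"
    unfolding smoothed_def distrib_right[symmetric]
    by (intro nn_integral_mono) (auto intro!: mult_right_mono pt split: split_indicator)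
  also have "\<dots> = (\<integral>\<^sup>+ \<omega>. (\<integral>\<^sup>+ l. ennreal (f (elliptical_rv \<omega>)) * ennreal (1 / (\<eta> / speed u * l)) * indicator {1..<exp (\<eta> / speed u)} l \<partial>lborel)
     + (\<integral>\<^sup>+ l. ennreal (g (l *\<^sub>R elliptical_rv \<omega>)) * ennreal (1 / (\<eta> / speed u * l)) * indicator {1..<exp (\<eta> / speed u)} l \<partial>lborel) \<partial>M)"
    by (intro nn_integral_cong nn_integral_add) auto
  also have "\<dots> = (\<integral>\<^sup>+ \<omega>. ennreal (f (elliptical_rv \<omega>)) \<partial>M) + smoothed \<eta> u (\<lambda>x. ennreal (g x))"
    unfolding const smoothed_def by (rule nn_integral_add) measurable
  finally show "smoothed \<eta> u (\<lambda>x. ennreal (f x)) \<le> (\<integral>\<^sup>+ \<omega>. ennreal (f (elliptical_rv \<omega>)) \<partial>M) + smoothed \<eta> u (\<lambda>x. ennreal (g x))" .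
qed

definition limit_functional :: "(('k \<Rightarrow> ereal) \<Rightarrow> real) \<Rightarrow> real" where
  "limit_functional F = (\<integral>y. F (limit_excess y) * of_bool (\<forall>i\<in>I \<union> T. 0 < y $ i) * exp (- limit_exponent y) \<partial>lborel)"

definition boundary_layer :: "real \<Rightarrow> real ^ 'k \<Rightarrow> real" where
  "boundary_layer \<theta> y = of_bool ((\<forall>i\<in>I \<union> T. - \<theta> < y $ i) \<and> \<not> (\<forall>i\<in>I \<union> T. \<theta> < y $ i))"

definition cone_ind :: "real ^ 'k \<Rightarrow> real" where "cone_ind y = of_bool (\<forall>i\<in>I. - 1 < y $ i)"

lemma boundary_layer_measurable[measurable]: "boundary_layer \<theta> \<in> borel_measurable borel" unfolding boundary_layer_def by measurable
lemma cone_ind_measurable[measurable]: "cone_ind \<in> borel_measurable borel" unfolding cone_ind_def by measurable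

lemma eventually_pos: "filterlim u at_top sequentially \<Longrightarrow> \<forall>\<^sub>F n in sequentially. 0 < (u n :: real)"
  using filterlim_at_top_dense by blast

lemma cone_ind_eventually:
  assumes "0 < u"
  shows "of_bool (\<forall>i\<in>I. - 1 < scaled_excess u (scaled_point u y) i) = cone_ind y"
  unfolding cone_ind_def using assms by (simp add: scaled_excess_scaled_point_I)

lemma cone_ind_zero: "y \<notin> shifted_cone \<Longrightarrow> cone_ind y = 0"
proof -
  assume "y \<notin> shifted_cone"
  then obtain i where "i \<in> I" "\<not> - 1 \<le> y $ i" by (auto simp: shifted_cone_def)
  then have "\<not> (\<forall>i\<in>I. - 1 < y $ i)" by (auto intro!: bexI[of _ i])
  then show ?thesis by (simp add: cone_ind_def)
qed

lemma cone_ind_integrable: "integrable lborel (\<lambda>y. cone_ind y * exp (- limit_exponent y))"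
proof (rule smoothed_convergence(1)[where f="\<lambda>n x. of_bool (\<forall>i\<in>I. - 1 < scaled_excess (real n) x i)" and u=real and \<eta>=1 and K=1])
  have u: "\<forall>\<^sub>F n in sequentially. 0 < real n" by (rule eventually_pos) (rule filterlim_real_sequentially)
  show "\<forall>\<^sub>F n in sequentially. \<forall>y. y \<notin> shifted_cone \<longrightarrow> of_bool (\<forall>i\<in>I. - 1 < scaled_excess (real n) (scaled_point (real n) y) i) = (0::real)"
    using u
  proof eventually_elim
    case (elim n)
    then show ?case unfolding cone_ind_eventually[OF elim] by (simp add: cone_ind_zero)
  qed
  show "AE y in lborel. (\<lambda>n. of_bool (\<forall>i\<in>I. - 1 < scaled_excess (real n) (scaled_point (real n) y) i)) \<longlonglongrightarrow> cone_ind y"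
  proof (rule AE_I2)
    fix y
    have "\<forall>\<^sub>F n in sequentially. cone_ind y = of_bool (\<forall>i\<in>I. - 1 < scaled_excess (real n) (scaled_point (real n) y) i)"
      using u by eventually_elim (rule cone_ind_eventually[symmetric])
    then show "(\<lambda>n. of_bool (\<forall>i\<in>I. - 1 < scaled_excess (real n) (scaled_point (real n) y) i)) \<longlonglongrightarrow> cone_ind y"
      by (rule Lim_transform_eventually[OF tendsto_const])
  qed
qed (auto simp: filterlim_real_sequentially)

lemma bounded_cone_ind_integrable:
  assumes [measurable]: "g \<in> borel_measurable borel" and g: "\<And>y. \<bar>g y\<bar> \<le> K * cone_ind y"
  shows "integrable lborel (\<lambda>y. g y * exp (- limit_exponent y))"
proof (rule Bochner_Integration.integrable_bound)
  show "integrable lborel (\<lambda>y. K * (cone_ind y * exp (- limit_exponent y)))" by (intro integrable_mult_right cone_ind_integrable)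
  show "AE y in lborel. norm (g y * exp (- limit_exponent y)) \<le> norm (K * (cone_ind y * exp (- limit_exponent y)))"
  proof (rule AE_I2)
    fix y
    have "\<bar>g y\<bar> * exp (- limit_exponent y) \<le> \<bar>K * cone_ind y\<bar> * exp (- limit_exponent y)"
      using g[of y] by (intro mult_right_mono) auto
    then show "norm (g y * exp (- limit_exponent y)) \<le> norm (K * (cone_ind y * exp (- limit_exponent y)))" by (simp add: abs_mult mult.assoc)
  qed
qed measurable

text \<open>
  The layers shrink to the boundary of the orthant, a null set.
\<close>

lemma boundary_layer_vanishes: "(\<lambda>k. \<integral>y. cone_ind y * boundary_layer (1 / (1 + real k)) y * exp (- limit_exponent y) \<partial>lborel) \<longlonglongrightarrow> 0"
proof -
  have ae: "AE y in (lborel :: (real ^ 'k) measure). \<forall>i. \<forall>c\<in>{0}. y $ i \<noteq> c"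
    by (rule AE_lborel_vec_coords) simp
  have "(\<lambda>k. \<integral>y. cone_ind y * boundary_layer (1 / (1 + real k)) y * exp (- limit_exponent y) \<partial>lborel) \<longlonglongrightarrow> (\<integral>y. 0 \<partial>(lborel :: (real^'k) measure))"
  proof (rule integral_dominated_convergence[OF _ _ cone_ind_integrable])
    show "AE y in lborel. norm (cone_ind y * boundary_layer (1 / (1 + real k)) y * exp (- limit_exponent y)) \<le> cone_ind y * exp (- limit_exponent y)" for k
      by (rule AE_I2) (auto simp: cone_ind_def boundary_layer_def)
    show "AE y in lborel. (\<lambda>k. cone_ind y * boundary_layer (1 / (1 + real k)) y * exp (- limit_exponent y)) \<longlonglongrightarrow> 0"
      using ae
    proof eventually_elim
      fix y :: "real^'k" assume y: "\<forall>i. \<forall>c\<in>{0}. y $ i \<noteq> c"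
      have tk: "(\<lambda>k. 1 / (1 + real k)) \<longlonglongrightarrow> 0" by real_asymp
      have small: "\<forall>\<^sub>F k in sequentially. \<forall>i. 1 / (1 + real k) < \<bar>y $ i\<bar>"
      proof (rule eventually_all_finite)
        fix i
        have "0 < \<bar>y $ i\<bar>" using y by simp
        with tk show "\<forall>\<^sub>F k in sequentially. 1 / (1 + real k) < \<bar>y $ i\<bar>"
          by (rule order_tendstoD(2))
      qed
      have "\<forall>\<^sub>F k in sequentially. 0 = cone_ind y * boundary_layer (1 / (1 + real k)) y * exp (- limit_exponent y)"
        using small
      proof eventually_elim
        case (elim k)
        define e where "e = 1 / (1 + real k)"
        have e: "0 < e" "\<And>i. e < \<bar>y $ i\<bar>" using elim by (auto simp: e_def)
        have "\<not> ((\<forall>i\<in>I \<union> T. - e < y $ i) \<and> \<not> (\<forall>i\<in>I \<union> T. e < y $ i))"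
          using e by (smt (verit))
        then show ?case unfolding boundary_layer_def e_def[symmetric] by simp
      qed
      then show "(\<lambda>k. cone_ind y * boundary_layer (1 / (1 + real k)) y * exp (- limit_exponent y)) \<longlonglongrightarrow> 0"
        by (rule Lim_transform_eventually[OF tendsto_const])
    qed
  qed measurable
  then show ?thesis by simp
qed

lemma excess_test_limit:
  assumes u: "filterlim u at_top sequentially" and F: "continuous_on UNIV F" "\<And>w. \<bar>F w\<bar> \<le> K"
  shows "AE y in lborel. (\<lambda>n. excess_test F (u n) (scaled_point (u n) y)) \<longlonglongrightarrow> F (limit_excess y) * of_bool (\<forall>i\<in>I \<union> T. 0 < y $ i)"
  using AE_lborel_vec_coords[OF finite.insertI[OF finite.emptyI], of 0]
proof eventually_elim
  fix y :: "real^'k" assume y: "\<forall>i. \<forall>c\<in>{0}. y $ i \<noteq> c"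
  have "((\<lambda>n. (\<lambda>i. ereal (scaled_excess (u n) (scaled_point (u n) y) i))) \<longlongrightarrow> limit_excess y) sequentially"
  proof (rule tendsto_fun_coordinatewise)
    fix i
    show "(\<lambda>n. ereal (scaled_excess (u n) (scaled_point (u n) y) i)) \<longlonglongrightarrow> limit_excess y i"
    proof (cases "i \<in> I \<union> T")
      case True
      then show ?thesis using scaled_excess_tendsto(1)[OF u True, of y] unfolding limit_excess_def by (simp add: tendsto_ereal)
    next
      case False
      then show ?thesis using scaled_excess_tendsto(2)[OF u False, of y] unfolding limit_excess_def by (simp add: tendsto_PInfty_eq_at_top)
    qed
  qed
  then have FQ: "(\<lambda>n. F (\<lambda>i. ereal (scaled_excess (u n) (scaled_point (u n) y) i))) \<longlonglongrightarrow> F (limit_excess y)"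
    using continuous_on_tendsto_compose[OF F(1)] by auto
  have "\<forall>\<^sub>F n in sequentially. of_bool (\<forall>i\<in>I \<union> T. 0 < y $ i) = (of_bool (\<forall>i. 0 < scaled_excess (u n) (scaled_point (u n) y) i) :: real)"
    using scaled_excess_threshold[OF u, of y 0] y by (auto elim: eventually_mono)
  then have "(\<lambda>n. of_bool (\<forall>i. 0 < scaled_excess (u n) (scaled_point (u n) y) i) :: real) \<longlonglongrightarrow> of_bool (\<forall>i\<in>I \<union> T. 0 < y $ i)"
    by (rule Lim_transform_eventually[OF tendsto_const])
  then show "(\<lambda>n. excess_test F (u n) (scaled_point (u n) y)) \<longlonglongrightarrow> F (limit_excess y) * of_bool (\<forall>i\<in>I \<union> T. 0 < y $ i)"
    unfolding excess_test_def by (rule tendsto_mult[OF FQ])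
qed

lemma scaling_error_limit:
  assumes u: "filterlim u at_top sequentially"
  shows "AE y in lborel. (\<lambda>n. scaling_error \<epsilon> K \<theta> (u n) (scaled_point (u n) y)) \<longlonglongrightarrow> cone_ind y * (\<epsilon> + K * boundary_layer \<theta> y)"
  using AE_lborel_vec_coords[OF finite.insertI[OF finite.insertI[OF finite.emptyI]], of \<theta> "- \<theta>"]
proof eventually_elim
  fix y :: "real^'k" assume y: "\<forall>i. \<forall>c\<in>{\<theta>, - \<theta>}. y $ i \<noteq> c"
  have dd0: "(\<lambda>n. displacement (speed (u n)) y $ i) \<longlonglongrightarrow> 0" for i
  proof -
    have "(\<lambda>n. 1 / m n * subvec y I $ i + 1 / sqrt (m n) * subvec y (- I) $ i + 1 / m n * (submat S (- I) I *v (B *v subvec y I)) $ i) \<longlonglongrightarrow> 0"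
      if "filterlim m at_top sequentially" for m :: "nat \<Rightarrow> real"
    proof -
      have "((\<lambda>m. 1 / m * subvec y I $ i + 1 / sqrt m * subvec y (- I) $ i + 1 / m * (submat S (- I) I *v (B *v subvec y I)) $ i) \<longlongrightarrow> 0) at_top"
        by real_asymp
      from filterlim_compose[OF this that] show ?thesis .
    qed
    then show ?thesis
      unfolding displacement_def using filterlim_compose[OF speed_at_top u] by simp
  qed
  have "\<forall>\<^sub>F n in sequentially. \<forall>i. dist (displacement (speed (u n)) y $ i) 0 < 1"
    by (intro eventually_all_finite tendstoD[OF dd0]) simp
  moreover have "\<forall>\<^sub>F n in sequentially. (\<forall>i. \<theta> < scaled_excess (u n) (scaled_point (u n) y) i) = (\<forall>i\<in>I \<union> T. \<theta> < y $ i)"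
    "\<forall>\<^sub>F n in sequentially. (\<forall>i. - \<theta> < scaled_excess (u n) (scaled_point (u n) y) i) = (\<forall>i\<in>I \<union> T. - \<theta> < y $ i)"
    by (rule scaled_excess_threshold[OF u], use y in simp)+
  ultimately have "\<forall>\<^sub>F n in sequentially. scaling_error \<epsilon> K \<theta> (u n) (scaled_point (u n) y) = cone_ind y * (\<epsilon> + K * boundary_layer \<theta> y)"
    using eventually_pos[OF u]
  proof eventually_elim
    case (elim n)
    have "\<not> c0 * u n < \<bar>scaled_point (u n) y $ i\<bar>" for i
    proof -
      have "\<bar>scaled_point (u n) y $ i\<bar> = u n * \<bar>b $ i + displacement (speed (u n)) y $ i\<bar>" unfolding scaled_point_def using elim by (simp add: abs_mult)
      also have "\<dots> \<le> u n * (\<bar>b $ i\<bar> + 1)"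
      proof (rule mult_left_mono)
        have "\<bar>displacement (speed (u n)) y $ i\<bar> < 1" using elim(1) by (simp add: dist_real_def)
        then show "\<bar>b $ i + displacement (speed (u n)) y $ i\<bar> \<le> \<bar>b $ i\<bar> + 1" by linarith
      qed (use elim in simp)
      also have "\<dots> \<le> u n * c0" using elim b_c0[of i] by (intro mult_left_mono) auto
      finally show ?thesis by (simp add: mult.commute)
    qed
    then show ?case unfolding scaling_error_def boundary_layer_def using cone_ind_eventually[of "u n" y] elim by simp
  qed
  then show "(\<lambda>n. scaling_error \<epsilon> K \<theta> (u n) (scaled_point (u n) y)) \<longlonglongrightarrow> cone_ind y * (\<epsilon> + K * boundary_layer \<theta> y)"
    by (rule tendsto_eventually)
qed

lemma tail_prob_pos: "\<forall>\<^sub>F u in at_top. 0 < tail_prob u"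
  using tail_ratio_bound[OF tail_prob_tail params] unfolding eventually_at_top_linorder by blast

text \<open>
  For fixed \<open>\<eta>\<close> the smoothed expectation and the error term both converge. The inequality assumed for
  \<open>e\<close> is the limit of the total error.
\<close>

lemma main_convergence_step:
  fixes Cn :: "nat \<Rightarrow> real"
  assumes u: "filterlim u at_top sequentially"
    and Cn: "\<forall>\<^sub>F n in sequentially. 0 < Cn n \<and> (\<forall>(\<eta>::real) f. 0 < \<eta> \<longrightarrow> f \<in> borel_measurable borel \<longrightarrow>
        smoothed \<eta> (u n) f = ennreal (Cn n) * (\<integral>\<^sup>+ y. f (scaled_point (u n) y) * ennreal (rel_density \<eta> (u n) y) \<partial>lborel))"
    and F: "continuous_on UNIV F" "\<And>w. 0 \<le> F w" "\<And>w. F w \<le> K"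
    and \<eta>: "0 < \<eta>" "\<eta> \<le> 1" and \<theta>: "\<theta> = \<eta> * c0" "\<theta> < 1/2" and \<epsilon>: "0 \<le> \<epsilon>"
    and unif: "\<And>x y :: 'k \<Rightarrow> real. (\<And>i. \<bar>x i - y i\<bar> \<le> \<theta>) \<Longrightarrow> \<bar>F (\<lambda>i. ereal (x i)) - F (\<lambda>i. ereal (y i))\<bar> \<le> \<epsilon>"
    and \<delta>: "(exp \<eta> - 1) / \<eta> * (\<epsilon> * (\<integral>y. cone_ind y * exp (- limit_exponent y) \<partial>lborel) + K * (\<integral>y. cone_ind y * boundary_layer \<theta> y * exp (- limit_exponent y) \<partial>lborel))
        + \<eta> * limit_functional F < e"
  shows "\<forall>\<^sub>F n in sequentially. \<bar>(\<integral>\<omega>. excess_test F (u n) (elliptical_rv \<omega>) \<partial>M) / Cn n - limit_functional F\<bar> < e"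
proof -
  define \<kappa> where "\<kappa> = (exp \<eta> - 1) / \<eta>"
  have \<kappa>: "1 \<le> \<kappa>" "\<kappa> \<le> 1 + \<eta>" unfolding \<kappa>_def by (rule exp_minus_one_bound[OF \<eta>])+
  have K: "0 \<le> K" using F(2)[of undefined] F(3)[of undefined] by linarith
  have Fm[measurable]: "F \<in> borel_measurable borel" by (rule borel_measurable_continuous_onI[OF F(1)])
  have Pm[measurable]: "excess_test F v \<in> borel_measurable borel" for v by (rule excess_test_measurable[OF Fm])
  have Phi01: "0 \<le> excess_test F v z" "excess_test F v z \<le> K" for v z unfolding excess_test_def using F K by auto
  have Err0: "0 \<le> scaling_error \<epsilon> K \<theta> v z" for v z unfolding scaling_error_def using K \<epsilon> by simp
  have ErrK: "scaling_error \<epsilon> K \<theta> v z \<le> \<epsilon> + K + K" for v z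
    unfolding scaling_error_def using K \<epsilon> by auto
  let ?s = "\<lambda>n. \<integral>y. excess_test F (u n) (scaled_point (u n) y) * rel_density \<eta> (u n) y \<partial>lborel"
  let ?r = "\<lambda>n. \<integral>y. scaling_error \<epsilon> K \<theta> (u n) (scaled_point (u n) y) * rel_density \<eta> (u n) y \<partial>lborel"
  let ?e = "\<lambda>n. \<integral>\<omega>. excess_test F (u n) (elliptical_rv \<omega>) \<partial>M"
  have suppE: "\<forall>\<^sub>F n in sequentially. \<forall>y. y \<notin> shifted_cone \<longrightarrow> scaling_error \<epsilon> K \<theta> (u n) (scaled_point (u n) y) = 0"
    using eventually_pos[OF u]
  proof eventually_elim
    case (elim n)
    then show ?case unfolding scaling_error_def cone_ind_eventually[OF elim] by (simp add: cone_ind_zero)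
  qed
  have suppP: "\<forall>\<^sub>F n in sequentially. \<forall>y. y \<notin> shifted_cone \<longrightarrow> excess_test F (u n) (scaled_point (u n) y) = 0"
    using eventually_pos[OF u]
  proof eventually_elim
    case (elim n)
    show ?case
    proof (intro allI impI)
      fix y assume "y \<notin> shifted_cone"
      then obtain i where "i \<in> I" "y $ i < - 1" by (auto simp: shifted_cone_def not_le)
      then have "\<not> 0 < scaled_excess (u n) (scaled_point (u n) y) i" using scaled_excess_scaled_point_I[OF elim] by simp
      then show "excess_test F (u n) (scaled_point (u n) y) = 0" unfolding excess_test_def by auto
    qed
  qed
  have FQm: "(\<lambda>y. F (limit_excess y) * of_bool (\<forall>i\<in>I \<union> T. 0 < y $ i)) \<in> borel_measurable borel" by measurable
  have Flim: "AE y in lborel. (\<lambda>n. excess_test F (u n) (scaled_point (u n) y)) \<longlonglongrightarrow> F (limit_excess y) * of_bool (\<forall>i\<in>I \<union> T. 0 < y $ i)"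
    by (rule excess_test_limit[OF u F(1), of K]) (use F in auto)
  note P = smoothed_convergence[OF \<eta> u Pm Phi01 suppP FQm Flim]
  have Em: "(\<lambda>y. cone_ind y * (\<epsilon> + K * boundary_layer \<theta> y)) \<in> borel_measurable borel" by measurable
  note E = smoothed_convergence[OF \<eta> u scaling_error_measurable Err0 ErrK suppE Em scaling_error_limit[OF u]]
  have s: "?s \<longlonglongrightarrow> \<kappa> * limit_functional F" using P(2) unfolding \<kappa>_def limit_functional_def .
  have r: "?r \<longlonglongrightarrow> \<kappa> * (\<epsilon> * (\<integral>y. cone_ind y * exp (- limit_exponent y) \<partial>lborel) + K * (\<integral>y. cone_ind y * boundary_layer \<theta> y * exp (- limit_exponent y) \<partial>lborel))"
  proof -
    have i: "integrable lborel (\<lambda>y. (cone_ind y * boundary_layer \<theta> y) * exp (- limit_exponent y))"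
      by (rule bounded_cone_ind_integrable[of _ 1]) (auto simp: cone_ind_def boundary_layer_def)
    have "(\<integral>y. cone_ind y * (\<epsilon> + K * boundary_layer \<theta> y) * exp (- limit_exponent y) \<partial>lborel)
      = (\<integral>y. \<epsilon> * (cone_ind y * exp (- limit_exponent y)) + K * (cone_ind y * boundary_layer \<theta> y * exp (- limit_exponent y)) \<partial>lborel)"
      by (simp add: algebra_simps)
    also have "\<dots> = \<epsilon> * (\<integral>y. cone_ind y * exp (- limit_exponent y) \<partial>lborel) + K * (\<integral>y. cone_ind y * boundary_layer \<theta> y * exp (- limit_exponent y) \<partial>lborel)"
      by (subst Bochner_Integration.integral_add) (auto intro!: integrable_mult_right cone_ind_integrable i)
    finally show ?thesis using E(2) unfolding \<kappa>_def by simp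
  qed
  have mF0: "0 \<le> limit_functional F" unfolding limit_functional_def using F by (intro integral_nonneg_AE) auto
  have "\<forall>\<^sub>F n in sequentially. 1 \<le> speed (u n)"
    using filterlim_at_top[THEN iffD1, OF filterlim_compose[OF speed_at_top u], rule_format, of 1] .
  then have close: "\<forall>\<^sub>F n in sequentially. \<bar>?e n / Cn n - ?s n\<bar> \<le> ?r n"
    using eventually_pos[OF u] Cn P(3) E(3)
  proof eventually_elim
    case (elim n)
    have C: "0 < Cn n" using elim by simp
    have ident: "smoothed \<eta> (u n) (\<lambda>x. ennreal (f x)) = ennreal (Cn n) * (\<integral>\<^sup>+ y. ennreal (f (scaled_point (u n) y)) * ennreal (rel_density \<eta> (u n) y) \<partial>lborel)"
      if [measurable]: "f \<in> borel_measurable borel" for f :: "real^'k \<Rightarrow> real"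
    proof -
      have "(\<lambda>x. ennreal (f x)) \<in> borel_measurable borel" by measurable
      then show ?thesis using elim(3) \<eta>(1) by blast
    qed
    have s0: "0 \<le> ?s n" and r0: "0 \<le> ?r n"
      using Phi01 Err0 rel_density_nonneg[OF \<eta>(1) elim(2)] by (auto intro!: integral_nonneg_AE)
    have e0: "0 \<le> ?e n" using Phi01 by (auto intro!: integral_nonneg_AE)
    have SP: "smoothed \<eta> (u n) (\<lambda>x. ennreal (excess_test F (u n) x)) = ennreal (Cn n * ?s n)"
      unfolding ident[OF Pm] elim(4) using C s0 by (simp add: ennreal_mult)
    have SE: "smoothed \<eta> (u n) (\<lambda>x. ennreal (scaling_error \<epsilon> K \<theta> (u n) x)) = ennreal (Cn n * ?r n)"
      unfolding ident[OF scaling_error_measurable] elim(5) using C r0 by (simp add: ennreal_mult)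
    have ee: "(\<integral>\<^sup>+ \<omega>. ennreal (excess_test F (u n) (elliptical_rv \<omega>)) \<partial>M) = ennreal (?e n)"
    proof (rule nn_integral_eq_integral)
      show "integrable M (\<lambda>\<omega>. excess_test F (u n) (elliptical_rv \<omega>))"
        using Phi01 by (intro integrable_const_bound[of _ K]) auto
    qed (use Phi01 in auto)
    have le: "\<bar>excess_test F (u n) x - excess_test F (u n) (l *\<^sub>R x)\<bar> \<le> scaling_error \<epsilon> K \<theta> (u n) (l *\<^sub>R x)" if "1 \<le> l" "l < exp (\<eta> / speed (u n))" for x l
    proof (rule excess_test_scaling_error[OF elim(2,1) \<eta> \<theta> that])
      show "\<bar>F (\<lambda>i. ereal (x i)) - F (\<lambda>i. ereal (y i))\<bar> \<le> \<epsilon>" if "\<And>i. \<bar>x i - y i\<bar> \<le> \<theta>" for x y :: "'k \<Rightarrow> real"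
        using that by (rule unif)
    qed (rule F \<epsilon>)+
    note sw = smoothing_sandwich[OF elim(2) \<eta>(1) Pm scaling_error_measurable Phi01(1) Err0 le, unfolded SP SE ee]
    have "?e n \<le> Cn n * ?s n + Cn n * ?r n"
      using sw(1) C s0 r0 by (simp add: ennreal_plus[symmetric] del: ennreal_plus)
    moreover have "Cn n * ?s n \<le> ?e n + Cn n * ?r n"
      using sw(2) C e0 r0 by (simp add: ennreal_plus[symmetric] del: ennreal_plus)
    ultimately show ?case using C by (simp add: abs_le_iff field_simps)
  qed
  have "(\<lambda>n. ?r n + \<bar>?s n - \<kappa> * limit_functional F\<bar> + (\<kappa> - 1) * limit_functional F) \<longlonglongrightarrow>
     \<kappa> * (\<epsilon> * (\<integral>y. cone_ind y * exp (- limit_exponent y) \<partial>lborel) + K * (\<integral>y. cone_ind y * boundary_layer \<theta> y * exp (- limit_exponent y) \<partial>lborel)) + \<bar>\<kappa> * limit_functional F - \<kappa> * limit_functional F\<bar> + (\<kappa> - 1) * limit_functional F"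
    by (intro tendsto_add r tendsto_rabs tendsto_diff s tendsto_const)
  moreover have "(\<kappa> - 1) * limit_functional F \<le> \<eta> * limit_functional F" using \<kappa> mF0 by (intro mult_right_mono) auto
  then have "\<kappa> * (\<epsilon> * (\<integral>y. cone_ind y * exp (- limit_exponent y) \<partial>lborel) + K * (\<integral>y. cone_ind y * boundary_layer \<theta> y * exp (- limit_exponent y) \<partial>lborel)) + \<bar>\<kappa> * limit_functional F - \<kappa> * limit_functional F\<bar> + (\<kappa> - 1) * limit_functional F < e"
    using \<delta> unfolding \<kappa>_def[symmetric] by simp
  ultimately have "\<forall>\<^sub>F n in sequentially. ?r n + \<bar>?s n - \<kappa> * limit_functional F\<bar> + (\<kappa> - 1) * limit_functional F < e"
    by (rule order_tendstoD(2))
  with close show ?thesis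
  proof eventually_elim
    case (elim n)
    have "?e n / Cn n - limit_functional F = (?e n / Cn n - ?s n) + (?s n - \<kappa> * limit_functional F) + (\<kappa> - 1) * limit_functional F" by (simp add: algebra_simps)
    then have "\<bar>?e n / Cn n - limit_functional F\<bar> \<le> \<bar>?e n / Cn n - ?s n\<bar> + \<bar>?s n - \<kappa> * limit_functional F\<bar> + \<bar>(\<kappa> - 1) * limit_functional F\<bar>"
      by linarith
    moreover have "\<bar>(\<kappa> - 1) * limit_functional F\<bar> = (\<kappa> - 1) * limit_functional F" using \<kappa> mF0 by simp
    ultimately show ?case using elim by linarith
  qed
qed

lemma main_convergence:
  assumes u: "filterlim u at_top sequentially"
  shows "\<exists>Cn. (\<forall>\<^sub>F n in sequentially. 0 < Cn n) \<and>
    (\<forall>F K. continuous_on UNIV F \<longrightarrow> (\<forall>w. 0 \<le> F w \<and> F w \<le> K) \<longrightarrow>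
       (\<lambda>n. (\<integral>\<omega>. excess_test F (u n) (elliptical_rv \<omega>) \<partial>M) / Cn n) \<longlonglongrightarrow> limit_functional F)"
proof -
  let ?P = "\<lambda>n C. 0 < C \<and> (\<forall>(\<eta>::real) f. 0 < \<eta> \<longrightarrow> f \<in> borel_measurable borel \<longrightarrow>
        smoothed \<eta> (u n) f = ennreal C * (\<integral>\<^sup>+ y. f (scaled_point (u n) y) * ennreal (rel_density \<eta> (u n) y) \<partial>lborel))"
  define Cn where "Cn n = (SOME C. ?P n C)" for n
  have "\<forall>\<^sub>F n in sequentially. 0 < tail_prob (u n)" using filterlim_iff[THEN iffD1, OF u] tail_prob_pos by blast
  with eventually_pos[OF u] have Cn: "\<forall>\<^sub>F n in sequentially. ?P n (Cn n)"
  proof eventually_elim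
    case (elim n)
    have "\<exists>C. ?P n C" using smoothing_identity[OF elim] by blast
    then show ?case unfolding Cn_def by (rule someI_ex)
  qed
  show ?thesis
  proof (intro exI[of _ Cn] conjI allI impI)
    show "\<forall>\<^sub>F n in sequentially. 0 < Cn n" using Cn by eventually_elim blast
    fix F :: "('k \<Rightarrow> ereal) \<Rightarrow> real" and K assume Fc: "continuous_on UNIV F" and FK: "\<forall>w. 0 \<le> F w \<and> F w \<le> K"
    have F: "0 \<le> F w" "F w \<le> K" for w using FK by auto
    have K: "0 \<le> K" using F[of undefined] by linarith
    show "(\<lambda>n. (\<integral>\<omega>. excess_test F (u n) (elliptical_rv \<omega>) \<partial>M) / Cn n) \<longlonglongrightarrow> limit_functional F"
    proof (rule tendstoI, unfold dist_real_def)
      fix e :: real assume e: "0 < e"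
      define h where "h = (\<integral>y. cone_ind y * exp (- limit_exponent y) \<partial>lborel)"
      have h: "0 \<le> h" unfolding h_def cone_ind_def by (intro integral_nonneg_AE) auto
      \<comment> \<open>The error is split into the oscillation of F, the boundary layer and the constant (exp \<eta> - 1) / \<eta>.\<close>
      define \<epsilon> where "\<epsilon> = e / (8 * (h + 1))"
      have \<epsilon>: "0 < \<epsilon>" using e h by (simp add: \<epsilon>_def)
      obtain d where d: "0 < d" "\<And>x y :: 'k \<Rightarrow> real. (\<And>i. \<bar>x i - y i\<bar> \<le> d) \<Longrightarrow> \<bar>F (\<lambda>i. ereal (x i)) - F (\<lambda>i. ereal (y i))\<bar> < \<epsilon>"
        using continuous_ereal_fun_uniformly_continuous[OF Fc \<epsilon>] by blast
      have mF0: "0 \<le> limit_functional F" unfolding limit_functional_def using F by (intro integral_nonneg_AE) auto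
      have c0: "1 \<le> c0" using b_c0[of undefined] by linarith
      let ?\<theta> = "\<lambda>k. 1 / (1 + real k)"
      let ?G = "\<lambda>k. \<integral>y. cone_ind y * boundary_layer (?\<theta> k) y * exp (- limit_exponent y) \<partial>lborel"
      have t0: "?\<theta> \<longlonglongrightarrow> 0" by real_asymp
      have "(\<lambda>k. 2 * (K * ?G k) + ?\<theta> k * limit_functional F) \<longlonglongrightarrow> 2 * (K * 0) + 0 * limit_functional F"
        by (intro tendsto_add tendsto_mult tendsto_const boundary_layer_vanishes t0)
      then have "(\<lambda>k. 2 * (K * ?G k) + ?\<theta> k * limit_functional F) \<longlonglongrightarrow> 0" by simp
      from order_tendstoD(2)[OF this, of "e / 2"] order_tendstoD(2)[OF t0 d(1)] order_tendstoD(2)[OF t0, of "1/2"] e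
      have "\<forall>\<^sub>F k in sequentially. 2 * (K * ?G k) + ?\<theta> k * limit_functional F < e / 2 \<and> ?\<theta> k < d \<and> ?\<theta> k < 1/2"
        by (auto intro!: eventually_conj)
      then obtain k where k: "2 * (K * ?G k) + ?\<theta> k * limit_functional F < e / 2" "?\<theta> k < d" "?\<theta> k < 1/2"
        using eventually_happens'[OF sequentially_bot] by blast
      define \<theta> where "\<theta> = ?\<theta> k"
      define G where "G = ?G k"
      have G: "0 \<le> G" unfolding G_def cone_ind_def boundary_layer_def by (intro integral_nonneg_AE) auto
      have \<theta>: "0 < \<theta>" "\<theta> < d" "\<theta> < 1/2" using k by (auto simp: \<theta>_def)
      \<comment> \<open>The order of choice is \<epsilon>, then the layer width \<theta>, then the smoothing range \<eta>.\<close>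
      define \<eta> where "\<eta> = \<theta> / c0"
      have \<eta>: "0 < \<eta>" "\<eta> \<le> \<theta>" "\<eta> \<le> 1" "\<theta> = \<eta> * c0" using \<theta> c0 by (auto simp: \<eta>_def divide_le_eq mult_le_cancel_left1 mult_le_cancel_left2)
      show "\<forall>\<^sub>F n in sequentially. \<bar>(\<integral>\<omega>. excess_test F (u n) (elliptical_rv \<omega>) \<partial>M) / Cn n - limit_functional F\<bar> < e"
      proof (rule main_convergence_step[OF u Cn Fc F \<eta>(1,3,4) \<theta>(3) less_imp_le[OF \<epsilon>]])
        show "\<bar>F (\<lambda>i. ereal (x i)) - F (\<lambda>i. ereal (y i))\<bar> \<le> \<epsilon>" if "\<And>i. \<bar>x i - y i\<bar> \<le> \<theta>" for x y :: "'k \<Rightarrow> real"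
          using d(2)[of x y] that \<theta>(2) by (meson less_imp_le order_trans)
        have "\<epsilon> * h \<le> e / 8"
        proof -
          have "\<epsilon> * h \<le> \<epsilon> * (h + 1)" using \<epsilon> by simp
          also have "\<dots> = e / 8"
          proof -
            have "h + 1 \<noteq> 0" using h by linarith
            moreover have "e / (8 * x) * x = e / 8" if "x \<noteq> 0" for x using that by simp
            ultimately show ?thesis unfolding \<epsilon>_def by blast
          qed
          finally show ?thesis .
        qed
        have "(exp \<eta> - 1) / \<eta> * (\<epsilon> * h + K * G) \<le> 2 * (\<epsilon> * h + K * G)"
          using exp_minus_one_bound(2)[OF \<eta>(1,3)] \<eta>(3) \<epsilon> h K G by (intro mult_right_mono) auto
        moreover have "\<eta> * limit_functional F \<le> \<theta> * limit_functional F" using \<eta>(2) mF0 by (intro mult_right_mono) auto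
        moreover have "2 * (K * G) + \<theta> * limit_functional F < e / 2" using k(1) unfolding \<theta>_def G_def .
        ultimately have "(exp \<eta> - 1) / \<eta> * (\<epsilon> * h + K * G) + \<eta> * limit_functional F \<le> 2 * (\<epsilon> * h + K * G) + \<theta> * limit_functional F"
          "2 * (\<epsilon> * h + K * G) + \<theta> * limit_functional F < e"
          using \<open>\<epsilon> * h \<le> e / 8\<close> e by (auto intro: add_mono)
        then have "(exp \<eta> - 1) / \<eta> * (\<epsilon> * h + K * G) + \<eta> * limit_functional F < e" by (rule le_less_trans)
        then show "(exp \<eta> - 1) / \<eta> * (\<epsilon> * (\<integral>y. cone_ind y * exp (- limit_exponent y) \<partial>lborel) + K * (\<integral>y. cone_ind y * boundary_layer \<theta> y * exp (- limit_exponent y) \<partial>lborel)) + \<eta> * limit_functional F < e"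
          unfolding h_def G_def \<theta>_def .
      qed
    qed
  qed
qed

end

context kotz_threshold
begin

section \<open>Identification of the limit\<close>

lemma D_form: "subvec z (- I) \<bullet> (D *v subvec z (- I)) = (\<Sum>i\<in>-I. \<Sum>j\<in>-I. z $ i * D $ i $ j * z $ j)"
proof -
  have "subvec z (- I) \<bullet> (D *v subvec z (- I)) = (\<Sum>i\<in>UNIV. \<Sum>j\<in>UNIV. subvec z (- I) $ i * D $ i $ j * subvec z (- I) $ j)"
    by (simp add: inner_vec_def matrix_vector_mult_def sum_distrib_left mult.assoc)
  also have "\<dots> = (\<Sum>i\<in>-I. \<Sum>j\<in>UNIV. subvec z (- I) $ i * D $ i $ j * subvec z (- I) $ j)"
    by (rule sum.mono_neutral_right) (auto simp: subvec_def)
  also have "\<dots> = (\<Sum>i\<in>-I. \<Sum>j\<in>-I. z $ i * D $ i $ j * z $ j)"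
    by (intro sum.cong refl sum.mono_neutral_cong_right) (auto simp: subvec_def)
  finally show ?thesis .
qed

lemma limit_law_exists: "\<exists>c. limit_law I T rate D c"
proof -
  obtain c where c: "0 < c" "\<And>z. c * (\<Sum>i\<in>-I. (z $ i)\<^sup>2) \<le> subvec z (- I) \<bullet> (D *v subvec z (- I))"
    using D_lower by blast
  have "limit_law I T rate D c"
  proof
    show "I \<noteq> {}" by (rule I_ne)
    show "T \<subseteq> - I" by (auto simp: T_def)
    show "0 < rate i" if "i \<in> I" for i using rate_pos[OF that] by (simp add: rate_def B_def)
    show "0 < c" by (rule c)
    fix z :: "'k \<Rightarrow> real"
    show "c * (\<Sum>i\<in>-I. (z i)\<^sup>2) \<le> (\<Sum>i\<in>-I. \<Sum>j\<in>-I. z i * D $ i $ j * z j)"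
      using c(2)[of "\<chi> i. z i"] unfolding D_form by simp
  qed
  then show ?thesis ..
qed

lemma limit_functional_eq_integral_MW:
  assumes L: "limit_law I T rate D c"
  shows "\<exists>\<kappa>>0. \<forall>F K. F \<in> borel_measurable borel \<longrightarrow> (\<forall>w. 0 \<le> F w \<and> F w \<le> K) \<longrightarrow>
     limit_functional F = \<kappa> * (\<integral>w. F w \<partial>limit_law.MW I T rate D)"
proof -
  interpret L: limit_law I T rate D c by (rule L)
  define \<kappa> where "\<kappa> = L.gauss_mass (\<lambda>_. 0) / (\<Prod>i\<in>I. rate i)"
  have \<kappa>: "0 < \<kappa>" unfolding \<kappa>_def using L.gauss_mass_pos L.rate by (intro divide_pos_pos prod_pos) auto
  show ?thesis
  proof (intro exI[of _ \<kappa>] conjI allI impI \<kappa>)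
    fix F :: "('k \<Rightarrow> ereal) \<Rightarrow> real" and K
    assume Fm[measurable]: "F \<in> borel_measurable borel" and FK: "\<forall>w. 0 \<le> F w \<and> F w \<le> K"
    have K: "0 \<le> K" using FK by (meson order_trans)
    have F: "0 \<le> F w" "F w \<le> K" for w using FK by auto
    let ?P = "\<lambda>y. of_bool (\<forall>i\<in>I \<union> T. 0 < y $ i) :: real"
    have ex: "exp (- limit_exponent y) = exp (- (\<Sum>i\<in>I. rate i * y $ i)) * L.gauss_weight (($) y)" for y
      unfolding limit_exponent_def L.gauss_weight_def D_form by (simp add: exp_add[symmetric])
    have "integrable lborel (\<lambda>y. (F (limit_excess y) * ?P y) * exp (- limit_exponent y))"
    proof (rule bounded_cone_ind_integrable)
      show "\<bar>F (limit_excess y) * ?P y\<bar> \<le> K * cone_ind y" for y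
      proof (cases "\<forall>i\<in>I \<union> T. 0 < y $ i")
        case True
        then have "cone_ind y = 1" unfolding cone_ind_def by (auto intro: less_trans[of "-1" 0])
        then show ?thesis using F[of "limit_excess y"] K True by simp
      next
        case False
        then have "?P y = 0" by (simp only: False of_bool_eq(1))
        moreover have "0 \<le> K * cone_ind y" using K by (simp add: cone_ind_def)
        ultimately show ?thesis by (simp only: mult_zero_right abs_zero)
      qed
    qed measurable
    then have "ennreal (limit_functional F) = (\<integral>\<^sup>+ y. ennreal (F (limit_excess y) * ?P y * exp (- limit_exponent y)) \<partial>lborel)"
      unfolding limit_functional_def using F by (intro nn_integral_eq_integral[symmetric]) auto
    also have "\<dots> = (\<integral>\<^sup>+ y. ennreal (F (\<lambda>i. if i \<in> I \<union> T then ereal (y $ i) else \<infinity>)) * indicator {y. \<forall>i\<in>I \<union> T. 0 < y $ i} y *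
      ennreal (exp (- (\<Sum>i\<in>I. rate i * y $ i)) * L.gauss_weight (($) y)) \<partial>lborel)"
    proof (rule nn_integral_cong)
      fix y :: "real^'k"
      have q: "(\<lambda>i. if i \<in> I \<union> T then ereal (y $ i) else \<infinity>) = limit_excess y" by (simp add: limit_excess_def fun_eq_iff)
      have i: "(indicator {y. \<forall>i\<in>I \<union> T. 0 < y $ i} y :: ennreal) = ennreal (?P y)" by (simp add: indicator_def)
      show "ennreal (F (limit_excess y) * ?P y * exp (- limit_exponent y)) = ennreal (F (\<lambda>i. if i \<in> I \<union> T then ereal (y $ i) else \<infinity>)) * indicator {y. \<forall>i\<in>I \<union> T. 0 < y $ i} y *
        ennreal (exp (- (\<Sum>i\<in>I. rate i * y $ i)) * L.gauss_weight (($) y))"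
        unfolding q i ex[symmetric] using F[of "limit_excess y"] by (subst ennreal_mult, simp, simp)+ simp
    qed
    also have "\<dots> = ennreal \<kappa> * (\<integral>\<^sup>+ w. ennreal (F w) \<partial>L.MW)"
      unfolding \<kappa>_def by (rule L.nn_integral_MW) measurable
    also have "(\<integral>\<^sup>+ w. ennreal (F w) \<partial>L.MW) = ennreal (\<integral>w. F w \<partial>L.MW)"
    proof (rule nn_integral_eq_integral)
      show "integrable L.MW F"
        using F K by (intro L.MW.integrable_const_bound[of _ K]) auto
    qed (use F in auto)
    also have "ennreal \<kappa> * \<dots> = ennreal (\<kappa> * (\<integral>w. F w \<partial>L.MW))"
      using \<kappa> F by (subst ennreal_mult) (auto intro!: integral_nonneg_AE)
    finally show "limit_functional F = \<kappa> * (\<integral>w. F w \<partial>L.MW)"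
      using \<kappa> F by (subst (asm) ennreal_inj) (auto simp: limit_functional_def intro!: integral_nonneg_AE mult_nonneg_nonneg)
  qed
qed

lemma normalised_convergence:
  assumes u: "filterlim u at_top sequentially"
  shows "\<forall>\<^sub>F n in sequentially. 0 < (\<integral>\<omega>. excess_test (\<lambda>_. 1) (u n) (elliptical_rv \<omega>) \<partial>M)"
    and "continuous_on UNIV F \<Longrightarrow> (\<And>w. 0 \<le> F w \<and> F w \<le> K) \<Longrightarrow>
      (\<lambda>n. (\<integral>\<omega>. excess_test F (u n) (elliptical_rv \<omega>) \<partial>M) / (\<integral>\<omega>. excess_test (\<lambda>_. 1) (u n) (elliptical_rv \<omega>) \<partial>M))
        \<longlonglongrightarrow> (\<integral>w. F w \<partial>limit_law.MW I T rate D)"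
proof -
  obtain c where L: "limit_law I T rate D c" using limit_law_exists by blast
  interpret L: limit_law I T rate D c by (rule L)
  obtain \<kappa> where \<kappa>: "0 < \<kappa>" "\<And>F K. F \<in> borel_measurable borel \<Longrightarrow> (\<forall>w. 0 \<le> F w \<and> F w \<le> K) \<Longrightarrow> limit_functional F = \<kappa> * (\<integral>w. F w \<partial>L.MW)"
    using limit_functional_eq_integral_MW[OF L] by blast
  obtain Cn where Cn: "\<forall>\<^sub>F n in sequentially. 0 < Cn n"
    "\<And>F K. continuous_on UNIV F \<Longrightarrow> (\<forall>w. 0 \<le> F w \<and> F w \<le> K) \<Longrightarrow> (\<lambda>n. (\<integral>\<omega>. excess_test F (u n) (elliptical_rv \<omega>) \<partial>M) / Cn n) \<longlonglongrightarrow> limit_functional F"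
    using main_convergence[OF u] by blast
  have one: "limit_functional (\<lambda>_. 1) = \<kappa>" using \<kappa>(2)[of "\<lambda>_. 1" 1] by (simp add: L.MW.prob_space)
  have c1: "(\<lambda>n. (\<integral>\<omega>. excess_test (\<lambda>_. 1) (u n) (elliptical_rv \<omega>) \<partial>M) / Cn n) \<longlonglongrightarrow> \<kappa>"
    using Cn(2)[of "\<lambda>_. 1" 1] one by simp
  from order_tendstoD(1)[OF c1 \<kappa>(1)] Cn(1)
  show "\<forall>\<^sub>F n in sequentially. 0 < (\<integral>\<omega>. excess_test (\<lambda>_. 1) (u n) (elliptical_rv \<omega>) \<partial>M)"
    by eventually_elim (simp add: zero_less_divide_iff)
  assume F: "continuous_on UNIV F" "\<And>w. 0 \<le> F w \<and> F w \<le> K"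
  have "limit_functional F = \<kappa> * (\<integral>w. F w \<partial>L.MW)"
    using F by (intro \<kappa>(2)) (auto intro: borel_measurable_continuous_onI)
  then have "(\<lambda>n. ((\<integral>\<omega>. excess_test F (u n) (elliptical_rv \<omega>) \<partial>M) / Cn n) / ((\<integral>\<omega>. excess_test (\<lambda>_. 1) (u n) (elliptical_rv \<omega>) \<partial>M) / Cn n))
     \<longlonglongrightarrow> \<kappa> * (\<integral>w. F w \<partial>L.MW) / \<kappa>"
    using Cn(2)[OF F(1), of K] F(2) \<kappa>(1) by (intro tendsto_divide c1) auto
  moreover have "\<forall>\<^sub>F n in sequentially. ((\<integral>\<omega>. excess_test F (u n) (elliptical_rv \<omega>) \<partial>M) / Cn n) / ((\<integral>\<omega>. excess_test (\<lambda>_. 1) (u n) (elliptical_rv \<omega>) \<partial>M) / Cn n)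
     = (\<integral>\<omega>. excess_test F (u n) (elliptical_rv \<omega>) \<partial>M) / (\<integral>\<omega>. excess_test (\<lambda>_. 1) (u n) (elliptical_rv \<omega>) \<partial>M)"
    using Cn(1) by eventually_elim simp
  ultimately have "(\<lambda>n. (\<integral>\<omega>. excess_test F (u n) (elliptical_rv \<omega>) \<partial>M) / (\<integral>\<omega>. excess_test (\<lambda>_. 1) (u n) (elliptical_rv \<omega>) \<partial>M))
        \<longlonglongrightarrow> \<kappa> * (\<integral>w. F w \<partial>L.MW) / \<kappa>"
    by (rule Lim_transform_eventually)
  then show "(\<lambda>n. (\<integral>\<omega>. excess_test F (u n) (elliptical_rv \<omega>) \<partial>M) / (\<integral>\<omega>. excess_test (\<lambda>_. 1) (u n) (elliptical_rv \<omega>) \<partial>M))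
        \<longlonglongrightarrow> (\<integral>w. F w \<partial>L.MW)" using \<kappa>(1) by simp
qed

text \<open>
  The factor is the reciprocal of the normalising constant of the Gaussian density. It is positive because
  the determinant of the Schur complement is, and it cancels in the survivor function.
\<close>

lemma gaussian_cond_zero_tied_orthant:
  assumes L: "limit_law I T rate D c"
  shows "\<exists>\<kappa>>0. \<forall>\<theta>. measure (gaussian_cond_zero S I) (limit_law.tied_orthant I T \<theta>) = \<kappa> * limit_law.gauss_mass I T D \<theta>"
proof -
  interpret L: limit_law I T rate D c by (rule L)
  define s where "s = sqrt ((2 * pi) ^ card (- I) * sub_det (schur_compl S I) (- I))"
  have s: "0 < s" unfolding s_def using sub_det_pos[OF schur(4)] by simp
  have g: "gaussian_cond_zero S I = density L.lebJ (\<lambda>z. ennreal (L.gauss_weight z / s))"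
    unfolding gaussian_cond_zero_def gaussian_law_def L.gauss_weight_def s_def unfolding D_def ..
  show ?thesis
  proof (intro exI[of _ "1 / s"] conjI allI)
    fix \<theta>
    have "emeasure (gaussian_cond_zero S I) (L.tied_orthant \<theta>) = (\<integral>\<^sup>+ z. ennreal (L.gauss_weight z / s) * indicator (L.tied_orthant \<theta>) z \<partial>L.lebJ)"
      unfolding g by (rule emeasure_density) measurable
    also have "\<dots> = (\<integral>\<^sup>+ z. ennreal (1 / s) * (ennreal (L.gauss_weight z) * indicator (L.tied_orthant \<theta>) z) \<partial>L.lebJ)"
      using s L.gauss_weight_pos by (intro nn_integral_cong) (simp add: mult.assoc[symmetric] ennreal_mult[symmetric] less_imp_le)
    also have "\<dots> = ennreal (1 / s) * ennreal (L.gauss_mass \<theta>)"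
      by (subst nn_integral_cmult) (auto simp: L.gauss_mass_nn)
    also have "\<dots> = ennreal (1 / s * L.gauss_mass \<theta>)"
      using s by (intro ennreal_mult[symmetric]) (auto simp: L.gauss_mass_def L.gauss_weight_pos less_imp_le intro!: integral_nonneg_AE)
    finally show "measure (gaussian_cond_zero S I) (L.tied_orthant \<theta>) = 1 / s * L.gauss_mass \<theta>"
      using s unfolding measure_def by (simp add: L.gauss_mass_def L.gauss_weight_pos less_imp_le integral_nonneg_AE)
  qed (use s in simp)
qed

end

lemma (in prob_space) integral_uniform_measure:
  fixes f :: "'a \<Rightarrow> real"
  assumes E[measurable]: "E \<in> events" and p: "0 < prob E" and f[measurable]: "f \<in> borel_measurable M"
  shows "(\<integral>x. f x \<partial>uniform_measure M E) = (\<integral>x. f x * indicator E x \<partial>M) / prob E"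
proof -
  have "indicator E x / emeasure M E = ennreal (indicator E x / prob E)" for x
    using p by (cases "x \<in> E") (simp_all add: emeasure_eq_measure divide_ennreal[symmetric])
  then have "uniform_measure M E = density M (\<lambda>x. ennreal (indicator E x / prob E))"
    unfolding uniform_measure_def by (simp only:)
  then have "(\<integral>x. f x \<partial>uniform_measure M E) = (\<integral>x. indicator E x / prob E * f x \<partial>M)"
    by (simp add: integral_density)
  also have "\<dots> = (\<integral>x. f x * indicator E x / prob E \<partial>M)" by (simp add: mult.commute)
  finally show ?thesis by simp
qed

theorem theorem4p1:
  fixes A S :: "real ^ 'k ^ 'k::finite"
    and M :: "'m measure" and R :: "'m \<Rightarrow> real" and U :: "'m \<Rightarrow> real ^ 'k"
    and MX :: "'x measure" and X :: "'x \<Rightarrow> real ^ 'k"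
    and MV :: "nat \<Rightarrow> 'v measure" and V :: "nat \<Rightarrow> 'v \<Rightarrow> real ^ 'k"
    and \<delta> p q N :: real and t :: "nat \<Rightarrow> real" and a :: "real ^ 'k" and I J :: "'k set"
    and v :: "nat \<Rightarrow> real ^ 'k"
  assumes k_ge_2: "2 \<le> CARD('k)"
    and A_nonsingular: "invertible A"
    and S_eq: "S = transpose A ** A"
    and S_corr: "correlation_matrix S"
    and prob_M: "prob_space M"
    and R_rv: "R \<in> borel_measurable M"
    and U_rv: "U \<in> borel_measurable M"
    and U_unif: "distr M borel U = sphere_uniform"
    and R_pos: "AE \<omega> in M. 0 < R \<omega>"
    and R_U_indep: "indep_rv M R U"
    and params: "0 < \<delta>" "0 < p" "0 < q"
    and R_tail: "(\<lambda>u. measure M {\<omega> \<in> space M. u < R \<omega>})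
                   \<sim>[at_top] (\<lambda>u. p * u powr N * exp (- q * u powr \<delta>))"
    and prob_MX: "prob_space MX"
    and X_rv: "X \<in> borel_measurable MX"
    and X_law: "distr MX borel X = distr M borel (\<lambda>\<omega>. transpose A *v (R \<omega> *\<^sub>R U \<omega>))"
    and t_pos: "\<And>n. 1 \<le> n \<Longrightarrow> 0 < t n"
    and t_lim: "filterlim t at_top sequentially"
    and a_pos: "\<exists>i. 0 < a $ i"
    and I_min: "minimal_index_set S a I"
    and J_eq: "J = UNIV - I"
    and v_I: "\<And>n i. 1 \<le> n \<Longrightarrow> i \<in> I \<Longrightarrow>
                v n $ i = q * \<delta> * (t n * sub_norm S I a) powr (\<delta> - 1)"
    and v_J: "\<And>n j. 1 \<le> n \<Longrightarrow> j \<in> J \<Longrightarrow>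
                v n $ j = sqrt (q * \<delta>) * (t n * sub_norm S I a) powr (\<delta> / 2 - 1)"
    and prob_MV: "\<And>n. 1 \<le> n \<Longrightarrow> prob_space (MV n)"
    and V_rv: "\<And>n. 1 \<le> n \<Longrightarrow> V n \<in> borel_measurable (MV n)"
    and V_law: "\<And>n. 1 \<le> n \<Longrightarrow> distr (MV n) borel (V n) = excess_law MX X (t n *\<^sub>R a)"
  shows "\<exists>(MW :: ('k \<Rightarrow> ereal) measure) (W :: ('k \<Rightarrow> ereal) \<Rightarrow> 'k \<Rightarrow> ereal).
      prob_space MW \<and> W \<in> borel_measurable MW \<and>
      weak_limit (\<lambda>n. distr (MV n) borel (\<lambda>\<omega> i. ereal (v n $ i * V n \<omega> $ i))) (distr MW borel W) \<and>
      prob_space.indep_vars MW (\<lambda>_. borel) (\<lambda>i \<omega>. W \<omega> i) I \<and>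
      (\<forall>i\<in>I. \<forall>s>0. measure MW {\<omega> \<in> space MW. ereal s < W \<omega> i}
          = exp (- s * (subvec a I \<bullet> (sub_inv S I *v axis i 1)) / sub_norm S I a)) \<and>
      (card I < CARD('k) \<longrightarrow>
         prob_space.indep_var MW (\<Pi>\<^sub>M i\<in>I. borel) (\<lambda>\<omega>. restrict (W \<omega>) I)
                                 (\<Pi>\<^sub>M j\<in>J. borel) (\<lambda>\<omega>. restrict (W \<omega>) J) \<and>
         (\<forall>(x :: real ^ 'k) L. (\<forall>i. 0 \<le> x $ i) \<and> L \<subseteq> J \<longrightarrow>
            measure MW {\<omega> \<in> space MW. \<forall>j\<in>L. ereal (x $ j) < W \<omega> j}
              = measure (gaussian_cond_zero S I)
                  {z \<in> space (gaussian_cond_zero S I). \<forall>j\<in>J.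
                     \<infinity> * ereal (a $ j - (submat S J I *v (sub_inv S I *v subvec a I)) $ j)
                       + ereal (subvec x L $ j) < ereal (z j)}
                / measure (gaussian_cond_zero S I)
                  {z \<in> space (gaussian_cond_zero S I). \<forall>j\<in>J.
                     \<infinity> * ereal (a $ j - (submat S J I *v (sub_inv S I *v subvec a I)) $ j)
                       < ereal (z j)}))"
proof -
  define al where "al = sub_norm S I a"
  note B0 = sub_inv_laws[OF correlation_matrix_posdef_on[OF S_corr], of I]
  obtain y where I_ne: "I \<noteq> {}" and yI: "\<And>i. i \<in> I \<Longrightarrow> y $ i = a $ i"
    and lam0: "\<And>i. i \<in> I \<Longrightarrow> 0 < (sub_inv S I *v subvec a I) $ i"
    and pos: "0 < subvec a I \<bullet> (sub_inv S I *v subvec a I)"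
    and yJ: "\<And>j. j \<notin> I \<Longrightarrow> y $ j = (submat S (- I) I *v (sub_inv S I *v subvec a I)) $ j \<and> a $ j \<le> y $ j"
    using I_min unfolding minimal_index_set_def by auto
  have al: "0 < al" "al * al = subvec a I \<bullet> (sub_inv S I *v subvec a I)"
    using pos by (simp_all add: al_def sub_norm_def)
  define b where "b = (1 / al) *\<^sub>R y"
  \<comment> \<open>Both the threshold and the minimiser are normalised, so that the radial level is u n = t n * al.\<close>
  define a' where "a' = (1 / al) *\<^sub>R a"
  have bI: "subvec b I = (1 / al) *\<^sub>R subvec a I" using yI by (simp add: b_def subvec_def vec_eq_iff)
  interpret K: kotz_threshold A S I b M R U \<delta> p q N a'
  proof (intro kotz_threshold.intro kotz.intro kotz_threshold_axioms.intro)
    show "invertible A" "S = transpose A ** A" "prob_space M" "R \<in> borel_measurable M" "U \<in> borel_measurable M"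
      "distr M borel U = sphere_uniform" "AE \<omega> in M. 0 < R \<omega>" "indep_rv M R U" "0 < p" "0 < q" "0 < \<delta>" "I \<noteq> {}"
      by fact+
    show "posdef_on UNIV S" by (rule correlation_matrix_posdef_on[OF S_corr])
    show "(\<lambda>u. measure M {\<omega> \<in> space M. u < R \<omega>}) \<sim>[at_top] weibull_tail p N q \<delta>" by (rule R_tail)
    show "0 < (sub_inv S I *v subvec b I) $ i" if "i \<in> I" for i
      using lam0[OF that] al by (simp add: bI matrix_vector_mult_scaleR)
    show "subvec b I \<bullet> (sub_inv S I *v subvec b I) = 1"
      using al by (simp add: bI matrix_vector_mult_scaleR al(2)[symmetric])
    show "subvec b (- I) = submat S (- I) I *v (sub_inv S I *v subvec b I)"
    proof -
      have "subvec y (- I) $ j = (submat S (- I) I *v (sub_inv S I *v subvec a I)) $ j" for j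
        using yJ[of j] by (cases "j \<in> I") (simp_all add: subvec_def submat_def matrix_vector_mult_def)
      then have "subvec y (- I) = submat S (- I) I *v (sub_inv S I *v subvec a I)" by (simp add: vec_eq_iff)
      moreover have "subvec b (- I) = (1 / al) *\<^sub>R subvec y (- I)" by (simp add: b_def subvec_def vec_eq_iff)
      ultimately show ?thesis by (simp add: bI matrix_vector_mult_scaleR)
    qed
    show "a' $ i = b $ i" if "i \<in> I" for i using yI[OF that] by (simp add: a'_def b_def)
    show "a' $ i \<le> b $ i" for i using yI[of i] yJ[of i] al by (cases "i \<in> I") (auto simp: a'_def b_def divide_right_mono)
  qed
  obtain c where L: "limit_law I K.T K.rate K.D c" using K.limit_law_exists by blast
  interpret L: limit_law I K.T K.rate K.D c by (rule L)
  interpret MX: prob_space MX by (rule prob_MX)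
  have Jc: "J = - I" using J_eq by auto
  define u where "u n = t n * al" for n
  have u: "filterlim u at_top sequentially"
    unfolding u_def using filterlim_tendsto_pos_mult_at_top[OF tendsto_const al(1) t_lim] by (simp add: mult.commute)
  have u0: "0 < u n" if "1 \<le> n" for n using t_pos[OF that] al by (simp add: u_def)
  have norming: "v n $ i = K.norming (u n) i" if n: "1 \<le> n" for n i
  proof (cases "i \<in> I")
    case True
    then show ?thesis unfolding v_I[OF n True] K.norming_def K.speed_def al_def[symmetric] u_def[symmetric]
      using u0[OF n] by (simp add: powr_diff)
  next
    case False
    then have "i \<in> J" by (simp add: Jc)
    have "sqrt (u n powr \<delta>) = u n powr (\<delta> / 2)" using u0[OF n] by (simp add: powr_half_sqrt[symmetric] powr_powr)
    then show ?thesis unfolding v_J[OF n \<open>i \<in> J\<close>] K.norming_def K.speed_def al_def[symmetric] u_def[symmetric]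
      using False u0[OF n] params by (simp add: powr_diff real_sqrt_mult)
  qed
  have vpos: "0 < K.norming (u n) i" if "1 \<le> n" for n i
    unfolding K.norming_def using u0[OF that] K.speed_pos[OF u0[OF that]] by simp
  have scaled_excess: "K.scaled_excess (u n) x i = v n $ i * (x $ i - t n * a $ i)" if "1 \<le> n" for n x i
    unfolding K.scaled_excess_def norming[OF that] using al by (simp add: u_def a'_def)
  have Qpos: "(\<forall>i. 0 < K.scaled_excess (u n) x i) \<longleftrightarrow> (\<forall>i. (t n *\<^sub>R a) $ i < x $ i)" if "1 \<le> n" for n x
  proof -
    have "0 < K.scaled_excess (u n) x i \<longleftrightarrow> (t n *\<^sub>R a) $ i < x $ i" for i
      unfolding scaled_excess[OF that] norming[OF that] using vpos[OF that, of i] by (simp add: zero_less_mult_iff)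
    then show ?thesis by simp
  qed
  let ?N = "\<lambda>F n. \<integral>\<omega>. K.excess_test F (u n) (K.elliptical_rv \<omega>) \<partial>M"
  have distrX: "distr MX borel X = distr M borel K.elliptical_rv" using X_law unfolding K.elliptical_rv_def[abs_def] .
  have N_MX: "?N F n = (\<integral>\<omega>. K.excess_test F (u n) (X \<omega>) \<partial>MX)" if [measurable]: "F \<in> borel_measurable borel" for F n
  proof -
    have Pm: "K.excess_test F (u n) \<in> borel_measurable borel" by (rule K.excess_test_measurable) fact
    have "?N F n = (\<integral>x. K.excess_test F (u n) x \<partial>distr M borel K.elliptical_rv)" by (rule integral_distr[symmetric]) (simp_all add: Pm)
    also have "\<dots> = (\<integral>\<omega>. K.excess_test F (u n) (X \<omega>) \<partial>MX)" unfolding distrX[symmetric] by (rule integral_distr) (simp_all add: Pm X_rv)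
    finally show ?thesis .
  qed
  let ?nu = "\<lambda>n. distr (MV n) borel (\<lambda>\<omega> i. ereal (v n $ i * V n \<omega> $ i))"
  have Wm: "(\<lambda>x :: real^'k. (\<lambda>i. ereal (v n $ i * x $ i))) \<in> borel_measurable borel" for n
    by (rule borel_measurable_funI) measurable
  have nu: "(\<integral>w. F w \<partial>?nu n) = ?N F n / ?N (\<lambda>_. 1) n"
    if Fm[measurable]: "F \<in> borel_measurable borel" and n: "1 \<le> n" and p: "0 < ?N (\<lambda>_. 1) n" for F :: "('k \<Rightarrow> ereal) \<Rightarrow> real" and n
  proof -
    note X_rv[measurable] and V_rv[OF n, measurable] and Wm[measurable]
    let ?E = "{\<omega> \<in> space MX. \<forall>i. (t n *\<^sub>R a) $ i < X \<omega> $ i}"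
    have E[measurable]: "?E \<in> sets MX" by measurable
    have ind: "of_bool (\<forall>i. 0 < K.scaled_excess (u n) (X \<omega>) i) = (indicator ?E \<omega> :: real)" if "\<omega> \<in> space MX" for \<omega>
      using that unfolding Qpos[OF n] by (simp add: indicator_def)
    have pE: "?N (\<lambda>_. 1) n = MX.prob ?E"
    proof -
      have "?N (\<lambda>_. 1) n = (\<integral>\<omega>. K.excess_test (\<lambda>_. 1) (u n) (X \<omega>) \<partial>MX)" by (rule N_MX) simp
      also have "\<dots> = (\<integral>\<omega>. indicator ?E \<omega> \<partial>MX)"
        unfolding K.excess_test_def by (intro Bochner_Integration.integral_cong refl) (simp only: ind mult_1)
      finally show ?thesis using E by simp
    qed
    let ?g = "\<lambda>x :: real^'k. F (\<lambda>i. ereal (v n $ i * x $ i))"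
    have "(\<integral>w. F w \<partial>?nu n) = (\<integral>\<omega>. ?g (V n \<omega>) \<partial>MV n)" by (rule integral_distr) measurable
    also have "\<dots> = (\<integral>x. ?g x \<partial>distr (MV n) borel (V n))" by (rule integral_distr[symmetric]) measurable
    also have "\<dots> = (\<integral>\<omega>. ?g (X \<omega> - t n *\<^sub>R a) \<partial>uniform_measure MX ?E)"
      unfolding V_law[OF n] excess_law_def by (rule integral_distr) measurable
    also have "\<dots> = (\<integral>\<omega>. ?g (X \<omega> - t n *\<^sub>R a) * indicator ?E \<omega> \<partial>MX) / MX.prob ?E"
    proof (rule MX.integral_uniform_measure[OF E])
      show "0 < MX.prob ?E" using p pE by simp
      have "?g \<in> borel_measurable borel" by (rule measurable_compose[OF Wm Fm])
      then show "(\<lambda>\<omega>. ?g (X \<omega> - t n *\<^sub>R a)) \<in> borel_measurable MX" by (rule measurable_compose[rotated]) measurable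
    qed
    also have "(\<integral>\<omega>. ?g (X \<omega> - t n *\<^sub>R a) * indicator ?E \<omega> \<partial>MX) = ?N F n"
      unfolding N_MX[OF Fm] unfolding K.excess_test_def
    proof (intro Bochner_Integration.integral_cong refl)
      fix \<omega> assume "\<omega> \<in> space MX"
      then show "?g (X \<omega> - t n *\<^sub>R a) * indicator ?E \<omega>
        = F (\<lambda>i. ereal (K.scaled_excess (u n) (X \<omega>) i)) * of_bool (\<forall>i. 0 < K.scaled_excess (u n) (X \<omega>) i)"
        unfolding ind[OF \<open>\<omega> \<in> space MX\<close>] by (simp add: scaled_excess[OF n])
    qed
    finally show ?thesis unfolding pE .
  qed
  have nn: "(\<lambda>n. \<integral>w. F w \<partial>?nu n) \<longlonglongrightarrow> (\<integral>w. F w \<partial>L.MW)"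
    if F: "continuous_on UNIV F" "\<And>w. 0 \<le> F w \<and> F w \<le> K" for F :: "('k \<Rightarrow> ereal) \<Rightarrow> real" and K
  proof -
    have Fm: "F \<in> borel_measurable borel" by (rule borel_measurable_continuous_onI[OF F(1)])
    have "\<forall>\<^sub>F n in sequentially. ?N F n / ?N (\<lambda>_. 1) n = (\<integral>w. F w \<partial>?nu n)"
      using K.normalised_convergence(1)[OF u] eventually_ge_at_top[of 1] by eventually_elim (simp add: nu[OF Fm])
    with K.normalised_convergence(2)[OF u F] show ?thesis by (rule Lim_transform_eventually)
  qed
  have weak: "weak_limit ?nu L.MW"
    unfolding weak_limit_def
  proof (intro allI impI, elim conjE)
    fix F :: "('k \<Rightarrow> ereal) \<Rightarrow> real" assume F: "continuous_on UNIV F" "bounded (range F)"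
    obtain K where K: "\<And>w. \<bar>F w\<bar> \<le> K" using F(2) by (auto simp: bounded_iff)
    have Fm[measurable]: "F \<in> borel_measurable borel" by (rule borel_measurable_continuous_onI[OF F(1)])
    have shift: "(\<integral>w. F w + K \<partial>\<nu>) = (\<integral>w. F w \<partial>\<nu>) + K" if "prob_space \<nu>" "sets \<nu> = sets borel" for \<nu>
    proof -
      interpret N: prob_space \<nu> by fact
      have "F \<in> borel_measurable \<nu>" using that(2) measurable_cong_sets[OF that(2) refl] Fm by blast
      then have "integrable \<nu> F" using K by (intro N.integrable_const_bound[of _ K]) auto
      then show ?thesis by (simp add: N.prob_space)
    qed
    have "(\<lambda>n. \<integral>w. F w + K \<partial>?nu n) \<longlonglongrightarrow> (\<integral>w. F w + K \<partial>L.MW)"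
    proof (rule nn)
      show "continuous_on UNIV (\<lambda>w. F w + K)" by (intro continuous_intros F(1))
      show "0 \<le> F w + K \<and> F w + K \<le> 2 * K" for w using K[of w] by (auto simp: abs_le_iff)
    qed
    moreover have "\<forall>\<^sub>F n in sequentially. (\<integral>w. F w + K \<partial>?nu n) = (\<integral>w. F w \<partial>?nu n) + K"
      using eventually_ge_at_top[of 1]
    proof eventually_elim
      case (elim n)
      interpret V: prob_space "MV n" by (rule prob_MV[OF elim])
      show ?case
        by (rule shift) (auto intro!: V.prob_space_distr measurable_compose[OF V_rv[OF elim] Wm])
    qed
    ultimately have "(\<lambda>n. (\<integral>w. F w \<partial>?nu n) + K) \<longlonglongrightarrow> (\<integral>w. F w \<partial>L.MW) + K"
      unfolding shift[OF L.prob_MW L.sets_MW] by (rule Lim_transform_eventually)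
    then show "(\<lambda>n. \<integral>w. F w \<partial>?nu n) \<longlonglongrightarrow> (\<integral>w. F w \<partial>L.MW)" by (simp add: tendsto_add_const_iff add.commute[of _ K])
  qed
  have rate: "K.rate i = subvec a I \<bullet> (sub_inv S I *v axis i 1) / sub_norm S I a" for i
  proof -
    have "subvec a I \<bullet> (sub_inv S I *v axis i 1) = (sub_inv S I *v subvec a I) \<bullet> axis i 1"
      by (rule inner_matrix_sym[OF B0(5)])
    then show ?thesis unfolding K.rate_def K.B_def bI
      by (simp add: matrix_vector_mult_scaleR inner_axis al_def)
  qed
  obtain \<kappa> where \<kappa>: "0 < \<kappa>" "\<And>\<theta>. measure (gaussian_cond_zero S I) (L.tied_orthant \<theta>) = \<kappa> * L.gauss_mass \<theta>"
    using K.gaussian_cond_zero_tied_orthant[OF L] by blast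
  \<comment> \<open>An index with strict inequality gives the threshold - \<infinity>, and a tied index gives \<infinity> * 0 = 0.\<close>
  have set_eq: "{z \<in> space (gaussian_cond_zero S I). \<forall>j\<in>J.
       \<infinity> * ereal (a $ j - (submat S J I *v (sub_inv S I *v subvec a I)) $ j) + ereal (\<theta> j) < ereal (z j)} = L.tied_orthant \<theta>" for \<theta>
  proof -
    have sp: "space (gaussian_cond_zero S I) = space L.lebJ" unfolding gaussian_cond_zero_def gaussian_law_def by simp
    have "(\<infinity> * ereal (a $ j - (submat S J I *v (sub_inv S I *v subvec a I)) $ j) + ereal (\<theta> j) < ereal (z j)) \<longleftrightarrow> (j \<in> K.T \<longrightarrow> \<theta> j < z j)"
      if j: "j \<in> J" for j z
    proof -
      have jI: "j \<notin> I" using j Jc by simp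
      let ?d = "a $ j - (submat S J I *v (sub_inv S I *v subvec a I)) $ j"
      have d: "?d = a $ j - y $ j" "a $ j \<le> y $ j" using yJ[OF jI] unfolding Jc by auto
      have T: "j \<in> K.T \<longleftrightarrow> a $ j = y $ j" using jI al unfolding K.T_def unfolding a'_def b_def by simp
      show ?thesis
      proof (cases "a $ j = y $ j")
        case True
        then show ?thesis unfolding d(1) T by (simp add: zero_ereal_def[symmetric])
      next
        case False
        then have "?d < 0" using d by simp
        then have "\<infinity> * ereal ?d = - \<infinity>" by simp
        then show ?thesis using False T by simp
      qed
    qed
    then show ?thesis unfolding L.tied_orthant_def sp using L.T Jc by auto
  qed
  have set_eq0: "{z \<in> space (gaussian_cond_zero S I). \<forall>j\<in>J.
       \<infinity> * ereal (a $ j - (submat S J I *v (sub_inv S I *v subvec a I)) $ j) < ereal (z j)} = L.tied_orthant (\<lambda>_. 0)"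
    using set_eq[of "\<lambda>_. 0"] by (simp add: zero_ereal_def[symmetric])
  show ?thesis
  proof (intro exI[of _ L.MW] exI[of _ "\<lambda>\<omega>. \<omega>"] conjI ballI allI impI)
    show "prob_space L.MW" by (rule L.prob_MW)
    show "(\<lambda>\<omega>. \<omega>) \<in> borel_measurable L.MW" by (simp add: measurable_ident_sets[OF L.sets_MW])
    have "distr L.MW borel (\<lambda>\<omega>. \<omega>) = L.MW" by (rule distr_id2) (simp add: L.sets_MW)
    then show "weak_limit ?nu (distr L.MW borel (\<lambda>\<omega>. \<omega>))" using weak by simp
    show "L.MW.indep_vars (\<lambda>_. borel) (\<lambda>i \<omega>. \<omega> i) I" by (rule L.MW_indep_I)
    show "measure L.MW {\<omega> \<in> space L.MW. ereal s < \<omega> i} = exp (- s * (subvec a I \<bullet> (sub_inv S I *v axis i 1)) / sub_norm S I a)"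
      if "i \<in> I" "0 < s" for i s
      using L.MW_survivor_I[OF that] unfolding rate by simp
    show "L.MW.indep_var (\<Pi>\<^sub>M i\<in>I. borel) (\<lambda>\<omega>. restrict \<omega> I) (\<Pi>\<^sub>M j\<in>J. borel) (\<lambda>\<omega>. restrict \<omega> J)"
      unfolding Jc by (rule L.MW_indep_IJ)
    fix x :: "real^'k" and L' assume xL: "(\<forall>i. 0 \<le> x $ i) \<and> L' \<subseteq> J"
    have sv: "($) (subvec x L') = (\<lambda>j. if j \<in> L' then x $ j else 0)" by (simp add: subvec_def fun_eq_iff)
    show "measure L.MW {\<omega> \<in> space L.MW. \<forall>j\<in>L'. ereal (x $ j) < \<omega> j}
      = measure (gaussian_cond_zero S I) {z \<in> space (gaussian_cond_zero S I). \<forall>j\<in>J.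
          \<infinity> * ereal (a $ j - (submat S J I *v (sub_inv S I *v subvec a I)) $ j) + ereal (subvec x L' $ j) < ereal (z j)}
        / measure (gaussian_cond_zero S I) {z \<in> space (gaussian_cond_zero S I). \<forall>j\<in>J.
          \<infinity> * ereal (a $ j - (submat S J I *v (sub_inv S I *v subvec a I)) $ j) < ereal (z j)}"
      unfolding set_eq0 set_eq[of "\<lambda>j. subvec x L' $ j"] \<kappa>(2)
      using L.MW_survivor_J[of "\<lambda>j. x $ j" L'] xL \<kappa>(1) Jc by (simp add: sv)
  qed
qed

end
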